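(* Let $n\in\mathbb{Z}_{>0}$ and $k\in\mathbb{Z}_{\ge0}$, and let $V$ be a complex vector space with basis $v_1,\ldots,v_n$. Let $S_m^\lambda$ denote the irreducible $S_m$-module indexed by the partition $\lambda$ of $m$. (a) As $(\mathbb{C}S_n,\mathbb{C}A_k(n))$-bimodules, $$V^{\otimes k}\cong\bigoplus_{\lambda\in\hat A_k(n)}S_n^\lambda\otimes A_k^\lambda(n),$$ where the vector spaces $A_k^\lambda(n)$ are irreducible $\mathbb{C}A_k(n)$-modules and $\dim(A_k^\lambda(n))$ is the number of paths from $(n)\in\hat A_0(n)$ to $\lambda\in\hat A_k(n)$ in the graph $\hat A(n)$. (b) As $(\mathbb{C}S_{n-1},\mathbb{C}A_{k+\frac12}(n))$-bimodules, $$V^{\otimes k}\cong\bigoplus_{\mu\in\hat A_{k+\frac12}(n)}S_{n-1}^\mu\otimes A_{k+\frac12}^\mu(n),$$ where the vector spaces $A_{k+\frac12}^\mu(n)$ are irreducible $\mathbb{C}A_{k+\frac12}(n)$-modules and $\dim(A_{k+\frac12}^\mu(n))$ is the number of paths from $(n)\in\hat A_0(n)$ to $\mu\in\hat A_{k+\frac12}(n)$ in the graph $\hat A(n)$.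
   Context: For an integer $k\ge0$, $A_k$ is the set of set partitions of $\{1,\ldots,k,1',\ldots,k'\}$, and $A_{k+\frac12}$ is the set of $d\in A_{k+1}$ in which $k+1$ and $(k+1)'$ are in the same block. The partition algebra $\mathbb{C}A_k(n)$ (resp. $\mathbb{C}A_{k+\frac12}(n)$) has basis $A_k$ (resp. $A_{k+\frac12}$) and product $d_1d_2=n^\ell(d_1\circ d_2)$, where $d_1\circ d_2$ is obtained by stacking $d_1$ above $d_2$, identifying the bottom (primed) vertices of $d_1$ with the top (unprimed) vertices of $d_2$, and removing the $\ell$ connected components lying entirely in the middle row. Actions: $S_n$ acts by $\sigma(v_{i_1}\otimes\cdots\otimes v_{i_k})=v_{\sigma(i_1)}\otimes\cdots\otimes v_{\sigma(i_k)}$, and $S_{n-1}\subseteq S_n$ is the stabilizer of $n$. $\mathbb{C}A_k(n)$ acts (as a right action, commuting with $S_n$) by sending $v_{i_1}\otimes\cdots\otimes v_{i_k}$ under $d\in A_k$ to the sum of $v_{i_{1'}}\otimes\cdots\otimes v_{i_{k'}}$ over all $i_{1'},\ldots,i_{k'}\in\{1,\ldots,n\}$ such that $i_r=i_s$ whenever $r,s$ are in the same block of $d$. $\mathbb{C}A_{k+\frac12}(n)$ acts on $V^{\otimes k}\cong V^{\otimes k}\otimes v_n\subseteq V^{\otimes(k+1)}$ by restricting the action of $\mathbb{C}A_{k+1}(n)$. For a partition $\lambda=(\lambda_1,\lambda_2,\ldots,\lambda_\ell)$ let $\lambda_{>1}=(\lambda_2,\ldots,\lambda_\ell)$. The graph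 $\hat A(n)$ has, for integers $k\ge0$, vertices on level $k$: $\hat A_k(n)=\{\lambda\vdash n: |\lambda_{>1}|\le k\}$, and on level $k+\frac12$: $\hat A_{k+\frac12}(n)=\{\mu\vdash n-1: |\mu_{>1}|\le k\}$. There is an edge from $\lambda\in\hat A_k(n)$ to $\mu\in\hat A_{k+\frac12}(n)$ if $\mu$ is obtained from $\lambda$ by removing a box, and an edge from $\mu\in\hat A_{k+\frac12}(n)$ to $\lambda\in\hat A_{k+1}(n)$ if $\lambda$ is obtained from $\mu$ by adding a box. Paths pass through successive levels $0,\frac12,1,\ldots$. *)

theory Defs
  imports
    Complex_Main
    "HOL-Library.Function_Algebras"
    "HOL-Library.Disjoint_Sets"
    "HOL-Algebra.Module"
    "HOL-Algebra.Sym_Groups"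
begin

section \<open>Complex vector spaces\<close>

text \<open>All vector spaces are subspaces of a space of functions \<open>'x \<Rightarrow> complex\<close> with pointwise
  operations (the module structure on functions comes from \<open>Function_Algebras\<close>). A space with
  a basis indexed by a finite set \<open>X\<close> is modelled by the functions vanishing outside \<open>X\<close>, the
  basis vector of \<open>x\<close> being \<open>basis_vec x\<close>.\<close>

definition fscale :: "complex \<Rightarrow> ('x \<Rightarrow> complex) \<Rightarrow> 'x \<Rightarrow> complex" where
  "fscale c f = (\<lambda>x. c * f x)"

global_interpretation cfun: vector_space "fscale :: complex \<Rightarrow> ('x \<Rightarrow> complex) \<Rightarrow> 'x \<Rightarrow> complex"
  by unfold_locales (auto simp: fscale_def fun_eq_iff algebra_simps)

definition basis_vec :: "'x \<Rightarrow> 'x \<Rightarrow> complex" where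
  "basis_vec x = (\<lambda>y. if y = x then 1 else 0)"

definition free_space :: "'x set \<Rightarrow> ('x \<Rightarrow> complex) set" where
  "free_space X = {f. \<forall>x. x \<notin> X \<longrightarrow> f x = 0}"

definition linear_on :: "('x \<Rightarrow> complex) set \<Rightarrow> (('x \<Rightarrow> complex) \<Rightarrow> ('y \<Rightarrow> complex)) \<Rightarrow> bool" where
  "linear_on W \<Phi> \<longleftrightarrow>
     (\<forall>v\<in>W. \<forall>w\<in>W. \<Phi> (v + w) = \<Phi> v + \<Phi> w) \<and> (\<forall>c. \<forall>w\<in>W. \<Phi> (fscale c w) = fscale c (\<Phi> w))"

section \<open>Algebras, modules and bimodules\<close>

text \<open>The complex algebra with finite basis \<open>B\<close>, product \<open>b\<^sub>1 b\<^sub>2 = q b\<^sub>1 b\<^sub>2 \<cdot> (m b\<^sub>1 b\<^sub>2)\<close> and unit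
  \<open>e \<in> B\<close>. Only the record type of the library theory \<open>Module\<close> is used: its locales for modules
  and algebras require commutativity.\<close>

definition based_algebra ::
    "'b set \<Rightarrow> ('b \<Rightarrow> 'b \<Rightarrow> 'b) \<Rightarrow> ('b \<Rightarrow> 'b \<Rightarrow> complex) \<Rightarrow> 'b \<Rightarrow> (complex, 'b \<Rightarrow> complex) module" where
  "based_algebra B m q e =
     \<lparr> carrier = free_space B,
       monoid.mult = (\<lambda>f g. \<Sum>b1\<in>B. \<Sum>b2\<in>B. fscale (f b1 * g b2 * q b1 b2) (basis_vec (m b1 b2))),
       one = basis_vec e,
       zero = 0,
       add = (+),
       smult = fscale \<rparr>"

definition group_algebra :: "'g monoid \<Rightarrow> (complex, 'g \<Rightarrow> complex) module" where
  "group_algebra G = based_algebra (carrier G) (monoid.mult G) (\<lambda>_ _. 1) (one G)"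

text \<open>A record of this type represents a left or a right module, according to the predicate
  applied to it; in a right module \<open>mact M a w\<close> stands for \<open>w \<cdot> a\<close>.\<close>

record ('a, 'x) amod =
  mspace :: "('x \<Rightarrow> complex) set"
  mact :: "'a \<Rightarrow> ('x \<Rightarrow> complex) \<Rightarrow> 'x \<Rightarrow> complex"

text \<open>The part of the module axioms which does not involve the order of multiplication.\<close>

definition bilinear_action :: "(complex, 'a) module \<Rightarrow> ('a, 'x) amod \<Rightarrow> bool" where
  "bilinear_action R M \<longleftrightarrow>
     cfun.subspace (mspace M) \<and>
     (\<forall>a\<in>carrier R. mact M a ` mspace M \<subseteq> mspace M \<and> linear_on (mspace M) (mact M a)) \<and>
     (\<forall>a\<in>carrier R. \<forall>b\<in>carrier R. \<forall>w\<in>mspace M. mact M (add R a b) w = mact M a w + mact M b w) \<and>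
     (\<forall>c. \<forall>a\<in>carrier R. \<forall>w\<in>mspace M. mact M (smult R c a) w = fscale c (mact M a w)) \<and>
     (\<forall>w\<in>mspace M. mact M (one R) w = w)"

definition left_module :: "(complex, 'a) module \<Rightarrow> ('a, 'x) amod \<Rightarrow> bool" where
  "left_module R M \<longleftrightarrow> bilinear_action R M \<and>
     (\<forall>a\<in>carrier R. \<forall>b\<in>carrier R. \<forall>w\<in>mspace M.
        mact M (monoid.mult R a b) w = mact M a (mact M b w))"

definition right_module :: "(complex, 'a) module \<Rightarrow> ('a, 'x) amod \<Rightarrow> bool" where
  "right_module R M \<longleftrightarrow> bilinear_action R M \<and>
     (\<forall>a\<in>carrier R. \<forall>b\<in>carrier R. \<forall>w\<in>mspace M.
        mact M (monoid.mult R a b) w = mact M b (mact M a w))"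

definition irreducible_right_module :: "(complex, 'a) module \<Rightarrow> ('a, 'x) amod \<Rightarrow> bool" where
  "irreducible_right_module R M \<longleftrightarrow> right_module R M \<and> mspace M \<noteq> {0} \<and>
     (\<forall>U. cfun.subspace U \<and> U \<subseteq> mspace M \<and> (\<forall>a\<in>carrier R. mact M a ` U \<subseteq> U)
          \<longrightarrow> U = {0} \<or> U = mspace M)"

definition module_dim :: "('a, 'x) amod \<Rightarrow> nat" where
  "module_dim M = cfun.dim (mspace M)"

record ('a, 'b, 'x) bimod =
  bspace :: "('x \<Rightarrow> complex) set"
  lact :: "'a \<Rightarrow> ('x \<Rightarrow> complex) \<Rightarrow> 'x \<Rightarrow> complex"
  ract :: "'b \<Rightarrow> ('x \<Rightarrow> complex) \<Rightarrow> 'x \<Rightarrow> complex"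

definition bimodule ::
    "(complex, 'a) module \<Rightarrow> (complex, 'b) module \<Rightarrow> ('a, 'b, 'x) bimod \<Rightarrow> bool" where
  "bimodule R S M \<longleftrightarrow>
     left_module R \<lparr>mspace = bspace M, mact = lact M\<rparr> \<and>
     right_module S \<lparr>mspace = bspace M, mact = ract M\<rparr> \<and>
     (\<forall>a\<in>carrier R. \<forall>b\<in>carrier S. \<forall>w\<in>bspace M. ract M b (lact M a w) = lact M a (ract M b w))"

definition bimodule_isomorphic ::
    "(complex, 'a) module \<Rightarrow> (complex, 'b) module \<Rightarrow> ('a, 'b, 'x) bimod \<Rightarrow> ('a, 'b, 'y) bimod \<Rightarrow> bool"
  where
  "bimodule_isomorphic R S M N \<longleftrightarrow>
     bimodule R S M \<and> bimodule R S N \<and>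
     (\<exists>\<Phi>. bij_betw \<Phi> (bspace M) (bspace N) \<and> linear_on (bspace M) \<Phi> \<and>
          (\<forall>a\<in>carrier R. \<forall>w\<in>bspace M. \<Phi> (lact M a w) = lact N a (\<Phi> w)) \<and>
          (\<forall>b\<in>carrier S. \<forall>w\<in>bspace M. \<Phi> (ract M b w) = ract N b (\<Phi> w)))"

text \<open>The tensor product of \<open>W \<subseteq> \<complex>\<^sup>X\<close> and \<open>U \<subseteq> \<complex>\<^sup>Y\<close>, realised inside \<open>\<complex>\<^sup>X\<^sup>\<times>\<^sup>Y\<close> with \<open>w \<otimes> u\<close> the function
  \<open>(x, y) \<mapsto> w x * u y\<close>; the canonical map from the abstract tensor product is injective.
  For \<open>T\<close> in this space the slices \<open>T (_, y)\<close> and \<open>T (x, _)\<close> lie in \<open>W\<close> and \<open>U\<close>, and \<open>a \<otimes> 1\<close>,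
  \<open>1 \<otimes> b\<close> act on the slices.\<close>

definition outer_tensor :: "('a, 'x) amod \<Rightarrow> ('b, 'y) amod \<Rightarrow> ('a, 'b, 'x \<times> 'y) bimod" where
  "outer_tensor M N =
     \<lparr> bspace = cfun.span {\<lambda>(x, y). w x * u y | w u. w \<in> mspace M \<and> u \<in> mspace N},
       lact = (\<lambda>a T (x, y). mact M a (\<lambda>x'. T (x', y)) x),
       ract = (\<lambda>b T (x, y). mact N b (\<lambda>y'. T (x, y')) y) \<rparr>"

text \<open>External direct sum over a finite index set \<open>I\<close>: \<open>F\<close> has the components \<open>\<lambda>x. F (i, x)\<close>.\<close>

definition direct_sum :: "'i set \<Rightarrow> ('i \<Rightarrow> ('a, 'b, 'x) bimod) \<Rightarrow> ('a, 'b, 'i \<times> 'x) bimod" where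
  "direct_sum I M =
     \<lparr> bspace = {F. (\<forall>i\<in>I. (\<lambda>x. F (i, x)) \<in> bspace (M i)) \<and> (\<forall>i x. i \<notin> I \<longrightarrow> F (i, x) = 0)},
       lact = (\<lambda>a F (i, x). if i \<in> I then lact (M i) a (\<lambda>x'. F (i, x')) x else 0),
       ract = (\<lambda>b F (i, x). if i \<in> I then ract (M i) b (\<lambda>x'. F (i, x')) x else 0) \<rparr>"

section \<open>The partition algebra\<close>

text \<open>\<open>Top i\<close> is the vertex \<open>i\<close> and \<open>Bot i\<close> the vertex \<open>i'\<close>; \<open>Mid i\<close> only occurs in stacked diagrams.\<close>

datatype vertex = Top nat | Mid nat | Bot nat

definition diagrams :: "nat \<Rightarrow> vertex set set set" where
  "diagrams k = {d. partition_on (Top ` {1..k} \<union> Bot ` {1..k}) d}"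

definition half_diagrams :: "nat \<Rightarrow> vertex set set set" where
  "half_diagrams k = {d \<in> diagrams (k + 1). \<exists>b\<in>d. Top (k + 1) \<in> b \<and> Bot (k + 1) \<in> b}"

definition identity_diagram :: "nat \<Rightarrow> vertex set set" where
  "identity_diagram k = (\<lambda>i. {Top i, Bot i}) ` {1..k}"

fun as_upper :: "vertex \<Rightarrow> vertex" where
  "as_upper (Bot i) = Mid i"
| "as_upper v = v"

fun as_lower :: "vertex \<Rightarrow> vertex" where
  "as_lower (Top i) = Mid i"
| "as_lower v = v"

definition stacked_blocks :: "vertex set set \<Rightarrow> vertex set set \<Rightarrow> vertex set set" where
  "stacked_blocks d1 d2 = (image as_upper) ` d1 \<union> (image as_lower) ` d2"

definition stack_components :: "vertex set set \<Rightarrow> vertex set set \<Rightarrow> vertex set set" where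
  "stack_components d1 d2 =
     \<Union>(stacked_blocks d1 d2) // {(x, y). \<exists>b\<in>stacked_blocks d1 d2. x \<in> b \<and> y \<in> b}\<^sup>+"

definition diagram_comp :: "vertex set set \<Rightarrow> vertex set set \<Rightarrow> vertex set set" where
  "diagram_comp d1 d2 = (\<lambda>C. C - range Mid) ` stack_components d1 d2 - {{}}"

definition removed_components :: "vertex set set \<Rightarrow> vertex set set \<Rightarrow> nat" where
  "removed_components d1 d2 = card {C \<in> stack_components d1 d2. C \<subseteq> range Mid}"

definition partition_algebra :: "nat \<Rightarrow> nat \<Rightarrow> (complex, vertex set set \<Rightarrow> complex) module" where
  "partition_algebra k n =
     based_algebra (diagrams k) diagram_comp
       (\<lambda>d1 d2. of_nat n ^ removed_components d1 d2) (identity_diagram k)"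

definition half_partition_algebra :: "nat \<Rightarrow> nat \<Rightarrow> (complex, vertex set set \<Rightarrow> complex) module" where
  "half_partition_algebra k n =
     based_algebra (half_diagrams k) diagram_comp
       (\<lambda>d1 d2. of_nat n ^ removed_components d1 d2) (identity_diagram (k + 1))"

section \<open>The actions on tensor space\<close>

text \<open>The linear extension to \<open>\<complex>S\<^sub>m\<close> and to \<open>free_space X\<close> of an action \<open>act\<close> of \<open>S\<^sub>m\<close> on \<open>X\<close>.\<close>

definition perm_action ::
    "nat \<Rightarrow> 'x set \<Rightarrow> ((nat \<Rightarrow> nat) \<Rightarrow> 'x \<Rightarrow> 'x) \<Rightarrow> ((nat \<Rightarrow> nat) \<Rightarrow> complex) \<Rightarrow> ('x \<Rightarrow> complex)
       \<Rightarrow> 'x \<Rightarrow> complex" where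
  "perm_action m X act a f =
     (\<Sum>\<sigma>\<in>carrier (sym_group m). \<Sum>x\<in>X. fscale (a \<sigma> * f x) (basis_vec (act \<sigma> x)))"

text \<open>\<open>V\<^sup>\<otimes>\<^sup>k\<close> is \<open>free_space (words n k)\<close>, where the word \<open>[i\<^sub>1, \<dots>, i\<^sub>k]\<close> indexes the basis vector
  \<open>v\<^bsub>i\<^sub>1\<^esub> \<otimes> \<dots> \<otimes> v\<^bsub>i\<^sub>k\<^esub>\<close>.\<close>

definition words :: "nat \<Rightarrow> nat \<Rightarrow> nat list set" where
  "words n k = {w. length w = k \<and> set w \<subseteq> {1..n}}"

text \<open>\<open>vertex_label u w\<close> assigns \<open>u = [i\<^sub>1, \<dots>, i\<^sub>k]\<close> to the top row and \<open>w = [i\<^sub>1\<^sub>', \<dots>, i\<^sub>k\<^sub>']\<close> to the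
  bottom row; the value on \<open>Mid\<close> is irrelevant.\<close>

fun vertex_label :: "nat list \<Rightarrow> nat list \<Rightarrow> vertex \<Rightarrow> nat" where
  "vertex_label u w (Top r) = u ! (r - 1)"
| "vertex_label u w (Bot r) = w ! (r - 1)"
| "vertex_label u w (Mid r) = 0"

definition compatible :: "vertex set set \<Rightarrow> nat list \<Rightarrow> nat list \<Rightarrow> bool" where
  "compatible d u w \<longleftrightarrow> (\<forall>b\<in>d. \<forall>x\<in>b. \<forall>y\<in>b. vertex_label u w x = vertex_label u w y)"

definition diagram_action ::
    "nat \<Rightarrow> nat \<Rightarrow> vertex set set \<Rightarrow> (nat list \<Rightarrow> complex) \<Rightarrow> nat list \<Rightarrow> complex" where
  "diagram_action n k d f =
     (\<Sum>u\<in>words n k. fscale (f u) (\<Sum>w | w \<in> words n k \<and> compatible d u w. basis_vec w))"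

definition partition_action ::
    "nat \<Rightarrow> nat \<Rightarrow> (vertex set set \<Rightarrow> complex) \<Rightarrow> (nat list \<Rightarrow> complex) \<Rightarrow> nat list \<Rightarrow> complex" where
  "partition_action n k a f = (\<Sum>d\<in>diagrams k. fscale (a d) (diagram_action n k d f))"

text \<open>The embedding \<open>f \<mapsto> f \<otimes> v\<^sub>n\<close> of \<open>V\<^sup>\<otimes>\<^sup>k\<close> into \<open>V\<^bsup>\<otimes>(k+1)\<^esup>\<close>.\<close>

definition tensor_last :: "nat \<Rightarrow> nat \<Rightarrow> (nat list \<Rightarrow> complex) \<Rightarrow> nat list \<Rightarrow> complex" where
  "tensor_last n k f = (\<Sum>u\<in>words n k. fscale (f u) (basis_vec (u @ [n])))"

lemma sum_fun_apply: "(\<Sum>i\<in>I. g i) x = (\<Sum>i\<in>I. g i x)" for g :: "'i \<Rightarrow> 'x \<Rightarrow> complex"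
  by (induction I rule: infinite_finite_induct) auto

text \<open>The inverse of the isomorphism \<open>V\<^sup>\<otimes>\<^sup>k \<cong> V\<^sup>\<otimes>\<^sup>k \<otimes> v\<^sub>n\<close> reads off the coefficients at \<open>w @ [n]\<close>. That the
  half-integer partition algebra preserves \<open>V\<^sup>\<otimes>\<^sup>k \<otimes> v\<^sub>n\<close> is the lemma \<open>tensor_last_half_action\<close> below.\<close>

definition half_action ::
    "nat \<Rightarrow> nat \<Rightarrow> (vertex set set \<Rightarrow> complex) \<Rightarrow> (nat list \<Rightarrow> complex) \<Rightarrow> nat list \<Rightarrow> complex" where
  "half_action n k a f = (\<lambda>w. partition_action n (k + 1) a (tensor_last n k f) (w @ [n]))"

lemma tensor_last_half_action:
  assumes n: "n > 0" and a: "a \<in> carrier (half_partition_algebra k n)"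
  shows "tensor_last n k (half_action n k a f) = partition_action n (k + 1) a (tensor_last n k f)"
proof
  fix w
  let ?f = "tensor_last n k f"
  have fin: "finite (words n j)" for j
    using finite_lists_length_eq[of "{1..n}" j] by (simp add: words_def conj_commute)
  have eval: "tensor_last n k g w = (\<Sum>u\<in>words n k. g u * (if w = u @ [n] then 1 else 0))" for g w
    by (simp add: tensor_last_def sum_fun_apply fscale_def basis_vec_def)
  show "tensor_last n k (half_action n k a f) w = partition_action n (k + 1) a ?f w"
  proof (cases "\<exists>u\<in>words n k. w = u @ [n]")
    case True
    then obtain u where u: "u \<in> words n k" "w = u @ [n]" by blast
    have "tensor_last n k (half_action n k a f) w
        = (\<Sum>u'\<in>words n k. if u' = u then half_action n k a f u' else 0)"
      unfolding eval by (rule sum.cong) (auto simp: u)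
    then show ?thesis using u fin by (simp add: half_action_def)
  next
    case False
    have z: "diagram_action n (k + 1) d ?f w = 0" if d: "d \<in> half_diagrams k" for d
    proof -
      have "?f u * (if w \<in> words n (k + 1) \<and> compatible d u w then 1 else 0) = 0" for u
      proof (rule ccontr)
        assume "\<not> ?thesis"
        then have "?f u \<noteq> 0" and w: "w \<in> words n (k + 1)" and c: "compatible d u w"
          by (auto split: if_splits)
        then obtain u' where u': "u' \<in> words n k" "u = u' @ [n]"
          unfolding tensor_last_def sum_fun_apply fscale_def basis_vec_def
          by (auto elim!: sum.not_neutral_contains_not_neutral split: if_splits)
        obtain b where b: "b \<in> d" "Top (k + 1) \<in> b" "Bot (k + 1) \<in> b"
          using d by (auto simp: half_diagrams_def)
        then have "u ! k = w ! k" using c by (force simp: compatible_def)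
        then have "w ! k = n" using u' by (auto simp: words_def nth_append)
        moreover have "length w = Suc k" using w by (simp add: words_def)
        ultimately have "w = take k w @ [n]"
          using take_Suc_conv_app_nth[of k w] by simp
        moreover have "take k w \<in> words n k"
          using w set_take_subset[of k w] by (auto simp: words_def)
        ultimately show False using False by blast
      qed
      moreover have "(\<Sum>v | v \<in> words n (k + 1) \<and> compatible d u v. basis_vec v) w
          = (if w \<in> words n (k + 1) \<and> compatible d u w then 1 else (0::complex))" for u
        using fin[of "k + 1"] by (simp add: sum_fun_apply basis_vec_def)
      ultimately show ?thesis
        by (simp add: diagram_action_def sum_fun_apply fscale_def del: mult_eq_0_iff)
    qed
    have "a d * diagram_action n (k + 1) d ?f w = 0" for d
      using z[of d] a
      by (cases "d \<in> half_diagrams k")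
        (auto simp: half_partition_algebra_def based_algebra_def free_space_def)
    then have "partition_action n (k + 1) a ?f w = 0"
      by (simp add: partition_action_def sum_fun_apply fscale_def del: mult_eq_0_iff)
    moreover have "tensor_last n k (half_action n k a f) w = 0"
      unfolding eval using False by (intro sum.neutral) auto
    ultimately show ?thesis by simp
  qed
qed

definition tensor_bimodule ::
    "nat \<Rightarrow> nat \<Rightarrow> ((nat \<Rightarrow> nat) \<Rightarrow> complex, vertex set set \<Rightarrow> complex, nat list) bimod" where
  "tensor_bimodule n k =
     \<lparr> bspace = free_space (words n k),
       lact = perm_action n (words n k) map,
       ract = partition_action n k \<rparr>"

text \<open>\<open>sym_group (n - 1)\<close> consists of the permutations of \<open>{1..n}\<close> fixing \<open>n\<close>, as functions on \<open>nat\<close>.\<close>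

definition half_tensor_bimodule ::
    "nat \<Rightarrow> nat \<Rightarrow> ((nat \<Rightarrow> nat) \<Rightarrow> complex, vertex set set \<Rightarrow> complex, nat list) bimod" where
  "half_tensor_bimodule n k =
     \<lparr> bspace = free_space (words n k),
       lact = perm_action (n - 1) (words n k) map,
       ract = half_action n k \<rparr>"

section \<open>Partitions and Specht modules\<close>

definition partitions :: "nat \<Rightarrow> nat list set" where
  "partitions m = {l. sorted_wrt (\<ge>) l \<and> 0 \<notin> set l \<and> sum_list l = m}"

text \<open>Boxes are numbered from 0.\<close>

definition young_diagram :: "nat list \<Rightarrow> (nat \<times> nat) set" where
  "young_diagram l = {(i, j). i < length l \<and> j < l ! i}"

definition tableaux :: "nat \<Rightarrow> nat list \<Rightarrow> (nat \<times> nat \<Rightarrow> nat) set" where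
  "tableaux m l = {t. bij_betw t (young_diagram l) {1..m}}"

text \<open>The tabloid of \<open>t\<close>, i.e. its class modulo row permutations, is the sequence of the sets of
  entries of its rows.\<close>

definition tabloid :: "nat list \<Rightarrow> (nat \<times> nat \<Rightarrow> nat) \<Rightarrow> nat \<Rightarrow> nat set" where
  "tabloid l t = (\<lambda>i. {t (i, j) | j. (i, j) \<in> young_diagram l})"

definition column_stabilizer :: "nat \<Rightarrow> nat list \<Rightarrow> (nat \<times> nat \<Rightarrow> nat) \<Rightarrow> (nat \<Rightarrow> nat) set" where
  "column_stabilizer m l t =
     {q \<in> carrier (sym_group m).
        \<forall>(i, j)\<in>young_diagram l. \<exists>i'. (i', j) \<in> young_diagram l \<and> q (t (i, j)) = t (i', j)}"

definition polytabloid :: "nat \<Rightarrow> nat list \<Rightarrow> (nat \<times> nat \<Rightarrow> nat) \<Rightarrow> (nat \<Rightarrow> nat set) \<Rightarrow> complex" where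
  "polytabloid m l t =
     (\<Sum>q\<in>column_stabilizer m l t. fscale (of_int (sign q)) (basis_vec (tabloid l (q \<circ> t))))"

text \<open>The irreducible \<open>S\<^sub>m\<close>-module indexed by the partition \<open>l\<close> of \<open>m\<close>: the Specht module spanned
  by the polytabloids. In this indexing \<open>[m]\<close> gives the trivial module.\<close>

definition specht :: "nat \<Rightarrow> nat list \<Rightarrow> ((nat \<Rightarrow> nat) \<Rightarrow> complex, nat \<Rightarrow> nat set) amod" where
  "specht m l =
     \<lparr> mspace = cfun.span (polytabloid m l ` tableaux m l),
       mact = perm_action m (tabloid l ` tableaux m l) (\<lambda>\<sigma> s i. \<sigma> ` s i) \<rparr>"

section \<open>The graph\<close>

definition hat_A :: "nat \<Rightarrow> nat \<Rightarrow> nat list set" where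
  "hat_A n k = {l \<in> partitions n. sum_list (tl l) \<le> k}"

definition hat_A_half :: "nat \<Rightarrow> nat \<Rightarrow> nat list set" where
  "hat_A_half n k = {l \<in> partitions (n - 1). sum_list (tl l) \<le> k}"

definition adds_box :: "nat list \<Rightarrow> nat list \<Rightarrow> bool" where
  "adds_box \<mu> l \<longleftrightarrow> (\<exists>c. c \<notin> young_diagram \<mu> \<and> young_diagram l = insert c (young_diagram \<mu>))"

text \<open>Levels are counted in half steps: level \<open>k\<close> of the graph is number \<open>2 * k\<close> and level
  \<open>k + 1/2\<close> is number \<open>2 * k + 1\<close>.\<close>

definition graph_level :: "nat \<Rightarrow> nat \<Rightarrow> nat list set" where
  "graph_level n s = (if even s then hat_A n (s div 2) else hat_A_half n (s div 2))"

definition graph_edge :: "nat \<Rightarrow> nat list \<Rightarrow> nat list \<Rightarrow> bool" where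
  "graph_edge s \<mu> l \<longleftrightarrow> (if even s then adds_box l \<mu> else adds_box \<mu> l)"

definition paths :: "nat \<Rightarrow> nat \<Rightarrow> nat list \<Rightarrow> nat list list set" where
  "paths n s l =
     {p. length p = s + 1 \<and> p ! 0 = [n] \<and> p ! s = l \<and>
         (\<forall>r\<le>s. p ! r \<in> graph_level n r) \<and> (\<forall>r<s. graph_edge r (p ! r) (p ! (r + 1)))}"

end

theory Submission
  imports Defs
begin

text \<open>For a tableau \<open>t\<close> of shape \<open>\<lambda>\<close>, the column antisymmetrizer of \<open>t\<close> annihilates the tabloids of shape \<open>\<mu>\<close>
  unless \<open>\<lambda>\<close> dominates \<open>\<mu>\<close>, and maps the tabloids of shape \<open>\<lambda>\<close> to multiples of the polytabloid of \<open>t\<close> (James).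
  This yields Schur's lemma for Specht modules and the independence of submodules of different shapes.

  When \<open>\<mu>\<close> arises from \<open>\<lambda>\<close> by removing a box there are nonzero \<open>S\<^bsub>m-1\<^esub>\<close>-maps between the Specht modules in both
  directions. Composing these along a path in the graph, with Frobenius reciprocity at the steps from \<open>k + 1/2\<close> to
  \<open>k + 1\<close>, gives for every path a copy of the Specht module of its endpoint in \<open>V\<^sup>\<otimes>\<^sup>k\<close>, and all these copies are
  independent. The dimension of a Specht module is at least the number \<open>f\<close> of standard tableaux, and the sum of
  \<open>f\<close> over the endpoints of all paths is \<open>n\<^sup>k\<close>, since \<open>DU - UD = 1\<close> in Young's lattice. So the copies exhaust
  tensor space, with the paths to \<open>\<lambda>\<close> as a basis of the multiplicity space of \<open>\<lambda>\<close>.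

  By Moebius inversion on the refinement order, the diagrams span all matrices commuting with the symmetric group;
  so the partition algebra contains all matrix units between paths to \<open>\<lambda>\<close>, and the multiplicity spaces are irreducible.\<close>

section \<open>Young diagrams and paths\<close>

text \<open>The decomposition is pinched rather than computed. Three one-sided facts go in: nonzero
  equivariant maps between Specht modules of neighbouring shapes, independence of the copies they
  produce, and the lower bound \<open>num_std\<close> for the dimension of a Specht module.
  Independent copies have total dimension at most \<open>n ^ k\<close>, and the lower bounds alone
  already add up to \<open>n ^ k\<close>; hence all estimates are equalities and the copies fill
  tensor space.

  The delicate point is to produce maps that are nonzero and land inside a Specht module: dropping
  or inserting the entry \<open>n\<close> gives maps between tabloid spaces, but these need not
  respect the Specht submodules. They are followed by a frame operator, a sum of rank one operators
  over the orbit of a polytabloid, whose image lies in the Specht module by construction. It cannot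
  vanish where it matters, because polytabloids are real and a sum of real squares does not cancel.

  Any choice of these maps serves: joint injectivity is a statement about kernels only, and it is
  what passes from one level to the next.\<close>

definition row_len :: "nat list \<Rightarrow> nat \<Rightarrow> nat" where
  "row_len l i = (if i < length l then l ! i else 0)"

lemma young_diagram_iff: "(i, j) \<in> young_diagram l \<longleftrightarrow> j < row_len l i"
  by (auto simp: young_diagram_def row_len_def)

lemma young_diagram_Sigma: "young_diagram l = Sigma {..<length l} (\<lambda>i. {..<l ! i})"
  by (auto simp: young_diagram_def)

lemma finite_young_diagram [simp]: "finite (young_diagram l)"
  by (simp add: young_diagram_Sigma)

lemma card_young_diagram: "card (young_diagram l) = sum_list l"
  by (simp add: young_diagram_Sigma sum_list_sum_nth atLeast0LessThan)

lemma card_young_diagram_partition: "l \<in> partitions m \<Longrightarrow> card (young_diagram l) = m"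
  by (simp add: card_young_diagram partitions_def)

lemma row_len_antimono:
  assumes "l \<in> partitions m" "i \<le> j"
  shows "row_len l j \<le> row_len l i"
  using assms sorted_wrt_nth_less[of "(\<ge>)" l i j]
  by (cases "i = j") (auto simp: partitions_def row_len_def)

lemma row_len_pos_iff: "l \<in> partitions m \<Longrightarrow> 0 < row_len l i \<longleftrightarrow> i < length l"
  by (auto simp: partitions_def row_len_def) (metis gr0I nth_mem)

text \<open>Row lengths can be read off the diagram, and as all parts are positive they also fix the
  length of the list.\<close>

lemma young_diagram_inj:
  assumes "l \<in> partitions m" "l' \<in> partitions m'" "young_diagram l = young_diagram l'"
  shows "l = l'"
proof -
  have r: "row_len l i = row_len l' i" for i
  proof -
    have "j < row_len l i \<longleftrightarrow> j < row_len l' i" for j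
      using assms(3) young_diagram_iff[of i j l] young_diagram_iff[of i j l'] by simp
    then show ?thesis by (metis linorder_neqE_nat less_irrefl)
  qed
  have "i < length l \<longleftrightarrow> i < length l'" for i
    using r[of i] row_len_pos_iff[OF assms(1), of i] row_len_pos_iff[OF assms(2), of i] by simp
  then have "length l = length l'"
    by (metis linorder_neqE_nat less_irrefl)
  then show ?thesis
    using r by (intro nth_equalityI) (metis row_len_def)+
qed

text \<open>The finite sets of this kind are exactly the Young diagrams. In this form stability
  under union and intersection is visible, which is what \<open>card_common_covers\<close>
  needs.\<close>

definition down_closed :: "(nat \<times> nat) set \<Rightarrow> bool" where
  "down_closed D \<longleftrightarrow> (\<forall>i j i' j'. (i, j) \<in> D \<longrightarrow> i' \<le> i \<longrightarrow> j' \<le> j \<longrightarrow> (i', j') \<in> D)"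

lemma down_closedD: "down_closed D \<Longrightarrow> (i, j) \<in> D \<Longrightarrow> i' \<le> i \<Longrightarrow> j' \<le> j \<Longrightarrow> (i', j') \<in> D"
  unfolding down_closed_def by blast

lemma down_closed_young_diagram:
  assumes "l \<in> partitions m" shows "down_closed (young_diagram l)"
  unfolding down_closed_def young_diagram_iff using row_len_antimono[OF assms]
  by (meson le_less_trans less_le_trans)

lemma finite_down_set_nat:
  fixes R :: "nat set"
  assumes "finite R" "\<And>x y. x \<in> R \<Longrightarrow> y \<le> x \<Longrightarrow> y \<in> R"
  shows "R = {..<card R}"
proof -
  define N where "N = (LEAST x. x \<notin> R)"
  have "N \<notin> R"
    unfolding N_def by (rule LeastI_ex) (use assms(1) ex_new_if_finite infinite_UNIV_nat in blast)
  moreover have "x < N \<Longrightarrow> x \<in> R" for x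
    unfolding N_def using not_less_Least by blast
  ultimately have "R = {..<N}"
    using assms(2) by (auto simp: not_less[symmetric])
  then show ?thesis by simp
qed

text \<open>The row lengths \<open>a i\<close> decrease weakly because a cell forces the cells above
  it; the list stops at the first empty row, so its parts are positive.\<close>

lemma young_diagram_surj:
  assumes fin: "finite D" and dc: "down_closed D"
  shows "\<exists>l\<in>partitions (card D). young_diagram l = D"
proof -
  define a where "a i = card {j. (i, j) \<in> D}" for i
  have a: "(i, j) \<in> D \<longleftrightarrow> j < a i" for i j
  proof -
    have "finite {j. (i, j) \<in> D}"
      by (rule finite_subset[of _ "snd ` D"]) (use fin in force)+
    then have "{j. (i, j) \<in> D} = {..<a i}"
      unfolding a_def by (rule finite_down_set_nat) (use dc down_closedD in blast)
    then show ?thesis by auto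
  qed
  have anti: "a i' \<le> a i" if "i \<le> i'" for i i'
  proof (rule ccontr)
    assume "\<not> ?thesis"
    then have "(i', a i) \<in> D" using a by simp
    then have "(i, a i) \<in> D" using dc that down_closedD by blast
    then show False using a by simp
  qed
  have "\<exists>i. i \<notin> fst ` D"
    using fin ex_new_if_finite infinite_UNIV_nat by blast
  then have ex: "\<exists>i. a i = 0"
    by (metis a fst_conv image_eqI gr0I)
  define N where "N = (LEAST i. a i = 0)"
  have N: "a N = 0" unfolding N_def using ex by (rule LeastI_ex)
  have N': "i < N \<Longrightarrow> a i \<noteq> 0" for i unfolding N_def using not_less_Least by blast
  define l where "l = map a [0..<N]"
  have r: "row_len l i = a i" for i
    using anti[of N i] N by (auto simp: row_len_def l_def)
  have Y: "young_diagram l = D"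
    using a r young_diagram_iff by auto
  have "sorted_wrt (\<ge>) l"
    by (auto simp: sorted_wrt_iff_nth_less l_def intro!: anti)
  moreover have "0 \<notin> set l"
    using N' by (fastforce simp: l_def)
  moreover have "sum_list l = card D" using Y card_young_diagram by metis
  ultimately show ?thesis using Y by (auto simp: partitions_def)
qed

lemma finite_partitions [simp]: "finite (partitions m)"
proof (rule finite_subset)
  show "partitions m \<subseteq> {l. set l \<subseteq> {..m} \<and> length l \<le> m}"
  proof
    fix l assume l: "l \<in> partitions m"
    have "length l \<le> sum_list l" if "0 \<notin> set l" for l :: "nat list"
      using that by (induction l) auto
    then show "l \<in> {l. set l \<subseteq> {..m} \<and> length l \<le> m}"
      using l member_le_sum_list[of _ l] by (auto simp: partitions_def)
  qed
  show "finite {l. set l \<subseteq> {..m} \<and> length l \<le> m}"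
    by (rule finite_lists_length_le) simp
qed

lemma partitions_0: "partitions 0 = {[]}"
  by (auto simp: partitions_def) (metis list.set_intros(1) neq_Nil_conv)

lemma single_row_partition: "n > 0 \<Longrightarrow> [n] \<in> partitions n"
  by (simp add: partitions_def)

section \<open>Adding and removing boxes\<close>

lemma adds_box_sum_list: "adds_box \<mu> l \<Longrightarrow> sum_list l = Suc (sum_list \<mu>)"
  unfolding adds_box_def card_young_diagram[symmetric] by auto

text \<open>The sizes differ by one, so an inclusion leaves exactly one cell.\<close>

lemma adds_box_iff_subset:
  assumes "\<mu> \<in> partitions n" "l \<in> partitions (Suc n)"
  shows "adds_box \<mu> l \<longleftrightarrow> young_diagram \<mu> \<subseteq> young_diagram l"
proof
  assume s: "young_diagram \<mu> \<subseteq> young_diagram l"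
  then have "card (young_diagram l - young_diagram \<mu>) = 1"
    using assms by (simp add: card_Diff_subset card_young_diagram_partition)
  then obtain c where "young_diagram l - young_diagram \<mu> = {c}"
    using card_1_singletonE by blast
  then show "adds_box \<mu> l" unfolding adds_box_def using s by blast
qed (auto simp: adds_box_def)

lemma adds_box_row:
  assumes "adds_box \<mu> l"
  obtains i where "row_len l = (row_len \<mu>)(i := Suc (row_len \<mu> i))"
proof -
  obtain i j where c: "(i, j) \<notin> young_diagram \<mu>" "young_diagram l = insert (i, j) (young_diagram \<mu>)"
    using assms unfolding adds_box_def by (metis surj_pair)
  have "{..<row_len l i} = insert j {..<row_len \<mu> i}"
    using c young_diagram_iff[of i _ l] young_diagram_iff[of i _ \<mu>] by auto
  moreover have "j \<notin> {..<row_len \<mu> i}" using c young_diagram_iff[of i _ \<mu>] by auto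
  ultimately have 1: "row_len l i = Suc (row_len \<mu> i)"
    by (metis card_insert_disjoint card_lessThan finite_lessThan)
  have 2: "row_len l i' = row_len \<mu> i'" if "i' \<noteq> i" for i'
  proof -
    have "j < row_len l i' \<longleftrightarrow> j < row_len \<mu> i'" for j
      using c that young_diagram_iff[of i' j l] young_diagram_iff[of i' j \<mu>] by auto
    then show ?thesis by (metis linorder_neqE_nat less_irrefl)
  qed
  have "row_len l = (row_len \<mu>)(i := Suc (row_len \<mu> i))" using 1 2 by auto
  then show ?thesis using that by blast
qed

text \<open>Addable corners, indexed by their rows. The first empty row
  \<open>i = length \<mu>\<close> qualifies as well, since \<open>row_len\<close> is 0
  there.\<close>

lemma adds_box_image:
  assumes mu: "\<mu> \<in> partitions n"
  defines "a \<equiv> row_len \<mu>"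
  shows "young_diagram ` {l \<in> partitions (Suc n). adds_box \<mu> l}
       = (\<lambda>i. insert (i, a i) (young_diagram \<mu>)) ` {i. i = 0 \<or> a i < a (i - 1)}" (is "?L = ?R")
proof
  note anti = row_len_antimono[OF mu, folded a_def]
  note iff = young_diagram_iff[of _ _ \<mu>, folded a_def]
  show "?L \<subseteq> ?R"
  proof
    fix D assume "D \<in> ?L"
    then obtain l where l: "l \<in> partitions (Suc n)" "adds_box \<mu> l" "D = young_diagram l" by blast
    then obtain i j where c: "(i, j) \<notin> young_diagram \<mu>"
        "young_diagram l = insert (i, j) (young_diagram \<mu>)"
      unfolding adds_box_def by (metis surj_pair)
    note dc = down_closedD[OF down_closed_young_diagram[OF l(1)]]
    have j: "j = a i"
    proof (rule ccontr)
      assume "j \<noteq> a i"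
      with c(1) iff have "a i < j" by auto
      then have "(i, a i) \<in> young_diagram l" using dc[of i j i "a i"] c(2) by simp
      with c(2) \<open>j \<noteq> a i\<close> iff show False by auto
    qed
    have "i = 0 \<or> a i < a (i - 1)"
    proof (cases "i = 0")
      case False
      have "(i - 1, j) \<in> young_diagram l" using dc[of i j "i - 1" j] c(2) by simp
      then show ?thesis using c(2) False iff j by auto
    qed simp
    then show "D \<in> ?R" using l c j by blast
  qed
  show "?R \<subseteq> ?L"
  proof
    fix D assume "D \<in> ?R"
    then obtain i where i: "i = 0 \<or> a i < a (i - 1)" and D: "D = insert (i, a i) (young_diagram \<mu>)"
      by blast
    have "down_closed D"
      unfolding down_closed_def
    proof (intro allI impI)
      fix x y x' y' assume xy: "(x, y) \<in> D" "x' \<le> x" "y' \<le> y"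
      show "(x', y') \<in> D"
      proof (cases "(x, y) \<in> young_diagram \<mu>")
        case True
        then show ?thesis
          using down_closedD[OF down_closed_young_diagram[OF mu] True xy(2,3)] D by simp
      next
        case False
        then have e: "x = i" "y = a i" using xy D by auto
        show ?thesis
        proof (cases "x' = i")
          case True then show ?thesis using e xy D iff by auto
        next
          case False
          then have "a (i - 1) \<le> a x'" "i \<noteq> 0" using xy e anti by auto
          then have "y' < a x'" using i xy e by auto
          then show ?thesis using D iff by auto
        qed
      qed
    qed
    moreover have "finite D" "card D = Suc n"
      using D iff card_young_diagram_partition[OF mu] by auto
    ultimately obtain l where "l \<in> partitions (Suc n)" "young_diagram l = D"
      using young_diagram_surj by metis
    then show "D \<in> ?L"
      using D iff by (auto simp: adds_box_def)
  qed
qed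

text \<open>Removable corners, indexed by the rows that are strictly longer than their successor.
  Shifting the index by one matches them with the addable rows other than row 0.\<close>

lemma removes_box_image:
  assumes mu: "\<mu> \<in> partitions n"
  defines "a \<equiv> row_len \<mu>"
  shows "young_diagram ` {l \<in> partitions (n - 1). adds_box l \<mu>}
       = (\<lambda>i. young_diagram \<mu> - {(i, a i - 1)}) ` {i. a (Suc i) < a i}" (is "?L = ?R")
proof
  note anti = row_len_antimono[OF mu, folded a_def]
  note iff = young_diagram_iff[of _ _ \<mu>, folded a_def]
  show "?L \<subseteq> ?R"
  proof
    fix D assume "D \<in> ?L"
    then obtain l where l: "l \<in> partitions (n - 1)" "adds_box l \<mu>" "D = young_diagram l" by blast
    then obtain i j where c: "(i, j) \<notin> young_diagram l"
        "young_diagram \<mu> = insert (i, j) (young_diagram l)"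
      unfolding adds_box_def by (metis surj_pair)
    note dc = down_closedD[OF down_closed_young_diagram[OF l(1)]]
    have ja: "j < a i" using c(2) iff by blast
    have j: "j = a i - 1"
    proof (rule ccontr)
      assume "j \<noteq> a i - 1"
      then have "(i, Suc j) \<in> young_diagram \<mu>" using ja iff by auto
      then have "(i, Suc j) \<in> young_diagram l" using c(2) by auto
      then show False using c(1) dc[of i "Suc j" i j] by simp
    qed
    have "a (Suc i) < a i"
    proof (rule ccontr)
      assume "\<not> ?thesis"
      then have "(Suc i, j) \<in> young_diagram \<mu>" using ja iff by auto
      then have "(Suc i, j) \<in> young_diagram l" using c(2) by auto
      then show False using c(1) dc[of "Suc i" j i j] by simp
    qed
    moreover have "D = young_diagram \<mu> - {(i, a i - 1)}" using l(3) c j by auto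
    ultimately show "D \<in> ?R" by blast
  qed
  show "?R \<subseteq> ?L"
  proof
    fix D assume "D \<in> ?R"
    then obtain i where i: "a (Suc i) < a i" and D: "D = young_diagram \<mu> - {(i, a i - 1)}"
      by blast
    have inn: "(i, a i - 1) \<in> young_diagram \<mu>" using i iff by auto
    have "down_closed D"
      unfolding down_closed_def
    proof (intro allI impI)
      fix x y x' y' assume xy: "(x, y) \<in> D" "x' \<le> x" "y' \<le> y"
      have m: "(x, y) \<in> young_diagram \<mu>" using xy D by blast
      have "(x', y') \<in> young_diagram \<mu>"
        using down_closedD[OF down_closed_young_diagram[OF mu] m xy(2,3)] .
      moreover have "(x', y') \<noteq> (i, a i - 1)"
      proof
        assume e: "(x', y') = (i, a i - 1)"
        have "y < a x" using m iff by auto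
        show False
        proof (cases "x = i")
          case True then show False using e xy D \<open>y < a x\<close> by auto
        next
          case False
          then have "a x \<le> a (Suc i)" using e xy anti by auto
          then show False using i e xy \<open>y < a x\<close> by auto
        qed
      qed
      ultimately show "(x', y') \<in> D" using D by auto
    qed
    moreover have "finite D" "card D = n - 1"
      using D inn card_young_diagram_partition[OF mu] by auto
    ultimately obtain l where "l \<in> partitions (n - 1)" "young_diagram l = D"
      using young_diagram_surj by metis
    then show "D \<in> ?L"
      using D inn by (auto simp: adds_box_def)
  qed
qed

section \<open>The commutation relation DU - UD = 1 in Young's lattice\<close>

lemma inj_on_young_diagram: "inj_on young_diagram (partitions m)"
  using young_diagram_inj by (auto intro!: inj_onI)

text \<open>The diagonal of DU - UD = 1. Row \<open>i + 1\<close> can be extended exactly if row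
  \<open>i\<close> can be shortened, and row 0 can always be extended, which gives the extra
  1.\<close>

lemma card_addable_removable:
  assumes mu: "\<mu> \<in> partitions n"
  shows "card {l \<in> partitions (Suc n). adds_box \<mu> l} = Suc (card {l \<in> partitions (n - 1). adds_box l \<mu>})"
proof -
  define a where "a = row_len \<mu>"
  define U where "U = {i. i = 0 \<or> a i < a (i - 1)}"
  define V where "V = {i. a (Suc i) < a i}"
  note iff = young_diagram_iff[of _ _ \<mu>, folded a_def]
  have "finite V"
    by (rule finite_subset[of _ "{..<length \<mu>}"]) (auto simp: V_def a_def row_len_def split: if_splits)
  moreover have "i \<in> U \<longleftrightarrow> i \<in> insert 0 (Suc ` V)" for i
    by (cases i) (auto simp: U_def V_def)
  then have "U = insert 0 (Suc ` V)" by blast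
  ultimately have UV: "card U = Suc (card V)" by (simp add: card_image)
  have "inj_on (\<lambda>i. insert (i, a i) (young_diagram \<mu>)) U"
    by (rule inj_onI) (use iff in blast)
  then have 1: "card {l \<in> partitions (Suc n). adds_box \<mu> l} = card U"
    using arg_cong[OF adds_box_image[OF mu, folded a_def, folded U_def], of card]
      card_image[OF inj_on_subset[OF inj_on_young_diagram], of "{l \<in> partitions (Suc n). adds_box \<mu> l}" "Suc n"]
    by (simp add: card_image)
  have "inj_on (\<lambda>i. young_diagram \<mu> - {(i, a i - 1)}) V"
  proof (rule inj_onI)
    fix i j assume ij: "i \<in> V" "j \<in> V"
      and e: "young_diagram \<mu> - {(i, a i - 1)} = young_diagram \<mu> - {(j, a j - 1)}"
    have "(i, a i - 1) \<in> young_diagram \<mu>" using ij iff by (auto simp: V_def)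
    then show "i = j" using e by blast
  qed
  then have 2: "card {l \<in> partitions (n - 1). adds_box l \<mu>} = card V"
    using arg_cong[OF removes_box_image[OF mu, folded a_def, folded V_def], of card]
      card_image[OF inj_on_subset[OF inj_on_young_diagram], of "{l \<in> partitions (n - 1). adds_box l \<mu>}" "n - 1"]
    by (simp add: card_image)
  show ?thesis using 1 2 UV by simp
qed

text \<open>The off-diagonal part of DU - UD = 1. A common cover must be the union of the two
  diagrams and a common lower neighbour their intersection. The sizes of union and intersection add
  up to \<open>2 * n\<close>, so both have the right size or neither has.\<close>

lemma card_common_covers:
  assumes mu: "\<mu> \<in> partitions n" and nu: "\<nu> \<in> partitions n" and ne: "\<mu> \<noteq> \<nu>"
  shows "card {l \<in> partitions (Suc n). adds_box \<mu> l \<and> adds_box \<nu> l}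
       = card {l \<in> partitions (n - 1). adds_box l \<mu> \<and> adds_box l \<nu>}"
proof -
  \<comment> \<open>Size 0 admits only one partition, so \<open>n\<close> is positive and
    \<open>n - 1\<close> is not truncated.\<close>
  obtain n' where n: "n = Suc n'" using mu nu ne partitions_0 by (cases n) auto
  define A where "A = young_diagram \<mu>"
  define B where "B = young_diagram \<nu>"
  have AB: "finite A" "finite B" "card A = n" "card B = n" "A \<noteq> B"
    using mu nu ne young_diagram_inj[OF mu nu] by (auto simp: A_def B_def card_young_diagram_partition)
  have dc: "down_closed A" "down_closed B"
    using mu nu down_closed_young_diagram by (auto simp: A_def B_def)
  have sum: "card (A \<union> B) + card (A \<inter> B) = 2 * n" using card_Un_Int[of A B] AB by simp
  have lt: "card (A \<inter> B) < n"
    by (metis AB card_subset_eq inf_le1 inf_le2 le_neq_implies_less card_mono)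
  have up: "{l \<in> partitions (Suc n). adds_box \<mu> l \<and> adds_box \<nu> l} = {l \<in> partitions (Suc n). young_diagram l = A \<union> B}"
    (is "?U = ?U'")
  proof
    show "?U \<subseteq> ?U'"
    proof
      fix l assume l: "l \<in> ?U"
      then have s: "A \<union> B \<subseteq> young_diagram l"
        using adds_box_iff_subset mu nu by (auto simp: A_def B_def)
      have "card (young_diagram l) \<le> card (A \<union> B)"
        using l sum lt card_young_diagram_partition by auto
      then show "l \<in> ?U'" using card_seteq[OF _ s] l by auto
    qed
    show "?U' \<subseteq> ?U" using adds_box_iff_subset mu nu by (auto simp: A_def B_def)
  qed
  have dn: "{l \<in> partitions (n - 1). adds_box l \<mu> \<and> adds_box l \<nu>} = {l \<in> partitions (n - 1). young_diagram l = A \<inter> B}"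
    (is "?D = ?D'")
  proof
    show "?D \<subseteq> ?D'"
    proof
      fix l assume l: "l \<in> ?D"
      then have s: "young_diagram l \<subseteq> A \<inter> B"
        using adds_box_iff_subset[of l n'] mu nu n by (auto simp: A_def B_def)
      have "card (A \<inter> B) \<le> card (young_diagram l)"
        using l lt card_young_diagram_partition by auto
      then show "l \<in> ?D'" using card_seteq[OF _ s] l AB by auto
    qed
    show "?D' \<subseteq> ?D" using adds_box_iff_subset[of _ n'] mu nu n by (auto simp: A_def B_def)
  qed
  have one: "card {l \<in> partitions m. young_diagram l = D} = (if card D = m then 1 else 0)"
    if "finite D" "down_closed D" for D m
  proof (cases "card D = m")
    case True
    obtain l where l: "l \<in> partitions m" "young_diagram l = D"
      using young_diagram_surj[of D] \<open>finite D\<close> \<open>down_closed D\<close> True by auto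
    then have "{l \<in> partitions m. young_diagram l = D} = {l}"
      using young_diagram_inj by blast
    then show ?thesis using True by simp
  next
    case False
    then have "{l \<in> partitions m. young_diagram l = D} = {}"
      using card_young_diagram_partition by blast
    then show ?thesis using False by simp
  qed
  have "down_closed (A \<union> B)" "down_closed (A \<inter> B)"
    using dc unfolding down_closed_def by blast+
  then show ?thesis
    using up dn one[of "A \<union> B" "Suc n"] one[of "A \<inter> B" "n - 1"] AB sum lt n by auto
qed

text \<open>For a partition \<open>l\<close> of \<open>n\<close> this is the number of standard
  tableaux of shape \<open>l\<close>, by the position of the largest entry, or the number of
  saturated chains from the empty partition to \<open>l\<close> in Young's lattice.\<close>

primrec num_std :: "nat \<Rightarrow> nat list \<Rightarrow> nat" where
  "num_std 0 l = 1"
| "num_std (Suc n) l = (\<Sum>\<mu> | \<mu> \<in> partitions n \<and> adds_box \<mu> l. num_std n \<mu>)"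

text \<open>Going up and then down from \<open>\<mu>\<close> differs from going down and then up by
  one copy of \<open>\<mu>\<close>. The induction hypothesis evaluates the second route: it
  contributes \<open>n * num_std n \<mu>\<close>.\<close>

lemma sum_num_std_up:
  assumes "\<mu> \<in> partitions n"
  shows "(\<Sum>l | l \<in> partitions (Suc n) \<and> adds_box \<mu> l. num_std (Suc n) l) = Suc n * num_std n \<mu>"
  using assms
proof (induction n arbitrary: \<mu>)
  \<comment> \<open>DU = UD + 1 applied to \<open>num_std\<close>. It is used at the base and in the
    induction step.\<close>
  have swap: "(\<Sum>l | l \<in> partitions (Suc n) \<and> adds_box \<mu> l. num_std (Suc n) l)
     = num_std n \<mu> + (\<Sum>\<rho> | \<rho> \<in> partitions (n - 1) \<and> adds_box \<rho> \<mu>.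
          \<Sum>\<nu> | \<nu> \<in> partitions n \<and> adds_box \<rho> \<nu>. num_std n \<nu>)"
    if mu: "\<mu> \<in> partitions n" for \<mu> n
  proof -
    have "(\<Sum>l | l \<in> partitions (Suc n) \<and> adds_box \<mu> l. num_std (Suc n) l)
        = (\<Sum>l\<in>{l \<in> partitions (Suc n). adds_box \<mu> l}. \<Sum>\<nu>\<in>{\<nu> \<in> partitions n. adds_box \<nu> l}. num_std n \<nu>)"
      by simp
    also have "\<dots> = (\<Sum>\<nu>\<in>partitions n. \<Sum>l | l \<in> {l \<in> partitions (Suc n). adds_box \<mu> l} \<and> adds_box \<nu> l. num_std n \<nu>)"
      by (rule sum.swap_restrict) auto
    also have "\<dots> = (\<Sum>\<nu>\<in>partitions n. num_std n \<nu> * card {l \<in> partitions (Suc n). adds_box \<mu> l \<and> adds_box \<nu> l})"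
      by (simp add: conj_assoc mult.commute)
    also have "\<dots> = (\<Sum>\<nu>\<in>partitions n. (if \<nu> = \<mu> then num_std n \<nu> else 0)
        + num_std n \<nu> * card {l \<in> partitions (n - 1). adds_box l \<mu> \<and> adds_box l \<nu>})"
    proof (rule sum.cong)
      fix \<nu> assume "\<nu> \<in> partitions n"
      then show "num_std n \<nu> * card {l \<in> partitions (Suc n). adds_box \<mu> l \<and> adds_box \<nu> l} =
        (if \<nu> = \<mu> then num_std n \<nu> else 0)
        + num_std n \<nu> * card {l \<in> partitions (n - 1). adds_box l \<mu> \<and> adds_box l \<nu>}"
        using card_common_covers[OF mu, of \<nu>] card_addable_removable[OF mu] by auto
    qed simp
    also have "\<dots> = num_std n \<mu> + (\<Sum>\<nu>\<in>partitions n. \<Sum>\<rho> | \<rho> \<in> {\<rho> \<in> partitions (n - 1). adds_box \<rho> \<mu>} \<and> adds_box \<rho> \<nu>. num_std n \<nu>)"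
      using mu by (simp add: sum.distrib conj_assoc mult.commute)
    also have "(\<Sum>\<nu>\<in>partitions n. \<Sum>\<rho> | \<rho> \<in> {\<rho> \<in> partitions (n - 1). adds_box \<rho> \<mu>} \<and> adds_box \<rho> \<nu>. num_std n \<nu>)
       = (\<Sum>\<rho>\<in>{\<rho> \<in> partitions (n - 1). adds_box \<rho> \<mu>}. \<Sum>\<nu>\<in>{\<nu> \<in> partitions n. adds_box \<rho> \<nu>}. num_std n \<nu>)"
      by (rule sum.swap_restrict[symmetric]) auto
    finally show ?thesis by simp
  qed
  {
    case 0
    \<comment> \<open>Here \<open>n - 1\<close> is truncated to 0, so the lower sum ranges over
      \<open>partitions 0\<close>; it is empty because a box would change the size.\<close>
    have "\<not> adds_box \<rho> \<mu>" for \<rho>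
      using 0 adds_box_sum_list[of \<rho> \<mu>] by (auto simp: partitions_0)
    then show ?case using swap[OF 0] by simp
  next
    case (Suc n)
    have "(\<Sum>\<rho> | \<rho> \<in> partitions n \<and> adds_box \<rho> \<mu>. \<Sum>\<nu> | \<nu> \<in> partitions (Suc n) \<and> adds_box \<rho> \<nu>. num_std (Suc n) \<nu>)
        = (\<Sum>\<rho> | \<rho> \<in> partitions n \<and> adds_box \<rho> \<mu>. Suc n * num_std n \<rho>)"
      by (rule sum.cong) (use Suc.IH in auto)
    also have "\<dots> = Suc n * num_std (Suc n) \<mu>"
      by (simp add: sum_distrib_left)
    finally show ?case using swap[OF Suc.prems] by simp
  }
qed

section \<open>Paths in the graph and the dimension count\<close>

lemma sum_list_tl: "sum_list (tl l) = sum_list l - row_len l 0"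
  by (cases l) (auto simp: row_len_def)

lemma row_len_le_sum_list: "row_len l 0 \<le> sum_list l"
  by (cases l) (auto simp: row_len_def)

lemma adds_box_sum_list_tl:
  assumes "adds_box \<mu> l"
  shows "sum_list (tl \<mu>) \<le> sum_list (tl l)" "sum_list (tl l) \<le> Suc (sum_list (tl \<mu>))"
proof -
  obtain i where "row_len l = (row_len \<mu>)(i := Suc (row_len \<mu> i))" using adds_box_row assms by blast
  then have "row_len l 0 = row_len \<mu> 0 \<or> row_len l 0 = Suc (row_len \<mu> 0)" by auto
  then show "sum_list (tl \<mu>) \<le> sum_list (tl l)" "sum_list (tl l) \<le> Suc (sum_list (tl \<mu>))"
    using adds_box_sum_list[OF assms] row_len_le_sum_list[of \<mu>] row_len_le_sum_list[of l]
    by (auto simp: sum_list_tl)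
qed

text \<open>All paths up to a level, whatever their endpoint: the recursion over levels and the
  family of embeddings are indexed by this set.\<close>

definition path_set :: "nat \<Rightarrow> nat \<Rightarrow> nat list list set" where
  "path_set n s = {p. length p = s + 1 \<and> p ! 0 = [n] \<and>
         (\<forall>r\<le>s. p ! r \<in> graph_level n r) \<and> (\<forall>r<s. graph_edge r (p ! r) (p ! (r + 1)))}"

definition level_size :: "nat \<Rightarrow> nat \<Rightarrow> nat" where
  "level_size n s = (if even s then n else n - 1)"

text \<open>Only the size of \<open>l\<close> is prescribed; membership in the next level is
  automatic by \<open>nexts_level\<close>.\<close>

definition nexts :: "nat \<Rightarrow> nat \<Rightarrow> nat list \<Rightarrow> nat list set" where
  "nexts n s \<mu> = {l \<in> partitions (level_size n (Suc s)). graph_edge s \<mu> l}"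

lemma last_conv_nth_Suc: "length p = Suc s \<Longrightarrow> last p = p ! s"
  by (cases p rule: rev_cases) auto

lemma paths_eq: "paths n s l = {p \<in> path_set n s. last p = l}"
  unfolding paths_def path_set_def using last_conv_nth_Suc[of _ s] by auto

lemma finite_nexts [simp]: "finite (nexts n s \<mu>)"
  by (simp add: nexts_def)

lemma graph_level_partitions: "l \<in> graph_level n s \<Longrightarrow> l \<in> partitions (level_size n s)"
  by (auto simp: graph_level_def level_size_def hat_A_def hat_A_half_def split: if_splits)

lemma path_set_last: "p \<in> path_set n s \<Longrightarrow> last p \<in> graph_level n s"
  by (simp add: path_set_def last_conv_nth_Suc)

lemma path_set_last_partitions: "p \<in> path_set n s \<Longrightarrow> last p \<in> partitions (level_size n s)"
  using path_set_last graph_level_partitions by blast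

lemma path_set_0: "n > 0 \<Longrightarrow> path_set n 0 = {[[n]]}"
proof -
  assume n: "n > 0"
  have "p = [[n]]" if "length p = 1" "p ! 0 = [n]" for p
    using that by (cases p) auto
  then show ?thesis
    using single_row_partition[OF n]
    by (auto simp: path_set_def graph_level_def hat_A_def)
qed

text \<open>Removing a box cannot enlarge the part below the first row, and adding a box enlarges it
  by at most 1, just as the bound \<open>s div 2\<close> stays fixed at the steps down and grows by
  1 at the steps up.\<close>

lemma nexts_level:
  assumes "\<mu> \<in> graph_level n s" "l \<in> nexts n s \<mu>"
  shows "l \<in> graph_level n (Suc s)"
proof (cases "even s")
  case True
  then show ?thesis using assms adds_box_sum_list_tl(1)[of l \<mu>]
    by (simp add: nexts_def graph_level_def level_size_def graph_edge_def hat_A_def hat_A_half_def)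
next
  case False
  then have "Suc s div 2 = Suc (s div 2)" by simp
  then show ?thesis using assms False adds_box_sum_list_tl(2)[of \<mu> l]
    by (simp add: nexts_def graph_level_def level_size_def graph_edge_def hat_A_def hat_A_half_def)
qed

lemma path_set_Suc:
  "bij_betw (\<lambda>(p, l). p @ [l]) (SIGMA p:path_set n s. nexts n s (last p)) (path_set n (Suc s))"
proof (rule bij_betw_imageI)
  show "inj_on (\<lambda>(p, l). p @ [l]) (SIGMA p:path_set n s. nexts n s (last p))"
    by (auto intro!: inj_onI)
  show "(\<lambda>(p, l). p @ [l]) ` (SIGMA p:path_set n s. nexts n s (last p)) = path_set n (Suc s)"
    (is "?L = ?R")
  proof
    show "?L \<subseteq> ?R"
    proof
      fix x assume "x \<in> ?L"
      then obtain p l where p: "p \<in> path_set n s" and l: "l \<in> nexts n s (last p)" and x: "x = p @ [l]"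
        by auto
      have len: "length p = Suc s" using p by (simp add: path_set_def)
      then have last: "last p = p ! s" by (rule last_conv_nth_Suc)
      have lev: "l \<in> graph_level n (Suc s)" using nexts_level path_set_last p l by blast
      have "graph_edge s (p ! s) l" using l last by (simp add: nexts_def)
      then show "x \<in> ?R"
        using p lev len by (auto simp: path_set_def x nth_append less_Suc_eq le_Suc_eq)
    qed
    show "?R \<subseteq> ?L"
    proof
      fix x assume x: "x \<in> ?R"
      have len: "length x = Suc (Suc s)" using x by (simp add: path_set_def)
      define p where "p = take (Suc s) x"
      define l where "l = x ! Suc s"
      have xp: "x = p @ [l]"
        using take_Suc_conv_app_nth[of "Suc s" x] len by (simp add: p_def l_def)
      have lp: "length p = Suc s" using len by (simp add: p_def)
      then have last: "last p = p ! s" by (rule last_conv_nth_Suc)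
      have ps: "x ! r = p ! r" if "r \<le> s" for r using that by (simp add: p_def)
      have "p ! r \<in> graph_level n r" if "r \<le> s" for r
        using x ps[OF that] that by (auto simp: path_set_def) (metis le_Suc_eq)
      moreover have "graph_edge r (p ! r) (p ! (r + 1))" if "r < s" for r
        using x ps[of r] ps[of "Suc r"] that by (auto simp: path_set_def) (metis less_Suc_eq)
      ultimately have "p \<in> path_set n s"
        using x lp ps[of 0] by (simp add: path_set_def)
      moreover have "l \<in> nexts n s (last p)"
        using x ps[of s] graph_level_partitions by (auto simp: nexts_def path_set_def last l_def)
      ultimately show "x \<in> ?L" using xp by force
    qed
  qed
qed

lemma finite_path_set [simp]: "n > 0 \<Longrightarrow> finite (path_set n s)"
proof (induction s)
  case (Suc s)
  then show ?case using bij_betw_finite[OF path_set_Suc[of n s]] by simp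
qed (simp add: path_set_0)

lemma sum_path_set_Suc:
  fixes g :: "nat list list \<Rightarrow> 'b :: comm_monoid_add"
  assumes "n > 0"
  shows "(\<Sum>p\<in>path_set n (Suc s). g p) = (\<Sum>p\<in>path_set n s. \<Sum>l\<in>nexts n s (last p). g (p @ [l]))"
  using assms sum.reindex_bij_betw[OF path_set_Suc[of n s], of g]
  by (simp add: sum.Sigma case_prod_unfold)

lemma nexts_even: "even s \<Longrightarrow> nexts n s \<mu> = {l \<in> partitions (n - 1). adds_box l \<mu>}"
  by (simp add: nexts_def level_size_def graph_edge_def)

lemma nexts_odd: "odd s \<Longrightarrow> nexts n s \<mu> = {l \<in> partitions n. adds_box \<mu> l}"
  by (simp add: nexts_def level_size_def graph_edge_def)

text \<open>A step to a half-integer level preserves the sum by the recursion of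
  \<open>num_std\<close>, and a step to an integer level multiplies it by \<open>n\<close> by
  \<open>sum_num_std_up\<close>. The start is a single row, which has one standard tableau. The
  value is the dimension of tensor space.\<close>

lemma sum_num_std_path_set:
  assumes n: "n > 0"
  shows "(\<Sum>p\<in>path_set n s. num_std (level_size n s) (last p)) = n ^ (s div 2)"
proof (induction s)
  case 0
  have "num_std m [m] = 1" for m
  proof (induction m)
    case (Suc m)
    have "{\<mu> \<in> partitions m. adds_box \<mu> [Suc m]} = (if m = 0 then {[]} else {[m]})"
    proof -
      have "\<mu> = (if m = 0 then [] else [m])" if "\<mu> \<in> partitions m" "adds_box \<mu> [Suc m]" for \<mu>
      proof -
        have "sum_list (tl \<mu>) = 0" using adds_box_sum_list_tl(1)[OF that(2)] by simp
        then have "tl \<mu> = []" using that(1)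
          by (cases \<mu>; cases "tl \<mu>") (auto simp: partitions_def)
        then show ?thesis using that(1) by (cases \<mu>) (auto simp: partitions_def)
      qed
      moreover have "adds_box (if m = 0 then [] else [m]) [Suc m]"
        unfolding adds_box_def
        by (intro exI[of _ "(0, m)"]) (auto simp: young_diagram_def)
      moreover have "(if m = 0 then [] else [m]) \<in> partitions m"
        using single_row_partition[of m] by (simp add: partitions_0)
      ultimately have "{\<mu> \<in> partitions m. adds_box \<mu> [Suc m]} = {if m = 0 then [] else [m]}"
        by blast
      then show ?thesis by simp
    qed
    then show ?case using Suc.IH by (auto split: if_splits)
  qed simp
  then show ?case using n by (simp add: path_set_0 level_size_def)
next
  case (Suc s)
  obtain n' where n': "n = Suc n'" using n by (cases n) auto
  show ?case
  proof (cases "even s")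
    case True
    have "(\<Sum>l\<in>nexts n s (last p). num_std (n - 1) l) = num_std n (last p)" for p
      using n' by (simp add: nexts_even[OF True])
    then show ?thesis using Suc.IH True n
      by (simp add: sum_path_set_Suc level_size_def)
  next
    case False
    have "(\<Sum>l\<in>nexts n s (last p). num_std n l) = n * num_std (n - 1) (last p)" if "p \<in> path_set n s" for p
      using path_set_last_partitions[OF that] False sum_num_std_up[of "last p" n'] n'
      by (simp add: nexts_odd level_size_def)
    then have "(\<Sum>p\<in>path_set n (Suc s). num_std n (last p)) = n * n ^ (s div 2)"
      using Suc.IH False n by (simp add: sum_path_set_Suc level_size_def sum_distrib_left[symmetric])
    then show ?thesis using False by (simp add: level_size_def)
  qed
qed

text \<open>Lengthening the first row leaves the part below it unchanged, so the bound
  \<open>k\<close> is kept; the empty partition becomes \<open>[1]\<close>.\<close>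

lemma hat_A_half_has_cover:
  assumes n: "n > 0" and mu: "\<mu> \<in> hat_A_half n k"
  shows "\<exists>l\<in>hat_A n k. adds_box \<mu> l"
proof -
  define l where "l = (if \<mu> = [] then [1] else Suc (hd \<mu>) # tl \<mu>)"
  have m: "\<mu> \<in> partitions (n - 1)" "sum_list (tl \<mu>) \<le> k" using mu by (auto simp: hat_A_half_def)
  have "l \<in> partitions n"
    using m n by (cases \<mu>) (auto simp: l_def partitions_def)
  moreover have "sum_list (tl l) \<le> k" using m by (simp add: l_def)
  moreover have "(0, row_len \<mu> 0) \<notin> young_diagram \<mu>" by (simp add: young_diagram_iff)
  moreover have "young_diagram l = insert (0, row_len \<mu> 0) (young_diagram \<mu>)"
  proof -
    have "(i, j) \<in> young_diagram l \<longleftrightarrow> (i, j) \<in> insert (0, row_len \<mu> 0) (young_diagram \<mu>)" for i j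
      unfolding insert_iff young_diagram_iff
      by (cases \<mu>; cases i) (auto simp: l_def row_len_def)
    then show ?thesis by auto
  qed
  ultimately show ?thesis by (auto simp: hat_A_def adds_box_def)
qed

text \<open>The end of the last row is always removable. This lowers the part below the first row by
  1, except for a single row, where that part is already empty.\<close>

lemma hat_A_has_cocover:
  assumes n: "n > 0" and l: "l \<in> hat_A n (Suc k)"
  shows "\<exists>\<mu>\<in>hat_A_half n k. adds_box \<mu> l"
proof -
  have lp: "l \<in> partitions n" "sum_list (tl l) \<le> Suc k" using l by (auto simp: hat_A_def)
  define i where "i = length l - 1"
  have "l \<noteq> []" using lp n by (auto simp: partitions_def)
  then have len: "length l = Suc i" by (simp add: i_def)
  define D where "D = young_diagram l - {(i, row_len l i - 1)}"
  have "row_len l (Suc i) < row_len l i"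
    using row_len_pos_iff[OF lp(1), of i] row_len_pos_iff[OF lp(1), of "Suc i"] len by simp
  then have "D \<in> young_diagram ` {\<mu> \<in> partitions (n - 1). adds_box \<mu> l}"
    unfolding removes_box_image[OF lp(1)] D_def by blast
  then obtain \<mu> where mu: "\<mu> \<in> partitions (n - 1)" "adds_box \<mu> l" "D = young_diagram \<mu>" by blast
  have "sum_list (tl \<mu>) \<le> k"
  proof (cases "i = 0")
    case True
    then have "sum_list (tl l) = 0" using len by (cases l) auto
    then show ?thesis using adds_box_sum_list_tl(1)[OF mu(2)] by linarith
  next
    case False
    then have "j < row_len \<mu> 0 \<longleftrightarrow> j < row_len l 0" for j
      using mu(3) young_diagram_iff[of 0 j l] young_diagram_iff[of 0 j \<mu>] by (auto simp: D_def)
    then have "row_len \<mu> 0 = row_len l 0" by (metis linorder_neqE_nat less_irrefl)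
    then show ?thesis
      using adds_box_sum_list[OF mu(2)] lp by (simp add: sum_list_tl)
  qed
  then show ?thesis using mu by (auto simp: hat_A_half_def)
qed

lemma path_set_extend:
  assumes "p \<in> path_set n s" "l \<in> partitions (level_size n (Suc s))" "graph_edge s (last p) l"
  shows "p @ [l] \<in> path_set n (Suc s)"
  using bij_betwE[OF path_set_Suc[of n s]] assms by (auto simp: nexts_def)

text \<open>Every vertex has a predecessor on the previous level. Consequently the shapes of the
  paths exhaust the level, and every multiplicity space is nonzero.\<close>

lemma paths_nonempty:
  assumes n: "n > 0"
  shows "\<forall>l\<in>graph_level n s. paths n s l \<noteq> {}"
proof (induction s)
  case 0
  have "l = [n]" if "l \<in> hat_A n 0" for l
  proof -
    have "sum_list (tl l) = 0" "l \<in> partitions n" using that by (auto simp: hat_A_def)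
    moreover from this have "tl l = []"
      by (cases l; cases "tl l") (auto simp: partitions_def)
    ultimately show ?thesis using n by (cases l) (auto simp: partitions_def)
  qed
  then show ?case using n by (auto simp: paths_eq path_set_0 graph_level_def)
next
  case (Suc s)
  show ?case
  proof
    fix l assume l: "l \<in> graph_level n (Suc s)"
    have "\<exists>\<mu>\<in>graph_level n s. graph_edge s \<mu> l"
    proof (cases "even s")
      case True
      then show ?thesis using hat_A_half_has_cover[OF n, of l "s div 2"] l
        by (auto simp: graph_level_def graph_edge_def)
    next
      case False
      then show ?thesis using hat_A_has_cocover[OF n, of l "s div 2"] l
        by (auto simp: graph_level_def graph_edge_def)
    qed
    then obtain \<mu> p where "p \<in> path_set n s" "last p = \<mu>" "graph_edge s \<mu> l"
      using Suc.IH by (fastforce simp: paths_eq)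
    then have "p @ [l] \<in> path_set n (Suc s)"
      using path_set_extend graph_level_partitions[OF l] by blast
    then show "paths n (Suc s) l \<noteq> {}" by (auto simp: paths_eq)
  qed
qed

section \<open>Linear maps and based algebras\<close>

lemma fscale_apply [simp]: "fscale c f x = c * f x"
  by (simp add: fscale_def)

lemma linear_on_add: "linear_on W \<Phi> \<Longrightarrow> v \<in> W \<Longrightarrow> w \<in> W \<Longrightarrow> \<Phi> (v + w) = \<Phi> v + \<Phi> w"
  by (simp add: linear_on_def)

lemma linear_on_scale: "linear_on W \<Phi> \<Longrightarrow> w \<in> W \<Longrightarrow> \<Phi> (fscale c w) = fscale c (\<Phi> w)"
  by (simp add: linear_on_def)

lemma linear_on_0:
  assumes "cfun.subspace W" "linear_on W \<Phi>" shows "\<Phi> 0 = 0"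
  using linear_on_scale[OF assms(2) cfun.subspace_0[OF assms(1)], of 0] by simp

lemma linear_on_sum:
  assumes W: "cfun.subspace W" and l: "linear_on W \<Phi>" and x: "\<And>i. i \<in> I \<Longrightarrow> x i \<in> W"
  shows "\<Phi> (\<Sum>i\<in>I. x i) = (\<Sum>i\<in>I. \<Phi> (x i))"
  using x
proof (induction I rule: infinite_finite_induct)
  case (insert i I)
  have "\<Phi> (x i + sum x I) = \<Phi> (x i) + \<Phi> (sum x I)"
    by (rule linear_on_add[OF l]) (use insert.prems cfun.subspace_sum[OF W, of I x] in auto)
  moreover have "\<Phi> (sum x I) = (\<Sum>i\<in>I. \<Phi> (x i))"
    using insert by blast
  ultimately have "\<Phi> (sum x (insert i I)) = (\<Sum>i\<in>insert i I. \<Phi> (x i))"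
    using insert.hyps by simp
  then show ?case .
qed (use linear_on_0[OF W l] in simp_all)

lemma linear_on_diff:
  assumes W: "cfun.subspace W" and l: "linear_on W \<Phi>" and x: "x \<in> W" "y \<in> W"
  shows "\<Phi> (x - y) = \<Phi> x - \<Phi> y"
proof -
  have "\<Phi> ((x - y) + y) = \<Phi> (x - y) + \<Phi> y"
    by (rule linear_on_add[OF l cfun.subspace_diff[OF W x] x(2)])
  then show ?thesis by simp
qed

lemma linear_on_compose:
  assumes "linear_on W \<Phi>" "linear_on V \<Psi>" "\<Phi> ` W \<subseteq> V"
  shows "linear_on W (\<lambda>x. \<Psi> (\<Phi> x))"
  using assms unfolding linear_on_def by (simp add: image_subset_iff)

lemma linear_on_eq_0_on_span:
  assumes l: "linear_on (cfun.span S) \<Phi>" and z: "\<And>x. x \<in> S \<Longrightarrow> \<Phi> x = 0" and v: "v \<in> cfun.span S"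
  shows "\<Phi> v = 0"
proof -
  have "v \<in> cfun.span S \<and> \<Phi> v = 0"
    using v
  proof (induction rule: cfun.span_induct_alt)
    case base
    show ?case using linear_on_0[OF cfun.subspace_span l] cfun.span_zero by blast
  next
    case (step c x y)
    note x = cfun.span_base[OF step(1)]
    have "\<Phi> (fscale c x + y) = fscale c (\<Phi> x) + \<Phi> y"
      using linear_on_add[OF l cfun.span_scale[OF x]] linear_on_scale[OF l x] step(2) by metis
    moreover have "\<Phi> y = 0" "\<Phi> x = 0" using step z by blast+
    ultimately have "\<Phi> (fscale c x + y) = 0" by simp
    then show ?case using step(2) cfun.span_add[OF cfun.span_scale[OF x]] by blast
  qed
  then show ?thesis by blast
qed

section \<open>Finite dimension and independent families\<close>

text \<open>The ambient function space may be infinite-dimensional, so finiteness is recorded for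
  the subspace before \<open>cfun.dim\<close> is compared with cardinalities.\<close>

definition fin_dim :: "('x \<Rightarrow> complex) set \<Rightarrow> bool" where
  "fin_dim N \<longleftrightarrow> (\<exists>T. finite T \<and> N \<subseteq> cfun.span T)"

lemma fin_dim_subset: "fin_dim N \<Longrightarrow> M \<subseteq> N \<Longrightarrow> fin_dim M"
  unfolding fin_dim_def by blast

lemma fin_dim_independent:
  assumes N: "fin_dim N" and C: "C \<subseteq> N" "cfun.independent C"
  shows "finite C" "card C \<le> cfun.dim N"
proof -
  obtain T where T: "finite T" "N \<subseteq> cfun.span T" using N fin_dim_def by blast
  obtain B where B: "B \<subseteq> N" "cfun.independent B" "N \<subseteq> cfun.span B" "card B = cfun.dim N"
    using cfun.basis_exists by blast
  have "finite B" using cfun.independent_span_bound[OF T(1) B(2)] B T by blast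
  then show "finite C" "card C \<le> cfun.dim N"
    using cfun.independent_span_bound[of B C] B C by auto
qed

lemma fin_dim_independent_spans:
  assumes N: "fin_dim N" and C: "C \<subseteq> N" "cfun.independent C" and c: "card C \<ge> cfun.dim N"
  shows "N \<subseteq> cfun.span C"
proof
  fix v assume v: "v \<in> N"
  show "v \<in> cfun.span C"
  proof (rule ccontr)
    assume n: "v \<notin> cfun.span C"
    then have "cfun.independent (insert v C)" using C cfun.independent_insertI by blast
    moreover have "insert v C \<subseteq> N" using v C by blast
    ultimately have "card (insert v C) \<le> cfun.dim N" using fin_dim_independent(2)[OF N] by blast
    moreover have "v \<notin> C" using n cfun.span_base by blast
    ultimately show False using c fin_dim_independent(1)[OF N C] by simp
  qed
qed

text \<open>\<open>cfun.independent\<close> speaks of sets and would overlook repetitions, so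
  injectivity of the indexing is part of the conclusion.\<close>

lemma independent_family:
  fixes g :: "'j \<Rightarrow> 'x \<Rightarrow> complex"
  assumes J: "finite J" and z: "\<And>c. (\<Sum>j\<in>J. fscale (c j) (g j)) = 0 \<Longrightarrow> \<forall>j\<in>J. c j = 0"
  shows "inj_on g J" "cfun.independent (g ` J)"
proof -
  show inj: "inj_on g J"
  proof (rule inj_onI, rule ccontr)
    fix a b assume ab: "a \<in> J" "b \<in> J" "g a = g b" "a \<noteq> b"
    define c :: "'j \<Rightarrow> complex" where "c j = (if j = a then 1 else if j = b then -1 else 0)" for j
    have "(\<Sum>j\<in>J. fscale (c j) (g j)) = (\<Sum>j\<in>{a, b}. fscale (c j) (g j))"
      by (rule sum.mono_neutral_right) (use J ab in \<open>simp_all add: c_def\<close>)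
    also have "\<dots> = 0" using ab by (simp add: c_def fun_eq_iff)
    finally show False using z[of c] ab by (auto simp: c_def)
  qed
  show "cfun.independent (g ` J)"
  proof (rule cfun.independent_if_scalars_zero)
    show "finite (g ` J)" using J by simp
    fix f x assume s: "(\<Sum>x\<in>g ` J. fscale (f x) x) = 0" and x: "x \<in> g ` J"
    have "(\<Sum>j\<in>J. fscale (f (g j)) (g j)) = 0"
      using s inj by (simp add: sum.reindex)
    then show "f x = 0" using z[of "\<lambda>j. f (g j)"] x by auto
  qed
qed

text \<open>For linear \<open>f i\<close> on subspaces \<open>S i\<close> this is injectivity of the
  induced map on the direct sum: each \<open>f i\<close> is injective and the images are
  independent.\<close>

definition jointly_inj ::
    "'i set \<Rightarrow> ('i \<Rightarrow> ('x \<Rightarrow> complex) set) \<Rightarrow> ('i \<Rightarrow> ('x \<Rightarrow> complex) \<Rightarrow> ('y \<Rightarrow> complex)) \<Rightarrow> bool" where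
  "jointly_inj I S f \<longleftrightarrow>
     (\<forall>x. (\<forall>i\<in>I. x i \<in> S i) \<longrightarrow> (\<Sum>i\<in>I. f i (x i)) = 0 \<longrightarrow> (\<forall>i\<in>I. x i = 0))"

lemma jointly_injD:
  "jointly_inj I S f \<Longrightarrow> (\<And>i. i \<in> I \<Longrightarrow> x i \<in> S i) \<Longrightarrow> (\<Sum>i\<in>I. f i (x i)) = 0 \<Longrightarrow> i \<in> I \<Longrightarrow> x i = 0"
  unfolding jointly_inj_def by blast

lemma jointly_inj_unique:
  assumes j: "jointly_inj I S f"
    and S: "\<And>i. i \<in> I \<Longrightarrow> cfun.subspace (S i)" and l: "\<And>i. i \<in> I \<Longrightarrow> linear_on (S i) (f i)"
    and x: "\<And>i. i \<in> I \<Longrightarrow> x i \<in> S i" and y: "\<And>i. i \<in> I \<Longrightarrow> y i \<in> S i"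
    and e: "(\<Sum>i\<in>I. f i (x i)) = (\<Sum>i\<in>I. f i (y i))" and i: "i \<in> I"
  shows "x i = y i"
proof -
  have "(\<Sum>i\<in>I. f i (x i - y i)) = (\<Sum>i\<in>I. f i (x i) - f i (y i))"
    by (rule sum.cong) (use linear_on_diff[OF S l x y] in auto)
  then have "(\<Sum>i\<in>I. f i (x i - y i)) = 0" using e by (simp add: sum_subtractf)
  moreover have "x i - y i \<in> S i" if "i \<in> I" for i
    using cfun.subspace_diff[OF S[OF that] x[OF that] y[OF that]] .
  ultimately have "x i - y i = 0"
    using jointly_injD[OF j, of "\<lambda>i. x i - y i" i] i by blast
  then show ?thesis by simp
qed

text \<open>The images of bases of the \<open>S i\<close> form one independent family in
  \<open>N\<close>. This bounds the sum of the dimensions, and if the bound is attained the family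
  spans \<open>N\<close>.\<close>

lemma jointly_inj_dim:
  assumes I: "finite I" and j: "jointly_inj I S f"
    and S: "\<And>i. i \<in> I \<Longrightarrow> cfun.subspace (S i)" "\<And>i. i \<in> I \<Longrightarrow> fin_dim (S i)"
    and l: "\<And>i. i \<in> I \<Longrightarrow> linear_on (S i) (f i)"
    and N: "fin_dim N" "\<And>i. i \<in> I \<Longrightarrow> f i ` S i \<subseteq> N"
  shows "(\<Sum>i\<in>I. cfun.dim (S i)) \<le> cfun.dim N"
    and "(\<Sum>i\<in>I. cfun.dim (S i)) \<ge> cfun.dim N \<Longrightarrow> w \<in> N \<Longrightarrow>
           \<exists>x. (\<forall>i\<in>I. x i \<in> S i) \<and> (\<Sum>i\<in>I. f i (x i)) = w"
proof -
  have "\<exists>B. \<forall>i\<in>I. B i \<subseteq> S i \<and> cfun.independent (B i) \<and> S i \<subseteq> cfun.span (B i) \<and> card (B i) = cfun.dim (S i)"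
  proof (rule bchoice, rule ballI)
    fix i show "\<exists>B. B \<subseteq> S i \<and> cfun.independent B \<and> S i \<subseteq> cfun.span B \<and> card B = cfun.dim (S i)"
      using cfun.basis_exists[of "S i"] by metis
  qed
  then obtain B where B: "\<And>i. i \<in> I \<Longrightarrow> B i \<subseteq> S i" "\<And>i. i \<in> I \<Longrightarrow> cfun.independent (B i)"
      "\<And>i. i \<in> I \<Longrightarrow> card (B i) = cfun.dim (S i)" by blast
  have fB: "finite (B i)" if "i \<in> I" for i
    using fin_dim_independent[OF S(2) B(1) B(2)] that by blast
  define J where "J = (SIGMA i:I. B i)"
  define g where "g = (\<lambda>(i, b). f i b)"
  have fJ: "finite J" using I fB by (simp add: J_def)
  have comb: "(\<Sum>j\<in>J. fscale (c j) (g j)) = (\<Sum>i\<in>I. f i (\<Sum>b\<in>B i. fscale (c (i, b)) b))" for c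
  proof -
    have "(\<Sum>j\<in>J. fscale (c j) (g j)) = (\<Sum>i\<in>I. \<Sum>b\<in>B i. fscale (c (i, b)) (f i b))"
      unfolding J_def g_def using I fB by (simp add: sum.Sigma case_prod_unfold)
    also have "\<dots> = (\<Sum>i\<in>I. f i (\<Sum>b\<in>B i. fscale (c (i, b)) b))"
    proof (rule sum.cong[OF refl])
      fix i assume i: "i \<in> I"
      have "f i (\<Sum>b\<in>B i. fscale (c (i, b)) b) = (\<Sum>b\<in>B i. f i (fscale (c (i, b)) b))"
        by (rule linear_on_sum[OF S(1)[OF i] l[OF i]])
          (use B(1)[OF i] cfun.subspace_scale[OF S(1)[OF i]] in blast)
      also have "\<dots> = (\<Sum>b\<in>B i. fscale (c (i, b)) (f i b))"
        by (rule sum.cong) (use B(1)[OF i] linear_on_scale[OF l[OF i]] in auto)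
      finally show "(\<Sum>b\<in>B i. fscale (c (i, b)) (f i b)) = f i (\<Sum>b\<in>B i. fscale (c (i, b)) b)" by simp
    qed
    finally show ?thesis .
  qed
  have inS: "(\<Sum>b\<in>B i. fscale (c (i, b)) b) \<in> S i" if "i \<in> I" for i and c :: "'a \<times> ('b \<Rightarrow> complex) \<Rightarrow> complex"
    by (rule cfun.subspace_sum[OF S(1)[OF that]], rule cfun.subspace_scale[OF S(1)[OF that]])
      (use B(1)[OF that] in blast)
  have z: "\<forall>j\<in>J. c j = 0" if "(\<Sum>j\<in>J. fscale (c j) (g j)) = 0" for c
  proof
    fix j assume "j \<in> J"
    then obtain i b where ib: "j = (i, b)" "i \<in> I" "b \<in> B i" by (auto simp: J_def)
    have "(\<Sum>b\<in>B i. fscale (c (i, b)) b) = 0"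
      by (rule jointly_injD[OF j, where x = "\<lambda>i. \<Sum>b\<in>B i. fscale (c (i, b)) b"])
        (use inS that[unfolded comb] ib(2) in auto)
    then show "c j = 0"
      using cfun.independentD[OF B(2)[OF ib(2)] fB[OF ib(2)] order_refl _ ib(3), of "\<lambda>b. c (i, b)"] ib(1) by simp
  qed
  have ind: "inj_on g J" "cfun.independent (g ` J)"
    using independent_family[OF fJ, of g] z by blast+
  have "g ` J \<subseteq> N" using B(1) N(2) by (fastforce simp: g_def J_def)
  note bound = fin_dim_independent[OF N(1) this ind(2)] and spans = fin_dim_independent_spans[OF N(1) this ind(2)]
  have card: "card (g ` J) = (\<Sum>i\<in>I. cfun.dim (S i))"
    using card_image[OF ind(1)] I fB B(3) by (simp add: J_def)
  then show "(\<Sum>i\<in>I. cfun.dim (S i)) \<le> cfun.dim N" using bound(2) by simp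
  assume "(\<Sum>i\<in>I. cfun.dim (S i)) \<ge> cfun.dim N" and w: "w \<in> N"
  then have "w \<in> cfun.span (g ` J)" using spans card by auto
  then obtain u where u: "w = (\<Sum>v\<in>g ` J. fscale (u v) v)"
    using cfun.span_finite[of "g ` J"] fJ by auto
  have "w = (\<Sum>j\<in>J. fscale (u (g j)) (g j))"
    using u ind(1) by (simp add: sum.reindex)
  then have "w = (\<Sum>i\<in>I. f i (\<Sum>b\<in>B i. fscale (u (g (i, b))) b))" unfolding comb .
  then show "\<exists>x. (\<forall>i\<in>I. x i \<in> S i) \<and> (\<Sum>i\<in>I. f i (x i)) = w"
    using inS[of _ "\<lambda>j. u (g j)"] by (intro exI[of _ "\<lambda>i. \<Sum>b\<in>B i. fscale (u (g (i, b))) b"]) simp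
qed

section \<open>Spaces with a finite basis\<close>

lemma subspace_free_space [simp]: "cfun.subspace (free_space X)"
  by (rule cfun.subspaceI) (auto simp: free_space_def)

lemma basis_vec_in_free_space [simp]: "basis_vec x \<in> free_space X \<longleftrightarrow> x \<in> X"
  by (auto simp: free_space_def basis_vec_def)

lemma basis_vec_apply: "basis_vec x y = (if y = x then 1 else 0)"
  by (simp add: basis_vec_def)

lemma free_space_expand:
  assumes "finite X" "f \<in> free_space X"
  shows "(\<Sum>x\<in>X. fscale (f x) (basis_vec x)) = f"
proof
  fix y
  have "(\<Sum>x\<in>X. fscale (f x) (basis_vec x)) y = (\<Sum>x\<in>X. if x = y then f x else 0)"
    unfolding sum_fun_apply by (rule sum.cong) (auto simp: basis_vec_apply)
  also have "\<dots> = f y" using assms by (auto simp: free_space_def)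
  finally show "(\<Sum>x\<in>X. fscale (f x) (basis_vec x)) y = f y" .
qed

lemma free_space_span:
  assumes "finite X" shows "free_space X = cfun.span (basis_vec ` X)"
proof
  show "free_space X \<subseteq> cfun.span (basis_vec ` X)"
  proof
    fix f assume f: "f \<in> free_space X"
    have "(\<Sum>x\<in>X. fscale (f x) (basis_vec x)) \<in> cfun.span (basis_vec ` X)"
      by (intro cfun.span_sum cfun.span_scale cfun.span_base) simp
    then show "f \<in> cfun.span (basis_vec ` X)" using free_space_expand[OF assms f] by simp
  qed
  show "cfun.span (basis_vec ` X) \<subseteq> free_space X"
    by (rule cfun.span_minimal) auto
qed

lemma fin_dim_free_space: "finite X \<Longrightarrow> fin_dim (free_space X)"
  unfolding fin_dim_def using free_space_span by blast

lemma dim_free_space: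
  assumes X: "finite X" shows "cfun.dim (free_space X) = card X"
proof -
  have z: "\<forall>x\<in>X. c x = 0" if "(\<Sum>x\<in>X. fscale (c x) (basis_vec x)) = 0" for c :: "'a \<Rightarrow> complex"
  proof
    fix x assume x: "x \<in> X"
    have "(\<Sum>x\<in>X. fscale (c x) (basis_vec x)) x = (\<Sum>y\<in>X. if y = x then c y else 0)"
      unfolding sum_fun_apply by (rule sum.cong) (auto simp: basis_vec_apply)
    then show "c x = 0" using that X x by simp
  qed
  note i = independent_family[OF X, of basis_vec, OF z]
  show ?thesis
    unfolding free_space_span[OF X]
    using cfun.dim_span_eq_card_independent[OF i(2)] card_image[OF i(1)] by simp
qed

lemma linear_on_free_space_eqI:
  assumes X: "finite X" and l: "linear_on (free_space X) \<Phi>" "linear_on (free_space X) \<Psi>"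
    and e: "\<And>x. x \<in> X \<Longrightarrow> \<Phi> (basis_vec x) = \<Psi> (basis_vec x)" and f: "f \<in> free_space X"
  shows "\<Phi> f = \<Psi> f"
proof -
  have *: "\<Theta> f = (\<Sum>x\<in>X. fscale (f x) (\<Theta> (basis_vec x)))" if t: "linear_on (free_space X) \<Theta>" for \<Theta> :: "('a \<Rightarrow> complex) \<Rightarrow> ('b \<Rightarrow> complex)"
  proof -
    have "\<Theta> (\<Sum>x\<in>X. fscale (f x) (basis_vec x)) = (\<Sum>x\<in>X. \<Theta> (fscale (f x) (basis_vec x)))"
      by (rule linear_on_sum[OF _ t]) (auto intro: cfun.subspace_scale)
    also have "\<dots> = (\<Sum>x\<in>X. fscale (f x) (\<Theta> (basis_vec x)))"
      by (rule sum.cong) (auto intro: linear_on_scale[OF t])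
    finally show ?thesis using free_space_expand[OF X f] by simp
  qed
  show ?thesis using *[OF l(1)] *[OF l(2)] e by simp
qed

section \<open>Actions of algebras with a given basis\<close>

text \<open>The linear extension of \<open>r\<close> at a product, expanded over pairs of basis
  elements; this reduces the module laws to the basis.\<close>

lemma based_algebra_mult_sum:
  assumes B: "finite B" and m: "\<And>a b. a \<in> B \<Longrightarrow> b \<in> B \<Longrightarrow> m a b \<in> B"
  shows "(\<Sum>b\<in>B. fscale (monoid.mult (based_algebra B m q e) f g b) (r b))
       = (\<Sum>b1\<in>B. \<Sum>b2\<in>B. fscale (f b1 * g b2 * q b1 b2) (r (m b1 b2)))"
proof
  fix y
  have "(\<Sum>b\<in>B. fscale (monoid.mult (based_algebra B m q e) f g b) (r b)) y
      = (\<Sum>b\<in>B. \<Sum>b1\<in>B. \<Sum>b2\<in>B. f b1 * g b2 * q b1 b2 * (if b = m b1 b2 then 1 else 0) * r b y)"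
    by (simp add: based_algebra_def sum_fun_apply sum_distrib_right basis_vec_apply)
  also have "\<dots> = (\<Sum>b1\<in>B. \<Sum>b\<in>B. \<Sum>b2\<in>B. f b1 * g b2 * q b1 b2 * (if b = m b1 b2 then 1 else 0) * r b y)"
    by (rule sum.swap)
  also have "\<dots> = (\<Sum>b1\<in>B. \<Sum>b2\<in>B. \<Sum>b\<in>B. f b1 * g b2 * q b1 b2 * (if b = m b1 b2 then 1 else 0) * r b y)"
    by (rule sum.cong[OF refl], rule sum.swap)
  also have "\<dots> = (\<Sum>b1\<in>B. \<Sum>b2\<in>B. f b1 * g b2 * q b1 b2 * r (m b1 b2) y)"
  proof (intro sum.cong refl)
    fix b1 b2 assume b: "b1 \<in> B" "b2 \<in> B"
    have "(\<Sum>b\<in>B. f b1 * g b2 * q b1 b2 * (if b = m b1 b2 then 1 else 0) * r b y)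
        = (\<Sum>b\<in>B. if b = m b1 b2 then f b1 * g b2 * q b1 b2 * r b y else 0)"
      by (rule sum.cong) auto
    then show "(\<Sum>b\<in>B. f b1 * g b2 * q b1 b2 * (if b = m b1 b2 then 1 else 0) * r b y) = f b1 * g b2 * q b1 b2 * r (m b1 b2) y"
      using B m[OF b] by simp
  qed
  finally show "(\<Sum>b\<in>B. fscale (monoid.mult (based_algebra B m q e) f g b) (r b)) y
       = (\<Sum>b1\<in>B. \<Sum>b2\<in>B. fscale (f b1 * g b2 * q b1 b2) (r (m b1 b2))) y"
    by (simp add: sum_fun_apply)
qed

text \<open>Serves left and right modules alike: the order of multiplication enters only in
  \<open>left_moduleI\<close> and \<open>right_moduleI\<close>, as a law for two basis
  elements.\<close>

locale based_action =
  fixes B :: "'b set" and m :: "'b \<Rightarrow> 'b \<Rightarrow> 'b" and q :: "'b \<Rightarrow> 'b \<Rightarrow> complex" and e :: 'b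
    and S :: "('x \<Rightarrow> complex) set" and r :: "'b \<Rightarrow> ('x \<Rightarrow> complex) \<Rightarrow> 'x \<Rightarrow> complex"
    and act :: "('b \<Rightarrow> complex) \<Rightarrow> ('x \<Rightarrow> complex) \<Rightarrow> 'x \<Rightarrow> complex"
  assumes finite_B: "finite B" and closed: "\<And>a b. a \<in> B \<Longrightarrow> b \<in> B \<Longrightarrow> m a b \<in> B" and unit_in: "e \<in> B"
    and subspace_S: "cfun.subspace S"
    and r_in: "\<And>b w. b \<in> B \<Longrightarrow> w \<in> S \<Longrightarrow> r b w \<in> S"
    and r_linear: "\<And>b. b \<in> B \<Longrightarrow> linear_on S (r b)"
    and r_unit: "\<And>w. w \<in> S \<Longrightarrow> r e w = w"
    and act_eq: "\<And>a w. a \<in> free_space B \<Longrightarrow> w \<in> S \<Longrightarrow> act a w = (\<Sum>b\<in>B. fscale (a b) (r b w))"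
begin

abbreviation "alg \<equiv> based_algebra B m q e"

lemma act_in: "a \<in> free_space B \<Longrightarrow> w \<in> S \<Longrightarrow> act a w \<in> S"
  unfolding act_eq
  by (rule cfun.subspace_sum[OF subspace_S], rule cfun.subspace_scale[OF subspace_S], rule r_in)

lemma act_linear:
  assumes a: "a \<in> free_space B" shows "linear_on S (act a)"
  unfolding linear_on_def
proof (intro conjI ballI allI)
  fix v w assume vw: "v \<in> S" "w \<in> S"
  have "act a (v + w) = (\<Sum>b\<in>B. fscale (a b) (r b v + r b w))"
    using vw act_eq[OF a cfun.subspace_add[OF subspace_S vw]] linear_on_add[OF r_linear] by simp
  then show "act a (v + w) = act a v + act a w"
    using act_eq[OF a] vw by (simp add: cfun.scale_right_distrib sum.distrib)
next
  fix c w assume w: "w \<in> S"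
  have "act a (fscale c w) = (\<Sum>b\<in>B. fscale (a b) (fscale c (r b w)))"
    using w act_eq[OF a cfun.subspace_scale[OF subspace_S w]] linear_on_scale[OF r_linear] by simp
  then show "act a (fscale c w) = fscale c (act a w)"
    using act_eq[OF a] w by (simp add: cfun.scale_sum_right mult.commute)
qed

lemma act_basis_vec: "b \<in> B \<Longrightarrow> w \<in> S \<Longrightarrow> act (basis_vec b) w = r b w"
proof -
  assume b: "b \<in> B" and w: "w \<in> S"
  have "act (basis_vec b) w = (\<Sum>b'\<in>B. fscale (basis_vec b b') (r b' w))"
    by (rule act_eq) (use b w in simp_all)
  also have "\<dots> = (\<Sum>b'\<in>B. if b' = b then r b' w else 0)"
    by (rule sum.cong) (auto simp: basis_vec_apply)
  finally show ?thesis using b finite_B by simp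
qed

lemma mult_in: "monoid.mult alg a b \<in> free_space B"
  unfolding based_algebra_def monoid.simps
  by (intro cfun.subspace_sum cfun.subspace_scale subspace_free_space) (simp add: closed)

lemma bilinear: "bilinear_action alg \<lparr>mspace = S, mact = act\<rparr>"
  unfolding bilinear_action_def
proof (intro conjI ballI allI; clarsimp)
  have carrier: "carrier alg = free_space B" by (simp add: based_algebra_def)
  show "cfun.subspace S" by (rule subspace_S)
  show "linear_on S (act a)" if "a \<in> carrier alg" for a using act_linear that carrier by simp
  show "act a w \<in> S" if "a \<in> carrier alg" "w \<in> S" for a w using act_in that carrier by simp
  show "act (add alg a b) w = act a w + act b w" if "a \<in> carrier alg" "b \<in> carrier alg" "w \<in> S" for a b w
  proof -
    have "a + b \<in> free_space B" using that carrier cfun.subspace_add[OF subspace_free_space] by blast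
    then show ?thesis
      using that carrier by (simp add: act_eq based_algebra_def cfun.scale_left_distrib sum.distrib)
  qed
  show "act (smult alg c a) w = fscale c (act a w)" if "a \<in> carrier alg" "w \<in> S" for c a w
  proof -
    have "fscale c a \<in> free_space B" using that carrier cfun.subspace_scale[OF subspace_free_space] by blast
    then show ?thesis using that carrier by (simp add: act_eq based_algebra_def cfun.scale_sum_right)
  qed
  show "act (one alg) w = w" if "w \<in> S" for w
    using act_basis_vec[OF unit_in that] r_unit[OF that] by (simp add: based_algebra_def)
qed

lemma act_act:
  assumes a: "a \<in> free_space B" and b: "b \<in> free_space B" and w: "w \<in> S"
  shows "act a (act b w) = (\<Sum>b1\<in>B. \<Sum>b2\<in>B. fscale (a b1 * b b2) (r b1 (r b2 w)))"
proof -
  have "act a (act b w) = (\<Sum>b1\<in>B. fscale (a b1) (r b1 (\<Sum>b2\<in>B. fscale (b b2) (r b2 w))))"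
    using act_eq[OF a act_in[OF b w]] act_eq[OF b w] by simp
  also have "\<dots> = (\<Sum>b1\<in>B. \<Sum>b2\<in>B. fscale (a b1 * b b2) (r b1 (r b2 w)))"
  proof (rule sum.cong[OF refl])
    fix b1 assume b1: "b1 \<in> B"
    have "r b1 (\<Sum>b2\<in>B. fscale (b b2) (r b2 w)) = (\<Sum>b2\<in>B. r b1 (fscale (b b2) (r b2 w)))"
      by (rule linear_on_sum[OF subspace_S r_linear[OF b1]])
        (use cfun.subspace_scale[OF subspace_S] r_in w in blast)
    also have "\<dots> = (\<Sum>b2\<in>B. fscale (b b2) (r b1 (r b2 w)))"
      by (rule sum.cong) (use linear_on_scale[OF r_linear[OF b1]] r_in w in auto)
    finally show "fscale (a b1) (r b1 (\<Sum>b2\<in>B. fscale (b b2) (r b2 w))) = (\<Sum>b2\<in>B. fscale (a b1 * b b2) (r b1 (r b2 w)))"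
      by (simp add: cfun.scale_sum_right)
  qed
  finally show ?thesis .
qed

lemma act_mult:
  assumes "w \<in> S"
  shows "act (monoid.mult alg a b) w = (\<Sum>b1\<in>B. \<Sum>b2\<in>B. fscale (a b1 * b b2) (fscale (q b1 b2) (r (m b1 b2) w)))"
  unfolding act_eq[OF mult_in assms] by (subst based_algebra_mult_sum[OF finite_B closed]) simp_all

lemma left_moduleI:
  assumes "\<And>b1 b2 w. b1 \<in> B \<Longrightarrow> b2 \<in> B \<Longrightarrow> w \<in> S \<Longrightarrow> r b1 (r b2 w) = fscale (q b1 b2) (r (m b1 b2) w)"
  shows "left_module alg \<lparr>mspace = S, mact = act\<rparr>"
  unfolding left_module_def
proof (intro conjI ballI bilinear)
  fix a b w assume ab: "a \<in> carrier alg" "b \<in> carrier alg" and "w \<in> mspace \<lparr>mspace = S, mact = act\<rparr>"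
  then have w: "w \<in> S" and f: "a \<in> free_space B" "b \<in> free_space B" by (simp_all add: based_algebra_def)
  have "act (monoid.mult alg a b) w = act a (act b w)"
    unfolding act_mult[OF w] act_act[OF f w] using assms w by simp
  then show "mact \<lparr>mspace = S, mact = act\<rparr> (monoid.mult alg a b) w
    = mact \<lparr>mspace = S, mact = act\<rparr> a (mact \<lparr>mspace = S, mact = act\<rparr> b w)" by simp
qed

lemma right_moduleI:
  assumes "\<And>b1 b2 w. b1 \<in> B \<Longrightarrow> b2 \<in> B \<Longrightarrow> w \<in> S \<Longrightarrow> r b2 (r b1 w) = fscale (q b1 b2) (r (m b1 b2) w)"
  shows "right_module alg \<lparr>mspace = S, mact = act\<rparr>"
  unfolding right_module_def
proof (intro conjI ballI bilinear)
  fix a b w assume ab: "a \<in> carrier alg" "b \<in> carrier alg" and "w \<in> mspace \<lparr>mspace = S, mact = act\<rparr>"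
  then have w: "w \<in> S" and f: "a \<in> free_space B" "b \<in> free_space B" by (simp_all add: based_algebra_def)
  have "act (monoid.mult alg a b) w = (\<Sum>b1\<in>B. \<Sum>b2\<in>B. fscale (b b2 * a b1) (r b2 (r b1 w)))"
    unfolding act_mult[OF w] using assms w by (simp add: mult.commute)
  also have "\<dots> = act b (act a w)"
    unfolding act_act[OF f(2,1) w] by (rule sum.swap)
  finally show "mact \<lparr>mspace = S, mact = act\<rparr> (monoid.mult alg a b) w
    = mact \<lparr>mspace = S, mact = act\<rparr> b (mact \<lparr>mspace = S, mact = act\<rparr> a w)" by simp
qed

end

section \<open>Permutation representations\<close>

text \<open>\<open>h\<close> may lead out of \<open>X\<close>: the same operator serves for the
  group elements and for the insertion of an entry in \<open>lift\<close>.\<close>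

definition push :: "'x set \<Rightarrow> ('x \<Rightarrow> 'x) \<Rightarrow> ('x \<Rightarrow> complex) \<Rightarrow> 'x \<Rightarrow> complex" where
  "push X h f = (\<Sum>x\<in>X. fscale (f x) (basis_vec (h x)))"

lemma push_add: "push X h (f + g) = push X h f + push X h g"
  by (simp add: push_def cfun.scale_left_distrib sum.distrib)

lemma push_scale: "push X h (fscale c f) = fscale c (push X h f)"
  by (simp add: push_def cfun.scale_sum_right)

lemma linear_on_push [simp]: "linear_on W (push X h)"
  by (simp add: linear_on_def push_add push_scale)

lemma push_sum: "push X h (\<Sum>i\<in>I. f i) = (\<Sum>i\<in>I. push X h (f i))"
  by (rule linear_on_sum[of UNIV]) auto

lemma push_basis_vec: "finite X \<Longrightarrow> x \<in> X \<Longrightarrow> push X h (basis_vec x) = basis_vec (h x)"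
proof -
  assume "finite X" "x \<in> X"
  moreover have "push X h (basis_vec x) = (\<Sum>y\<in>X. if y = x then basis_vec (h y) else 0)"
    unfolding push_def by (rule sum.cong) (auto simp: basis_vec_apply)
  ultimately show ?thesis by simp
qed

locale perm_rep =
  fixes m :: nat and X :: "'x set" and act :: "(nat \<Rightarrow> nat) \<Rightarrow> 'x \<Rightarrow> 'x"
  assumes finite_X: "finite X"
    and act_closed: "\<And>\<sigma> x. \<sigma> permutes {1..m} \<Longrightarrow> x \<in> X \<Longrightarrow> act \<sigma> x \<in> X"
    and act_comp: "\<And>\<sigma> \<tau> x. \<sigma> permutes {1..m} \<Longrightarrow> \<tau> permutes {1..m} \<Longrightarrow> x \<in> X \<Longrightarrow> act (\<sigma> \<circ> \<tau>) x = act \<sigma> (act \<tau> x)"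
    and act_id: "\<And>x. x \<in> X \<Longrightarrow> act id x = x"
begin

abbreviation rep :: "(nat \<Rightarrow> nat) \<Rightarrow> ('x \<Rightarrow> complex) \<Rightarrow> 'x \<Rightarrow> complex" where
  "rep \<sigma> \<equiv> push X (act \<sigma>)"

lemma act_inv1:
  assumes "\<sigma> permutes {1..m}" "x \<in> X"
  shows "act (inv' \<sigma>) (act \<sigma> x) = x"
  using act_comp[OF permutes_inv[OF assms(1)] assms] assms act_id permutes_inv_o(2)[OF assms(1)] by simp

lemma act_inv2:
  assumes "\<sigma> permutes {1..m}" "x \<in> X"
  shows "act \<sigma> (act (inv' \<sigma>) x) = x"
  using act_comp[OF assms(1) permutes_inv[OF assms(1)] assms(2)] assms act_id permutes_inv_o(1)[OF assms(1)] by simp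

lemma act_bij: "\<sigma> permutes {1..m} \<Longrightarrow> bij_betw (act \<sigma>) X X"
  by (rule bij_betw_byWitness[where f' = "act (inv' \<sigma>)"])
    (use act_inv1 act_inv2 act_closed act_closed[OF permutes_inv] in auto)

text \<open>Pushing basis vectors forward pulls coefficients back, hence the inverse.\<close>

lemma rep_apply:
  assumes s: "\<sigma> permutes {1..m}"
  shows "rep \<sigma> f y = (if y \<in> X then f (act (inv' \<sigma>) y) else 0)"
proof -
  have "rep \<sigma> f y = (\<Sum>x\<in>X. f x * (if y = act \<sigma> x then 1 else 0))"
    by (simp add: push_def sum_fun_apply basis_vec_apply)
  also have "\<dots> = (if y \<in> X then f (act (inv' \<sigma>) y) else 0)"
  proof (cases "y \<in> X")
    case True
    have "(\<Sum>x\<in>X. f x * (if y = act \<sigma> x then 1 else 0)) = (\<Sum>x\<in>X. if x = act (inv' \<sigma>) y then f x else 0)"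
      by (rule sum.cong) (use act_inv1[OF s] act_inv2[OF s True] in auto)
    then show ?thesis using True act_closed[OF permutes_inv[OF s]] finite_X by simp
  next
    case False
    then show ?thesis using act_closed[OF s] by (auto intro!: sum.neutral)
  qed
  finally show ?thesis .
qed

lemma rep_apply_act: "\<sigma> permutes {1..m} \<Longrightarrow> x \<in> X \<Longrightarrow> rep \<sigma> f (act \<sigma> x) = f x"
  by (simp add: rep_apply act_closed act_inv1)

lemma rep_in: "\<sigma> permutes {1..m} \<Longrightarrow> rep \<sigma> f \<in> free_space X"
  by (simp add: free_space_def rep_apply)

lemma rep_comp:
  assumes "\<sigma> permutes {1..m}" "\<tau> permutes {1..m}"
  shows "rep (\<sigma> \<circ> \<tau>) f = rep \<sigma> (rep \<tau> f)"
proof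
  fix y show "rep (\<sigma> \<circ> \<tau>) f y = rep \<sigma> (rep \<tau> f) y"
    using assms act_comp[OF permutes_inv[OF assms(2)] permutes_inv[OF assms(1)], of y]
      act_closed[OF permutes_inv[OF assms(1)], of y]
    by (simp add: rep_apply permutes_compose o_inv_distrib permutes_bij)
qed

lemma rep_id: "f \<in> free_space X \<Longrightarrow> rep id f = f"
  by (rule ext) (use rep_apply[OF permutes_id] act_id in \<open>auto simp: free_space_def\<close>)

lemma perm_action_eq:
  "perm_action m X act a f = (\<Sum>\<sigma>\<in>carrier (sym_group m). fscale (a \<sigma>) (rep \<sigma> f))"
  by (simp add: perm_action_def push_def cfun.scale_sum_right)

lemma finite_sym_group: "finite (carrier (sym_group m))"
  by (simp add: sym_group_def finite_permutations)

lemma perm_based_action: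
  assumes "cfun.subspace S" "\<And>\<sigma> v. \<sigma> permutes {1..m} \<Longrightarrow> v \<in> S \<Longrightarrow> rep \<sigma> v \<in> S" "S \<subseteq> free_space X"
  shows "based_action (carrier (sym_group m)) (monoid.mult (sym_group m)) (one (sym_group m)) S rep (perm_action m X act)"
proof
  show "finite (carrier (sym_group m))" by (rule finite_sym_group)
  show "rep \<one>\<^bsub>sym_group m\<^esub> w = w" if "w \<in> S" for w
    using rep_id that assms(3) by (auto simp: sym_group_def)
qed (use assms in \<open>auto simp: sym_group_def permutes_compose permutes_id perm_action_eq\<close>)

lemma perm_left_module:
  assumes "cfun.subspace S" "\<And>\<sigma> v. \<sigma> permutes {1..m} \<Longrightarrow> v \<in> S \<Longrightarrow> rep \<sigma> v \<in> S" "S \<subseteq> free_space X"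
  shows "left_module (group_algebra (sym_group m)) \<lparr>mspace = S, mact = perm_action m X act\<rparr>"
  unfolding group_algebra_def
  by (rule based_action.left_moduleI[OF perm_based_action[OF assms]])
    (use rep_comp in \<open>auto simp: sym_group_def\<close>)

end

text \<open>The group appears only through \<open>m\<close>, so restriction to the stabilizer of a
  point lowers \<open>m\<close> and leaves the sets and actions as they are.\<close>

definition equivariant_on ::
    "nat \<Rightarrow> 'x set \<Rightarrow> ((nat \<Rightarrow> nat) \<Rightarrow> 'x \<Rightarrow> 'x) \<Rightarrow> 'y set \<Rightarrow> ((nat \<Rightarrow> nat) \<Rightarrow> 'y \<Rightarrow> 'y) \<Rightarrow>
      ('x \<Rightarrow> complex) set \<Rightarrow> (('x \<Rightarrow> complex) \<Rightarrow> 'y \<Rightarrow> complex) \<Rightarrow> bool" where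
  "equivariant_on m X act Y act' S f \<longleftrightarrow> linear_on S f \<and>
     (\<forall>\<sigma> v. \<sigma> permutes {1..m} \<longrightarrow> v \<in> S \<longrightarrow> f (push X (act \<sigma>) v) = push Y (act' \<sigma>) (f v))"

section \<open>Specht modules\<close>

declare One_nat_def [simp del]

abbreviation tabloids :: "nat \<Rightarrow> nat list \<Rightarrow> (nat \<Rightarrow> nat set) set" where
  "tabloids m l \<equiv> tabloid l ` tableaux m l"

abbreviation tact :: "(nat \<Rightarrow> nat) \<Rightarrow> (nat \<Rightarrow> nat set) \<Rightarrow> nat \<Rightarrow> nat set" where
  "tact \<equiv> \<lambda>\<sigma> s i. \<sigma> ` s i"

abbreviation tabloid_rep :: "nat \<Rightarrow> nat list \<Rightarrow> (nat \<Rightarrow> nat) \<Rightarrow> ((nat \<Rightarrow> nat set) \<Rightarrow> complex) \<Rightarrow> (nat \<Rightarrow> nat set) \<Rightarrow> complex" where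
  "tabloid_rep m l \<sigma> \<equiv> push (tabloids m l) (tact \<sigma>)"

abbreviation specht_space :: "nat \<Rightarrow> nat list \<Rightarrow> ((nat \<Rightarrow> nat set) \<Rightarrow> complex) set" where
  "specht_space m l \<equiv> cfun.span (polytabloid m l ` tableaux m l)"

lemma tableaux_bij: "t \<in> tableaux m l \<Longrightarrow> bij_betw t (young_diagram l) {1..m}"
  by (simp add: tableaux_def)

lemma tableaux_comp: "t \<in> tableaux m l \<Longrightarrow> \<sigma> permutes {1..m} \<Longrightarrow> \<sigma> \<circ> t \<in> tableaux m l"
  unfolding tableaux_def using bij_betw_trans permutes_imp_bij by blast

lemma tableaux_nonempty: "l \<in> partitions m \<Longrightarrow> \<exists>t. t \<in> tableaux m l"
  unfolding tableaux_def
  using finite_same_card_bij[OF finite_young_diagram finite_atLeastAtMost, of l 1 m]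
  by (auto simp: card_young_diagram_partition)

lemma tabloid_comp: "tabloid l (\<sigma> \<circ> t) = tact \<sigma> (tabloid l t)"
  by (auto simp: tabloid_def)

lemma tabloid_subset: "t \<in> tableaux m l \<Longrightarrow> tabloid l t i \<subseteq> {1..m}"
  using tableaux_bij bij_betwE by (fastforce simp: tabloid_def)

lemma finite_tabloids: "finite (tabloids m l)"
proof (rule finite_subset)
  show "tabloids m l \<subseteq> {s. \<forall>i. (i \<in> {..<length l} \<longrightarrow> s i \<in> Pow {1..m}) \<and> (i \<notin> {..<length l} \<longrightarrow> s i = {})}"
  proof
    fix s assume "s \<in> tabloids m l"
    then obtain t where t: "t \<in> tableaux m l" "s = tabloid l t" by blast
    have "tabloid l t i = {}" if "i \<notin> {..<length l}" for i
      using that by (auto simp: tabloid_def young_diagram_def)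
    then show "s \<in> {s. \<forall>i. (i \<in> {..<length l} \<longrightarrow> s i \<in> Pow {1..m}) \<and> (i \<notin> {..<length l} \<longrightarrow> s i = {})}"
      using tabloid_subset[OF t(1)] t(2) by blast
  qed
  show "finite {s. \<forall>i. (i \<in> {..<length l} \<longrightarrow> s i \<in> Pow {1..m}) \<and> (i \<notin> {..<length l} \<longrightarrow> s i = ({}::nat set))}"
    by (rule finite_set_of_finite_funs) auto
qed

lemma tact_tabloids:
  assumes "\<sigma> permutes {1..m}" "s \<in> tabloids m l"
  shows "tact \<sigma> s \<in> tabloids m l"
proof -
  obtain t where t: "t \<in> tableaux m l" "s = tabloid l t" using assms(2) by blast
  then have "tact \<sigma> s = tabloid l (\<sigma> \<circ> t)" by (simp add: tabloid_comp)
  then show ?thesis using tableaux_comp[OF t(1) assms(1)] by blast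
qed

global_interpretation tab: perm_rep m "tabloids m l" tact for m l
  by unfold_locales (auto simp: finite_tabloids image_comp intro: tact_tabloids)

section \<open>Rows and columns of a tableau, column stabilizers\<close>

definition col_of :: "nat list \<Rightarrow> (nat \<times> nat \<Rightarrow> nat) \<Rightarrow> nat \<Rightarrow> nat" where
  "col_of l t a = snd (inv_into (young_diagram l) t a)"

definition row_of :: "nat list \<Rightarrow> (nat \<times> nat \<Rightarrow> nat) \<Rightarrow> nat \<Rightarrow> nat" where
  "row_of l t a = fst (inv_into (young_diagram l) t a)"

lemma inv_tableau: "t \<in> tableaux m l \<Longrightarrow> (i, j) \<in> young_diagram l \<Longrightarrow> inv_into (young_diagram l) t (t (i, j)) = (i, j)"
  using tableaux_bij bij_betw_imp_inj_on by (metis inv_into_f_f)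

lemma tableau_cell:
  assumes "t \<in> tableaux m l" "a \<in> {1..m}"
  shows "(row_of l t a, col_of l t a) \<in> young_diagram l" "t (row_of l t a, col_of l t a) = a"
proof -
  have "a \<in> t ` young_diagram l" using tableaux_bij[OF assms(1)] assms(2) by (simp add: bij_betw_def)
  then show "(row_of l t a, col_of l t a) \<in> young_diagram l" "t (row_of l t a, col_of l t a) = a"
    using inv_into_into[of a t "young_diagram l"] f_inv_into_f[of a t "young_diagram l"]
    by (simp_all add: row_of_def col_of_def)
qed

lemma tableau_in: "t \<in> tableaux m l \<Longrightarrow> c \<in> young_diagram l \<Longrightarrow> t c \<in> {1..m}"
  using tableaux_bij bij_betwE by blast

lemma row_col_of_tableau:
  assumes "t \<in> tableaux m l" "(i, j) \<in> young_diagram l"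
  shows "row_of l t (t (i, j)) = i" "col_of l t (t (i, j)) = j"
  using inv_tableau[OF assms] by (simp_all add: row_of_def col_of_def)

lemma tabloid_row_of:
  assumes t: "t \<in> tableaux m l" shows "tabloid l t i = {a \<in> {1..m}. row_of l t a = i}"
proof (rule subset_antisym; rule subsetI)
  fix a assume "a \<in> tabloid l t i"
  then obtain j where "a = t (i, j)" "(i, j) \<in> young_diagram l" by (auto simp: tabloid_def)
  then show "a \<in> {a \<in> {1..m}. row_of l t a = i}" using t tableau_in row_col_of_tableau by simp
next
  fix a assume a: "a \<in> {a \<in> {1..m}. row_of l t a = i}"
  then show "a \<in> tabloid l t i" using tableau_cell[OF t, of a] by (auto simp: tabloid_def) metis
qed

text \<open>The stabilizer consists of the permutations that preserve the function
  \<open>col_of l t\<close>; from this form closure under products and inverses is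
  immediate.\<close>

lemma column_stabilizer_iff:
  assumes t: "t \<in> tableaux m l"
  shows "q \<in> column_stabilizer m l t \<longleftrightarrow> q permutes {1..m} \<and> (\<forall>a\<in>{1..m}. col_of l t (q a) = col_of l t a)"
    (is "?L \<longleftrightarrow> ?R")
proof
  assume L: ?L
  then have q: "q permutes {1..m}" by (simp add: column_stabilizer_def sym_group_def)
  have "col_of l t (q a) = col_of l t a" if a: "a \<in> {1..m}" for a
  proof -
    obtain i' where "(i', col_of l t a) \<in> young_diagram l" "q (t (row_of l t a, col_of l t a)) = t (i', col_of l t a)"
      using L tableau_cell(1)[OF t a] unfolding column_stabilizer_def by blast
    then show ?thesis using tableau_cell(2)[OF t a] row_col_of_tableau[OF t] by simp
  qed
  then show ?R using q by blast
next
  assume R: ?R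
  have "\<exists>i'. (i', j) \<in> young_diagram l \<and> q (t (i, j)) = t (i', j)" if ij: "(i, j) \<in> young_diagram l" for i j
  proof -
    have a: "t (i, j) \<in> {1..m}" using tableau_in[OF t ij] .
    then have "q (t (i, j)) \<in> {1..m}" using R permutes_in_image by metis
    from tableau_cell[OF t this] show ?thesis
      using R a row_col_of_tableau[OF t ij] by (intro exI[of _ "row_of l t (q (t (i, j)))"]) simp
  qed
  then show ?L using R by (auto simp: column_stabilizer_def sym_group_def)
qed

lemma column_stabilizer_permutes: "q \<in> column_stabilizer m l t \<Longrightarrow> q permutes {1..m}"
  by (simp add: column_stabilizer_def sym_group_def)

lemma finite_column_stabilizer [simp]: "finite (column_stabilizer m l t)"
  by (rule finite_subset[of _ "{q. q permutes {1..m}}"])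
    (auto simp: column_stabilizer_permutes finite_permutations)

lemma permutation_column_stabilizer: "q \<in> column_stabilizer m l t \<Longrightarrow> permutation q"
  using column_stabilizer_permutes permutation_permutes by blast

lemma column_stabilizer_id: "t \<in> tableaux m l \<Longrightarrow> id \<in> column_stabilizer m l t"
  by (simp add: column_stabilizer_iff permutes_id)

lemma column_stabilizer_comp:
  assumes t: "t \<in> tableaux m l" and "p \<in> column_stabilizer m l t" "q \<in> column_stabilizer m l t"
  shows "p \<circ> q \<in> column_stabilizer m l t"
  using assms permutes_in_image[of q "{1..m}"]
  by (auto simp: column_stabilizer_iff[OF t] permutes_compose)

lemma column_stabilizer_inv:
  assumes t: "t \<in> tableaux m l" and q: "q \<in> column_stabilizer m l t"
  shows "inv' q \<in> column_stabilizer m l t"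
proof -
  have p: "q permutes {1..m}" using q column_stabilizer_permutes by blast
  have "col_of l t (inv' q a) = col_of l t a" if "a \<in> {1..m}" for a
  proof -
    have "inv' q a \<in> {1..m}" using that permutes_in_image[OF permutes_inv[OF p]] by blast
    then have "col_of l t (q (inv' q a)) = col_of l t (inv' q a)" using q by (simp add: column_stabilizer_iff[OF t])
    then show ?thesis using permutes_inverses(1)[OF p] by simp
  qed
  then show ?thesis using permutes_inv[OF p] by (simp add: column_stabilizer_iff[OF t])
qed

text \<open>Tableaux are functions on all pairs of numbers and may differ outside the
  diagram.\<close>

lemma column_stabilizer_cong:
  assumes "\<And>c. c \<in> young_diagram l \<Longrightarrow> t c = t' c"
  shows "column_stabilizer m l t = column_stabilizer m l t'" "tabloid l t = tabloid l t'"
proof -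
  have "column_stabilizer m l t \<subseteq> column_stabilizer m l t'" if "\<And>c. c \<in> young_diagram l \<Longrightarrow> t c = t' c" for t t'
    unfolding column_stabilizer_def using that by fastforce
  then show "column_stabilizer m l t = column_stabilizer m l t'" using assms by (metis subset_antisym)
  show "tabloid l t = tabloid l t'" using assms unfolding tabloid_def by (intro ext) metis
qed

lemma polytabloid_cong:
  assumes "\<And>c. c \<in> young_diagram l \<Longrightarrow> t c = t' c"
  shows "polytabloid m l t = polytabloid m l t'"
proof -
  have "tabloid l (q \<circ> t) = tabloid l (q \<circ> t')" for q
    by (rule column_stabilizer_cong(2)) (use assms in simp)
  then show ?thesis using column_stabilizer_cong(1)[OF assms] by (simp add: polytabloid_def)
qed

section \<open>Column antisymmetrizers and polytabloids\<close>

text \<open>The signed column sum \<open>\<kappa>\<^sub>t\<close> of James, acting on an arbitrary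
  permutation module and not just on the tabloids of its own shape.\<close>

definition col_sym :: "nat \<Rightarrow> nat list \<Rightarrow> (nat \<times> nat \<Rightarrow> nat) \<Rightarrow> 'x set \<Rightarrow> ((nat \<Rightarrow> nat) \<Rightarrow> 'x \<Rightarrow> 'x) \<Rightarrow>
    ('x \<Rightarrow> complex) \<Rightarrow> 'x \<Rightarrow> complex" where
  "col_sym m l t X act f = (\<Sum>q\<in>column_stabilizer m l t. fscale (of_int (sign q)) (push X (act q) f))"

lemma linear_on_col_sym: "linear_on W (col_sym m l t X act)"
  unfolding linear_on_def col_sym_def
  by (simp add: push_add push_scale cfun.scale_right_distrib sum.distrib cfun.scale_sum_right mult.commute)

lemma polytabloid_col_sym:
  assumes t: "t \<in> tableaux m l"
  shows "polytabloid m l t = col_sym m l t (tabloids m l) tact (basis_vec (tabloid l t))"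
  unfolding polytabloid_def col_sym_def
  by (rule sum.cong) (use t in \<open>simp_all add: push_basis_vec finite_tabloids tabloid_comp\<close>)

lemma polytabloid_in_free_space: "t \<in> tableaux m l \<Longrightarrow> polytabloid m l t \<in> free_space (tabloids m l)"
  unfolding polytabloid_def
  by (intro cfun.subspace_sum cfun.subspace_scale subspace_free_space)
    (auto intro!: imageI tableaux_comp column_stabilizer_permutes)

lemma specht_space_subset: "specht_space m l \<subseteq> free_space (tabloids m l)"
  by (rule cfun.span_minimal) (auto simp: polytabloid_in_free_space)

lemma fin_dim_specht_space: "fin_dim (specht_space m l)"
  using fin_dim_subset[OF fin_dim_free_space[OF finite_tabloids] specht_space_subset] .

context perm_rep begin

text \<open>Substitute \<open>q \<circ> p\<close> for \<open>q\<close> in the sum over the column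
  stabilizer, which is a group; the sign is multiplicative.\<close>

lemma col_sym_rep:
  assumes t: "t \<in> tableaux m l" and p: "p \<in> column_stabilizer m l t"
  shows "col_sym m l t X act (rep p f) = fscale (of_int (sign p)) (col_sym m l t X act f)"
proof -
  let ?C = "column_stabilizer m l t"
  note perm = column_stabilizer_permutes permutation_column_stabilizer
  have bij: "bij_betw (\<lambda>q. q \<circ> p) ?C ?C"
  proof (rule bij_betw_byWitness[where f' = "\<lambda>q. q \<circ> inv' p"])
    show "\<forall>q\<in>?C. (q \<circ> p) \<circ> inv' p = q" "\<forall>q\<in>?C. (q \<circ> inv' p) \<circ> p = q"
      using permutes_inv_o[OF perm(1)[OF p]] by (simp_all add: o_assoc[symmetric])
    show "(\<lambda>q. q \<circ> p) ` ?C \<subseteq> ?C" "(\<lambda>q. q \<circ> inv' p) ` ?C \<subseteq> ?C"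
      using column_stabilizer_comp[OF t] column_stabilizer_inv[OF t] p by auto
  qed
  have "fscale (of_int (sign p)) (col_sym m l t X act f)
      = (\<Sum>q\<in>?C. fscale (of_int (sign p)) (fscale (of_int (sign (q \<circ> p))) (rep (q \<circ> p) f)))"
    unfolding col_sym_def cfun.scale_sum_right
    by (rule sum.reindex_bij_betw[OF bij, symmetric])
  also have "\<dots> = (\<Sum>q\<in>?C. fscale (of_int (sign q)) (rep q (rep p f)))"
  proof (rule sum.cong[OF refl])
    fix q assume q: "q \<in> ?C"
    have "(of_int (sign p) :: complex) * of_int (sign (q \<circ> p)) = of_int (sign q)"
      unfolding sign_compose[OF perm(2)[OF q] perm(2)[OF p]] of_int_mult[symmetric]
      by (metis mult.left_commute mult.right_neutral sign_idempotent)
    then show "fscale (of_int (sign p)) (fscale (of_int (sign (q \<circ> p))) (rep (q \<circ> p) f)) = fscale (of_int (sign q)) (rep q (rep p f))"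
      using rep_comp[OF perm(1)[OF q] perm(1)[OF p]] by simp
  qed
  finally show ?thesis by (simp add: col_sym_def)
qed

text \<open>A transposition inside a column of \<open>t\<close> that fixes \<open>f\<close> makes
  the value equal to its own negative.\<close>

lemma col_sym_eq_0:
  assumes t: "t \<in> tableaux m l" and ab: "a \<noteq> b" "a \<in> {1..m}" "b \<in> {1..m}" "col_of l t a = col_of l t b"
    and inv: "rep (transpose a b) f = f"
  shows "col_sym m l t X act f = 0"
proof -
  have "transpose a b permutes {1..m}" using ab by (intro permutes_swap_id)
  then have p: "transpose a b \<in> column_stabilizer m l t"
    using ab by (auto simp: column_stabilizer_iff[OF t] transpose_def)
  have "sign (transpose a b) = -1" using ab sign_swap_id[of a b] by simp
  then have e: "col_sym m l t X act f = fscale (-1) (col_sym m l t X act f)"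
    using col_sym_rep[OF t p, of f] inv by simp
  show ?thesis
  proof
    fix x show "col_sym m l t X act f x = 0 x"
      using fun_cong[OF e, of x] by simp
  qed
qed

lemma equivariant_col_sym:
  assumes f: "equivariant_on m Y act' X act S f" and S: "cfun.subspace S"
    and inv: "\<And>\<sigma> v. \<sigma> permutes {1..m} \<Longrightarrow> v \<in> S \<Longrightarrow> push Y (act' \<sigma>) v \<in> S" and v: "v \<in> S"
  shows "f (col_sym m l t Y act' v) = col_sym m l t X act (f v)"
proof -
  have l: "linear_on S f" using f by (simp add: equivariant_on_def)
  have i: "push Y (act' q) v \<in> S" if "q \<in> column_stabilizer m l t" for q
    using inv column_stabilizer_permutes that v by blast
  have "f (col_sym m l t Y act' v) = (\<Sum>q\<in>column_stabilizer m l t. f (fscale (of_int (sign q)) (push Y (act' q) v)))"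
    unfolding col_sym_def by (rule linear_on_sum[OF S l]) (use i cfun.subspace_scale[OF S] in blast)
  also have "\<dots> = col_sym m l t X act (f v)"
    unfolding col_sym_def
    by (rule sum.cong)
      (use i linear_on_scale[OF l] f v column_stabilizer_permutes in \<open>auto simp: equivariant_on_def\<close>)
  finally show ?thesis .
qed

end

lemma col_of_comp:
  assumes t: "t \<in> tableaux m l" and s: "\<sigma> permutes {1..m}" and a: "a \<in> {1..m}"
  shows "col_of l (\<sigma> \<circ> t) (\<sigma> a) = col_of l t a"
  using row_col_of_tableau(2)[OF tableaux_comp[OF t s] tableau_cell(1)[OF t a]] tableau_cell(2)[OF t a] by simp

text \<open>The column stabilizer of \<open>\<sigma> \<circ> t\<close> is the conjugate by
  \<open>\<sigma>\<close> of that of \<open>t\<close>, and conjugation preserves signs.\<close>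

lemma rep_polytabloid:
  assumes t: "t \<in> tableaux m l" and s: "\<sigma> permutes {1..m}"
  shows "tabloid_rep m l \<sigma> (polytabloid m l t) = polytabloid m l (\<sigma> \<circ> t)"
proof -
  let ?C = "column_stabilizer m l t" and ?C' = "column_stabilizer m l (\<sigma> \<circ> t)"
  note st = tableaux_comp[OF t s]
  note si = permutes_inv[OF s]
  have sp: "permutation \<sigma>" using s permutation_permutes by blast
  have conj: "\<tau> \<circ> q \<circ> inv' \<tau> \<in> column_stabilizer m l (\<tau> \<circ> u)"
    if u: "u \<in> tableaux m l" and tau: "\<tau> permutes {1..m}" and q: "q \<in> column_stabilizer m l u" for \<tau> q u
  proof -
    have qp: "q permutes {1..m}" using q column_stabilizer_permutes by blast
    have "col_of l (\<tau> \<circ> u) ((\<tau> \<circ> q \<circ> inv' \<tau>) a) = col_of l (\<tau> \<circ> u) a" if a: "a \<in> {1..m}" for a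
    proof -
      have b: "inv' \<tau> a \<in> {1..m}" using a permutes_in_image[OF permutes_inv[OF tau]] by blast
      then have c: "q (inv' \<tau> a) \<in> {1..m}" using permutes_in_image[OF qp] by blast
      show ?thesis
        using col_of_comp[OF u tau b] col_of_comp[OF u tau c] q b permutes_inverses(1)[OF tau]
        by (simp add: column_stabilizer_iff[OF u])
    qed
    then show ?thesis
      using permutes_compose[OF permutes_inv[OF tau] permutes_compose[OF qp tau]]
      by (simp add: column_stabilizer_iff[OF tableaux_comp[OF u tau]] o_assoc)
  qed
  have bij: "bij_betw (\<lambda>q. \<sigma> \<circ> q \<circ> inv' \<sigma>) ?C ?C'"
  proof (rule bij_betw_byWitness[where f' = "\<lambda>q. inv' \<sigma> \<circ> q \<circ> \<sigma>"])
    show "\<forall>q\<in>?C. inv' \<sigma> \<circ> (\<sigma> \<circ> q \<circ> inv' \<sigma>) \<circ> \<sigma> = q" "\<forall>q\<in>?C'. \<sigma> \<circ> (inv' \<sigma> \<circ> q \<circ> \<sigma>) \<circ> inv' \<sigma> = q"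
      using permutes_inverses[OF s] by (auto simp: fun_eq_iff)
    show "(\<lambda>q. \<sigma> \<circ> q \<circ> inv' \<sigma>) ` ?C \<subseteq> ?C'" using conj[OF t s] by blast
    have "inv' \<sigma> \<circ> (\<sigma> \<circ> t) = t" using permutes_inverses[OF s] by (simp add: fun_eq_iff)
    then show "(\<lambda>q. inv' \<sigma> \<circ> q \<circ> \<sigma>) ` ?C' \<subseteq> ?C"
      using conj[OF st si] permutes_inv_inv[OF s] by auto
  qed
  have "polytabloid m l (\<sigma> \<circ> t) = (\<Sum>q\<in>?C. fscale (of_int (sign (\<sigma> \<circ> q \<circ> inv' \<sigma>))) (basis_vec (tabloid l ((\<sigma> \<circ> q \<circ> inv' \<sigma>) \<circ> (\<sigma> \<circ> t)))))"
    unfolding polytabloid_def by (rule sum.reindex_bij_betw[OF bij, symmetric])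
  also have "\<dots> = (\<Sum>q\<in>?C. fscale (of_int (sign q)) (basis_vec (tabloid l (\<sigma> \<circ> (q \<circ> t)))))"
  proof (rule sum.cong[OF refl])
    fix q assume q: "q \<in> ?C"
    note qp = permutation_column_stabilizer[OF q]
    have "sign (\<sigma> \<circ> q \<circ> inv' \<sigma>) = sign \<sigma> * sign q * sign \<sigma>"
      using sign_compose[OF permutation_compose[OF sp qp] permutation_inverse[OF sp]]
        sign_compose[OF sp qp] sign_inverse[OF sp] by metis
    also have "\<dots> = sign q"
      by (metis mult.assoc mult.commute sign_left_idempotent)
    finally have "sign (\<sigma> \<circ> q \<circ> inv' \<sigma>) = sign q" .
    moreover have "(\<sigma> \<circ> q \<circ> inv' \<sigma>) \<circ> (\<sigma> \<circ> t) = \<sigma> \<circ> (q \<circ> t)"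
      using permutes_inverses[OF s] by (simp add: fun_eq_iff)
    ultimately show "fscale (of_int (sign (\<sigma> \<circ> q \<circ> inv' \<sigma>))) (basis_vec (tabloid l ((\<sigma> \<circ> q \<circ> inv' \<sigma>) \<circ> (\<sigma> \<circ> t))))
      = fscale (of_int (sign q)) (basis_vec (tabloid l (\<sigma> \<circ> (q \<circ> t))))" by simp
  qed
  also have "\<dots> = tabloid_rep m l \<sigma> (polytabloid m l t)"
    unfolding polytabloid_def push_sum push_scale
  proof (rule sum.cong[OF refl])
    fix q assume q: "q \<in> ?C"
    have "tabloid l (q \<circ> t) \<in> tabloids m l" using tableaux_comp[OF t column_stabilizer_permutes[OF q]] by blast
    then show "fscale (of_int (sign q)) (basis_vec (tabloid l (\<sigma> \<circ> (q \<circ> t)))) =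
         fscale (of_int (sign q)) (tabloid_rep m l \<sigma> (basis_vec (tabloid l (q \<circ> t))))"
      by (simp only: push_basis_vec[OF finite_tabloids] tabloid_comp[of l \<sigma>])
  qed
  finally show ?thesis by simp
qed

lemma rep_specht_space:
  assumes s: "\<sigma> permutes {1..m}" and v: "v \<in> specht_space m l"
  shows "tabloid_rep m l \<sigma> v \<in> specht_space m l"
proof -
  let ?U = "{v. tabloid_rep m l \<sigma> v \<in> specht_space m l}"
  have "cfun.subspace ?U"
    by (rule cfun.subspaceI)
      (auto simp: push_add push_scale linear_on_0[OF cfun.subspace_UNIV linear_on_push] cfun.span_zero intro: cfun.span_add cfun.span_scale)
  moreover have "polytabloid m l ` tableaux m l \<subseteq> ?U"
    using rep_polytabloid[OF _ s] tableaux_comp[OF _ s] by (auto intro: cfun.span_base)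
  ultimately have "specht_space m l \<subseteq> ?U" by (intro cfun.span_minimal)
  then show ?thesis using v by blast
qed

lemma polytabloid_apply:
  "polytabloid m l t x = (\<Sum>q\<in>column_stabilizer m l t. if x = tabloid l (q \<circ> t) then of_int (sign q) else 0)"
  unfolding polytabloid_def sum_fun_apply by (rule sum.cong) (auto simp: basis_vec_apply)

text \<open>A permutation preserving both the rows and the columns of \<open>t\<close> fixes every
  entry, so only \<open>id\<close> contributes.\<close>

lemma polytabloid_self:
  assumes t: "t \<in> tableaux m l"
  shows "polytabloid m l t (tabloid l t) = 1"
proof -
  have id: "q = id" if q: "q \<in> column_stabilizer m l t" and e: "tabloid l t = tabloid l (q \<circ> t)" for q
  proof
    fix a
    have qp: "q permutes {1..m}" using q column_stabilizer_permutes by blast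
    show "q a = id a"
    proof (cases "a \<in> {1..m}")
      case True
      have qa: "q a \<in> {1..m}" using True permutes_in_image[OF qp] by blast
      have "q a \<in> tabloid l (q \<circ> t) (row_of l t a)"
        using tableau_cell[OF t True] unfolding tabloid_def by force
      then have "row_of l t (q a) = row_of l t a" using e tabloid_row_of[OF t] by simp
      moreover have "col_of l t (q a) = col_of l t a" using q True by (simp add: column_stabilizer_iff[OF t])
      ultimately show ?thesis using tableau_cell(2)[OF t True] tableau_cell(2)[OF t qa] by simp
    qed (use permutes_not_in[OF qp] in simp)
  qed
  have "polytabloid m l t (tabloid l t) = (\<Sum>q\<in>column_stabilizer m l t. if q = id then 1 else 0)"
    unfolding polytabloid_apply by (rule sum.cong) (use id in auto)
  then show ?thesis using column_stabilizer_id[OF t] by simp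
qed

lemma polytabloid_nonzero: "t \<in> tableaux m l \<Longrightarrow> polytabloid m l t \<noteq> 0"
  using polytabloid_self by fastforce

text \<open>\<open>\<kappa>\<^sub>t\<close> is idempotent up to the order of the column stabilizer:
  by \<open>col_sym_rep\<close> each summand of the polytabloid is mapped to the polytabloid, the
  two signs cancelling.\<close>

lemma col_sym_polytabloid:
  assumes t: "t \<in> tableaux m l"
  shows "col_sym m l t (tabloids m l) tact (polytabloid m l t)
       = fscale (of_nat (card (column_stabilizer m l t))) (polytabloid m l t)"
proof -
  let ?C = "column_stabilizer m l t" and ?K = "col_sym m l t (tabloids m l) tact"
  let ?b = "basis_vec (tabloid l t)"
  have "?K (polytabloid m l t) = ?K (\<Sum>q\<in>?C. fscale (of_int (sign q)) (tabloid_rep m l q ?b))"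
    using polytabloid_col_sym[OF t] by (simp add: col_sym_def)
  also have "\<dots> = (\<Sum>q\<in>?C. ?K (fscale (of_int (sign q)) (tabloid_rep m l q ?b)))"
    by (rule linear_on_sum[OF cfun.subspace_UNIV linear_on_col_sym]) simp
  also have "\<dots> = (\<Sum>q\<in>?C. polytabloid m l t)"
  proof (rule sum.cong[OF refl])
    fix q assume q: "q \<in> ?C"
    have "?K (fscale (of_int (sign q)) (tabloid_rep m l q ?b))
      = fscale (of_int (sign q)) (?K (tabloid_rep m l q ?b))"
      by (rule linear_on_scale[OF linear_on_col_sym UNIV_I])
    also have "\<dots> = fscale (of_int (sign q) * of_int (sign q)) (?K ?b)"
      using tab.col_sym_rep[OF t q, of l ?b] by simp
    also have "\<dots> = ?K ?b"
      unfolding of_int_mult[symmetric] sign_idempotent by simp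
    finally show "?K (fscale (of_int (sign q)) (tabloid_rep m l q ?b)) = polytabloid m l t"
      using polytabloid_col_sym[OF t] by simp
  qed
  also have "\<dots> = fscale (of_nat (card ?C)) (polytabloid m l t)"
    by (rule cfun.sum_constant_scale)
  finally show ?thesis .
qed

lemma column_stabilizer_nonempty: "t \<in> tableaux m l \<Longrightarrow> column_stabilizer m l t \<noteq> {}"
  using column_stabilizer_id by blast

subsection \<open>Dominance\<close>

text \<open>The partial sums of the parts appear as numbers of cells in the first \<open>r\<close>
  rows, so that they can be compared with arbitrary sets of cells in
  \<open>columns_compressed\<close>.\<close>

definition dominates :: "nat list \<Rightarrow> nat list \<Rightarrow> bool" where
  "dominates l l' \<longleftrightarrow> (\<forall>r. card {x \<in> young_diagram l'. fst x < r} \<le> card {x \<in> young_diagram l. fst x < r})"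

lemma dominates_trans: "dominates l l' \<Longrightarrow> dominates l' l'' \<Longrightarrow> dominates l l''"
  unfolding dominates_def using le_trans by blast

lemma card_split_lt:
  fixes Y :: "(nat \<times> nat) set"
  assumes "finite Y"
  shows "card {x \<in> Y. fst x < Suc r} = card {x \<in> Y. fst x < r} + card {x \<in> Y. fst x = r}"
proof -
  have "{x \<in> Y. fst x < Suc r} = {x \<in> Y. fst x < r} \<union> {x \<in> Y. fst x = r}" by auto
  then show ?thesis using assms by (subst card_Un_disjoint[symmetric]) auto
qed

lemma dominates_antisym:
  assumes p: "l \<in> partitions m" "l' \<in> partitions m'" and d: "dominates l l'" "dominates l' l"
  shows "l = l'"
proof (rule young_diagram_inj[OF p])
  have e: "card {x \<in> young_diagram l'. fst x < r} = card {x \<in> young_diagram l. fst x < r}" for r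
    using d by (simp add: dominates_def le_antisym)
  have row: "row_len k r = card {x \<in> young_diagram k. fst x = r}" for k r
  proof -
    have "{x \<in> young_diagram k. fst x = r} = Pair r ` {..<row_len k r}"
      using young_diagram_iff by auto
    then show ?thesis by (simp add: card_image inj_on_def)
  qed
  have "row_len l r = row_len l' r" for r
    unfolding row using e[of r] e[of "Suc r"] card_split_lt[OF finite_young_diagram, of l r]
      card_split_lt[OF finite_young_diagram, of l' r] by simp
  then show "young_diagram l = young_diagram l'" using young_diagram_iff by auto
qed

text \<open>Pushing every column of \<open>Y\<close> to the top turns \<open>Y\<close> into
  \<open>D\<close> and can only increase the number of cells in the first \<open>r\<close> rows. If
  no such number increases, all columns were compressed already.\<close>

lemma columns_compressed:
  assumes D: "finite D" "down_closed D" and Y: "finite Y"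
    and col: "\<And>j. card {x \<in> Y. snd x = j} = card {x \<in> D. snd x = j}"
  shows "card {x \<in> Y. fst x < r} \<le> card {x \<in> D. fst x < r}"
    and "(\<And>r. card {x \<in> Y. fst x < r} = card {x \<in> D. fst x < r}) \<Longrightarrow> Y = D"
proof -
  define c where "c j = card {x \<in> D. snd x = j}" for j
  obtain N where N: "\<And>x. x \<in> Y \<union> D \<Longrightarrow> snd x < N"
    using finite_nat_set_iff_bounded[of "snd ` (Y \<union> D)"] D(1) Y by auto
  have cells: "card {x \<in> Z. fst x < r} = (\<Sum>j<N. card {x \<in> Z. snd x = j \<and> fst x < r})"
    if Z: "Z \<subseteq> Y \<union> D" for Z r
  proof -
    have fin: "finite Z" using Z D(1) Y by (meson finite_UnI finite_subset)
    have "{x \<in> Z. fst x < r} = (\<Union>j<N. {x \<in> Z. snd x = j \<and> fst x < r})" using N Z by auto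
    then show ?thesis using fin by (simp only:, subst card_UN_disjoint) auto
  qed
  have colD: "{x \<in> D. snd x = j} = (\<lambda>i. (i, j)) ` {..<c j}" for j
  proof -
    have "{i. (i, j) \<in> D} = {..<card {i. (i, j) \<in> D}}"
    proof (rule finite_down_set_nat)
      show "finite {i. (i, j) \<in> D}" by (rule finite_subset[of _ "fst ` D"]) (use D(1) in force)+
    qed (use down_closedD[OF D(2)] in blast)
    moreover have s: "{x \<in> D. snd x = j} = (\<lambda>i. (i, j)) ` {i. (i, j) \<in> D}" by auto
    moreover have "c j = card {i. (i, j) \<in> D}"
      unfolding c_def s by (simp add: card_image inj_on_def)
    ultimately show ?thesis by simp
  qed
  have memD: "(i, j) \<in> D \<longleftrightarrow> i < c j" for i j
    using colD[of j] by (auto simp: set_eq_iff)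
  have lenD: "card {x \<in> D. snd x = j \<and> fst x < r} = min r (c j)" for r j
  proof -
    have "{x \<in> D. snd x = j \<and> fst x < r} = (\<lambda>i. (i, j)) ` {..<min r (c j)}" using memD by auto
    then show ?thesis by (simp add: card_image inj_on_def)
  qed
  have lenY: "card {x \<in> Y. snd x = j \<and> fst x < r} \<le> min r (c j)" for r j
  proof -
    have "card {x \<in> Y. snd x = j \<and> fst x < r} \<le> card ((\<lambda>i. (i, j)) ` {..<r})"
      by (rule card_mono) auto
    then have "card {x \<in> Y. snd x = j \<and> fst x < r} \<le> r" by (simp add: card_image inj_on_def)
    moreover have "card {x \<in> Y. snd x = j \<and> fst x < r} \<le> card {x \<in> Y. snd x = j}"
      by (rule card_mono) (use Y in auto)
    ultimately show ?thesis using col c_def by simp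
  qed
  show "card {x \<in> Y. fst x < r} \<le> card {x \<in> D. fst x < r}" for r
    using lenY lenD by (simp add: cells sum_mono)
  assume eq: "\<And>r. card {x \<in> Y. fst x < r} = card {x \<in> D. fst x < r}"
  \<comment> \<open>The totals over the columns agree and the inequality holds in every column, so
    it is an equality in every column.\<close>
  have lenY': "card {x \<in> Y. snd x = j \<and> fst x < r} = min r (c j)" if "j < N" for r j
    using eq[of r] sum_mono_inv[of "\<lambda>j. card {x \<in> Y. snd x = j \<and> fst x < r}" "{..<N}" "\<lambda>j. min r (c j)" j]
      lenY lenD that by (simp add: cells)
  have mem: "(i, j) \<in> Y \<longleftrightarrow> i < c j" if j: "j < N" for i j
  proof -
    have "card {x \<in> {x \<in> Y. snd x = j}. fst x < Suc i} = card {x \<in> {x \<in> Y. snd x = j}. fst x < i} + card {x \<in> {x \<in> Y. snd x = j}. fst x = i}"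
      by (rule card_split_lt) (use Y in auto)
    then have "min (Suc i) (c j) = min i (c j) + card {x \<in> {x \<in> Y. snd x = j}. fst x = i}"
      using lenY'[OF j, of i] lenY'[OF j, of "Suc i"] by (simp add: conj_assoc)
    moreover have "{x \<in> {x \<in> Y. snd x = j}. fst x = i} = (if (i, j) \<in> Y then {(i, j)} else {})" by auto
    ultimately show ?thesis by (auto split: if_splits simp: min_def)
  qed
  have "(i, j) \<in> Y \<longleftrightarrow> (i, j) \<in> D" for i j
    using mem[of j i] memD[of i j] N[of "(i, j)"] by (cases "j < N") auto
  then show "Y = D" by auto
qed

text \<open>If two entries shared a row of \<open>u\<close> and a column of \<open>t\<close>, their
  transposition would fix the tabloid and \<open>col_sym_eq_0\<close> would apply. Hence
  \<open>?g\<close> (row in \<open>u\<close>, column in \<open>t\<close>) is injective on entries,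
  and its image \<open>Y\<close> has the column lengths of \<open>l\<close> and the row lengths of
  \<open>l'\<close>. Compressing columns gives dominance; for equal shapes it gives
  \<open>Y = young_diagram l\<close>.\<close>

lemma col_sym_tabloid_cases:
  assumes l: "l \<in> partitions m" and t: "t \<in> tableaux m l" and u: "u \<in> tableaux m l'"
    and nz: "col_sym m l t (tabloids m l') tact (basis_vec (tabloid l' u)) \<noteq> 0"
  shows "dominates l l'" and "l' = l \<Longrightarrow> \<exists>q\<in>column_stabilizer m l t. tabloid l u = tabloid l (q \<circ> t)"
proof -
  let ?g = "\<lambda>a. (row_of l' u a, col_of l t a)"
  let ?s = "tabloid l' u"
  have inj: "inj_on ?g {1..m}"
  proof (rule inj_onI, rule ccontr)
    fix a b assume ab: "a \<in> {1..m}" "b \<in> {1..m}" "?g a = ?g b" "a \<noteq> b"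
    have "transpose a b ` ?s i = ?s i" for i
    proof -
      have "a \<in> ?s i \<longleftrightarrow> b \<in> ?s i" using ab by (simp add: tabloid_row_of[OF u])
      then show ?thesis
        by (cases "a \<in> ?s i") (auto simp: transpose_def image_def)
    qed
    then have "tabloid_rep m l' (transpose a b) (basis_vec ?s) = basis_vec ?s"
      using u by (simp add: push_basis_vec finite_tabloids)
    then show False using nz tab.col_sym_eq_0[OF t, of a b l' "basis_vec ?s"] ab by simp
  qed
  define Y where "Y = ?g ` {1..m}"
  have bt: "bij_betw t (young_diagram l) {1..m}" and bu: "bij_betw u (young_diagram l') {1..m}"
    using tableaux_bij t u by auto
  have bg: "bij_betw ?g {1..m} Y" unfolding Y_def using inj by (rule inj_on_imp_bij_betw)
  have col: "card {x \<in> Y. snd x = j} = card {x \<in> young_diagram l. snd x = j}" for j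
  proof -
    have "{x \<in> Y. snd x = j} = ?g ` {a \<in> {1..m}. col_of l t a = j}" by (auto simp: Y_def)
    moreover have "inj_on ?g {a \<in> {1..m}. col_of l t a = j}"
      by (rule inj_on_subset[OF inj]) auto
    ultimately have "card {x \<in> Y. snd x = j} = card {a \<in> {1..m}. col_of l t a = j}"
      by (simp only: card_image)
    moreover have "{a \<in> {1..m}. col_of l t a = j} = t ` {x \<in> young_diagram l. snd x = j}"
      using tableau_cell[OF t] row_col_of_tableau[OF t] tableau_in[OF t] by force
    moreover have "inj_on t {x \<in> young_diagram l. snd x = j}"
      using bt by (auto simp: bij_betw_def intro: inj_on_subset)
    ultimately show ?thesis by (simp add: card_image)
  qed
  have row: "card {x \<in> Y. fst x < r} = card {x \<in> young_diagram l'. fst x < r}" for r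
  proof -
    have "{x \<in> Y. fst x < r} = ?g ` {a \<in> {1..m}. row_of l' u a < r}" by (auto simp: Y_def)
    moreover have "inj_on ?g {a \<in> {1..m}. row_of l' u a < r}"
      by (rule inj_on_subset[OF inj]) auto
    ultimately have "card {x \<in> Y. fst x < r} = card {a \<in> {1..m}. row_of l' u a < r}"
      by (simp only: card_image)
    moreover have "{a \<in> {1..m}. row_of l' u a < r} = u ` {x \<in> young_diagram l'. fst x < r}"
      using tableau_cell[OF u] row_col_of_tableau[OF u] tableau_in[OF u] by force
    moreover have "inj_on u {x \<in> young_diagram l'. fst x < r}"
      using bu by (auto simp: bij_betw_def intro: inj_on_subset)
    ultimately show ?thesis by (simp add: card_image)
  qed
  note cc = columns_compressed[OF finite_young_diagram down_closed_young_diagram[OF l], of Y, OF _ col]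
  have "finite Y" by (simp add: Y_def)
  then show "dominates l l'" using cc(1) row by (simp add: dominates_def)
  assume eq: "l' = l"
  have Y: "Y = young_diagram l" using cc(2) row eq \<open>finite Y\<close> by blast
  \<comment> \<open>\<open>q\<close> replaces the entry of \<open>t\<close> in a cell by the entry
    whose row in \<open>u\<close> and column in \<open>t\<close> are those of this cell. So it
    preserves the columns of \<open>t\<close> and carries the rows of \<open>t\<close> to the rows
    of \<open>u\<close>.\<close>
  define q where "q a = (if a \<in> {1..m} then inv_into {1..m} ?g (inv_into (young_diagram l) t a) else a)" for a
  have gq: "?g (q a) = (row_of l t a, col_of l t a)" and qin: "q a \<in> {1..m}" if "a \<in> {1..m}" for a
  proof -
    let ?c = "(row_of l t a, col_of l t a)"
    have "?c = inv_into (young_diagram l) t a" by (simp add: row_of_def col_of_def)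
    then have q: "q a = inv_into {1..m} ?g ?c" using that by (simp add: q_def)
    have c: "?c \<in> ?g ` {1..m}" using tableau_cell(1)[OF t that] Y unfolding Y_def by blast
    show "?g (q a) = ?c" unfolding q by (rule f_inv_into_f[OF c])
    show "q a \<in> {1..m}" unfolding q by (rule inv_into_into[OF c])
  qed
  have "inj_on q {1..m}"
  proof (rule inj_onI)
    fix a b assume ab: "a \<in> {1..m}" "b \<in> {1..m}" "q a = q b"
    then have "(row_of l t a, col_of l t a) = (row_of l t b, col_of l t b)"
      using gq[OF ab(1)] gq[OF ab(2)] by simp
    then show "a = b" using tableau_cell(2)[OF t ab(1)] tableau_cell(2)[OF t ab(2)] by metis
  qed
  moreover have "q ` {1..m} \<subseteq> {1..m}" using qin by blast
  ultimately have bq: "bij_betw q {1..m} {1..m}"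
    using endo_inj_surj[of "{1..m}" q] by (simp add: bij_betw_def)
  have qp: "q permutes {1..m}" by (rule bij_imp_permutes[OF bq]) (auto simp: q_def)
  have qC: "q \<in> column_stabilizer m l t"
    using qp gq by (simp add: column_stabilizer_iff[OF t])
  have "tabloid l (q \<circ> t) i = tabloid l u i" for i
  proof -
    have "tabloid l (q \<circ> t) i = q ` {a \<in> {1..m}. row_of l t a = i}"
      using tabloid_row_of[OF t] by (simp add: tabloid_comp)
    also have "\<dots> = {b \<in> {1..m}. row_of l' u b = i}"
    proof
      show "q ` {a \<in> {1..m}. row_of l t a = i} \<subseteq> {b \<in> {1..m}. row_of l' u b = i}" using gq qin by auto
      show "{b \<in> {1..m}. row_of l' u b = i} \<subseteq> q ` {a \<in> {1..m}. row_of l t a = i}"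
      proof
        fix b assume b: "b \<in> {b \<in> {1..m}. row_of l' u b = i}"
        then have "b \<in> q ` {1..m}" using bij_betw_imp_surj_on[OF bq] by blast
        then obtain a where "a \<in> {1..m}" "b = q a" by blast
        then show "b \<in> q ` {a \<in> {1..m}. row_of l t a = i}" using gq b by auto
      qed
    qed
    finally show ?thesis using tabloid_row_of[OF u] eq by simp
  qed
  then show "\<exists>q\<in>column_stabilizer m l t. tabloid l u = tabloid l (q \<circ> t)" using qC by (auto intro!: bexI[of _ q])
qed

lemma col_sym_not_dominates:
  assumes l: "l \<in> partitions m" and t: "t \<in> tableaux m l" and f: "f \<in> free_space (tabloids m l')"
    and nd: "\<not> dominates l l'"
  shows "col_sym m l t (tabloids m l') tact f = 0"
proof -
  have "linear_on (cfun.span (basis_vec ` tabloids m l')) (col_sym m l t (tabloids m l') tact)"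
    by (rule linear_on_col_sym)
  then show ?thesis
    by (rule linear_on_eq_0_on_span)
      (use f col_sym_tabloid_cases(1)[OF l t] nd in \<open>auto simp: free_space_span[OF finite_tabloids]\<close>)
qed

section \<open>The invariant form and the detection of vectors\<close>

text \<open>Bilinear, not Hermitian: that \<open>form X f f\<close> does not vanish for
  \<open>f\<close> nonzero on \<open>X\<close> can be concluded for real-valued
  \<open>f\<close>.\<close>

definition form :: "'x set \<Rightarrow> ('x \<Rightarrow> complex) \<Rightarrow> ('x \<Rightarrow> complex) \<Rightarrow> complex" where
  "form X f g = (\<Sum>x\<in>X. f x * g x)"

lemma form_add: "form X f (g + h) = form X f g + form X f h"
  by (simp add: form_def algebra_simps sum.distrib)

lemma form_zero: "form X f 0 = 0"
  by (simp add: form_def)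

lemma form_scale: "form X f (fscale c g) = c * form X f g"
  by (simp add: form_def sum_distrib_left algebra_simps)

lemma form_sum: "form X f (\<Sum>i\<in>I. g i) = (\<Sum>i\<in>I. form X f (g i))"
  unfolding form_def sum_fun_apply sum_distrib_left by (rule sum.swap)

lemma form_commute: "form X f g = form X g f"
  by (simp add: form_def mult.commute)

lemma form_basis_vec: "finite X \<Longrightarrow> x \<in> X \<Longrightarrow> form X f (basis_vec x) = f x"
proof -
  assume "finite X" "x \<in> X"
  moreover have "form X f (basis_vec x) = (\<Sum>y\<in>X. if y = x then f y else 0)"
    unfolding form_def by (rule sum.cong) (auto simp: basis_vec_apply)
  ultimately show ?thesis by simp
qed

lemma (in perm_rep) form_rep:
  assumes s: "\<sigma> permutes {1..m}"
  shows "form X (rep \<sigma> f) (rep \<sigma> g) = form X f g"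
proof -
  have "form X (rep \<sigma> f) (rep \<sigma> g) = (\<Sum>x\<in>X. rep \<sigma> f (act \<sigma> x) * rep \<sigma> g (act \<sigma> x))"
    unfolding form_def by (rule sum.reindex_bij_betw[OF act_bij[OF s], symmetric])
  then show ?thesis by (simp add: form_def rep_apply_act[OF s])
qed

text \<open>The column antisymmetrizer is self-adjoint, since a permutation and its inverse have the
  same sign; the polytabloid is its value at a basis vector.\<close>

lemma form_polytabloid:
  assumes t: "t \<in> tableaux m l"
  shows "form (tabloids m l) f (polytabloid m l t) = col_sym m l t (tabloids m l) tact f (tabloid l t)"
proof -
  let ?C = "column_stabilizer m l t"
  have bij: "bij_betw (inv') ?C ?C"
    by (rule bij_betw_byWitness[where f' = "inv'"])
      (auto simp: column_stabilizer_inv[OF t] permutes_inv_inv[OF column_stabilizer_permutes])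
  have "form (tabloids m l) f (polytabloid m l t) = (\<Sum>q\<in>?C. of_int (sign q) * f (tabloid l (q \<circ> t)))"
    unfolding polytabloid_def form_sum form_scale
    by (rule sum.cong)
      (auto simp: form_basis_vec finite_tabloids t tableaux_comp column_stabilizer_permutes)
  also have "\<dots> = (\<Sum>q\<in>?C. of_int (sign (inv' q)) * f (tabloid l (inv' q \<circ> t)))"
    by (rule sum.reindex_bij_betw[OF bij, symmetric])
  also have "\<dots> = (\<Sum>q\<in>?C. of_int (sign q) * tabloid_rep m l q f (tabloid l t))"
    by (rule sum.cong)
      (use t in \<open>simp_all add: sign_inverse permutation_column_stabilizer tab.rep_apply column_stabilizer_permutes tabloid_comp\<close>)
  also have "\<dots> = col_sym m l t (tabloids m l) tact f (tabloid l t)"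
    by (simp add: col_sym_def sum_fun_apply)
  finally show ?thesis .
qed

text \<open>By \<open>col_sym_tabloid_cases\<close> every tabloid of shape \<open>l\<close> is sent
  to 0 or to plus or minus the polytabloid, so the image is a line. The factor is read off at
  \<open>tabloid l t\<close>, where the polytabloid has the value 1.\<close>

lemma col_sym_eq_scale:
  assumes l: "l \<in> partitions m" and t: "t \<in> tableaux m l" and f: "f \<in> free_space (tabloids m l)"
  shows "col_sym m l t (tabloids m l) tact f = fscale (form (tabloids m l) f (polytabloid m l t)) (polytabloid m l t)"
proof -
  let ?K = "col_sym m l t (tabloids m l) tact" and ?e = "polytabloid m l t"
  let ?U = "{f. \<exists>c. ?K f = fscale c ?e}"
  have lin: "?K (f + g) = ?K f + ?K g" "?K (fscale c f) = fscale c (?K f)" for f g c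
    using linear_on_col_sym[of UNIV m l t "tabloids m l" tact] by (simp_all add: linear_on_def)
  have "cfun.subspace ?U"
  proof (rule cfun.subspaceI)
    show "0 \<in> ?U" using linear_on_0[OF cfun.subspace_UNIV linear_on_col_sym] by (auto intro!: exI[of _ 0])
    show "f + g \<in> ?U" if "f \<in> ?U" "g \<in> ?U" for f g
    proof -
      obtain c d where "?K f = fscale c ?e" "?K g = fscale d ?e" using \<open>f \<in> ?U\<close> \<open>g \<in> ?U\<close> by blast
      then have "?K (f + g) = fscale (c + d) ?e" by (simp only: lin cfun.scale_left_distrib)
      then show ?thesis by blast
    qed
    show "fscale a f \<in> ?U" if "f \<in> ?U" for a f
    proof -
      obtain c where "?K f = fscale c ?e" using \<open>f \<in> ?U\<close> by blast
      then have "?K (fscale a f) = fscale (a * c) ?e" by (simp only: lin cfun.scale_scale)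
      then show ?thesis by blast
    qed
  qed
  moreover have "basis_vec ` tabloids m l \<subseteq> ?U"
  proof safe
    fix u assume u: "u \<in> tableaux m l"
    show "\<exists>c. ?K (basis_vec (tabloid l u)) = fscale c ?e"
    proof (cases "?K (basis_vec (tabloid l u)) = 0")
      case True then show ?thesis by (intro exI[of _ 0]) simp
    next
      case False
      then obtain q where q: "q \<in> column_stabilizer m l t" "tabloid l u = tabloid l (q \<circ> t)"
        using col_sym_tabloid_cases(2)[OF l t u] by blast
      then have "basis_vec (tabloid l u) = tabloid_rep m l q (basis_vec (tabloid l t))"
        using t by (simp add: push_basis_vec finite_tabloids tabloid_comp)
      then have "?K (basis_vec (tabloid l u)) = fscale (of_int (sign q)) ?e"
        using tab.col_sym_rep[OF t q(1), of l] polytabloid_col_sym[OF t] by simp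
      then show ?thesis by blast
    qed
  qed
  ultimately have "free_space (tabloids m l) \<subseteq> ?U"
    unfolding free_space_span[OF finite_tabloids] by (intro cfun.span_minimal)
  then have "f \<in> ?U" using f by (rule subsetD)
  then have "\<exists>c. ?K f = fscale c ?e" by (rule CollectD)
  then obtain c where c: "?K f = fscale c ?e" by blast
  then have "form (tabloids m l) f ?e = c"
    using form_polytabloid[OF t, of f] polytabloid_self[OF t] by simp
  then show ?thesis using c by simp
qed

text \<open>If \<open>v\<close> were orthogonal to all polytabloids it would be orthogonal to its
  own complex conjugate, which again lies in the Specht space because polytabloids have real
  coefficients. Then the sum of the \<open>\<bar>v x\<bar>\<^sup>2\<close> would be 0.\<close>

lemma specht_detect:
  assumes l: "l \<in> partitions m" and v: "v \<in> specht_space m l" "v \<noteq> 0"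
  shows "\<exists>t\<in>tableaux m l. \<exists>c. c \<noteq> 0 \<and> col_sym m l t (tabloids m l) tact v = fscale c (polytabloid m l t)"
proof -
  let ?X = "tabloids m l"
  have vX: "v \<in> free_space ?X" using v specht_space_subset by blast
  have "\<exists>t\<in>tableaux m l. form ?X v (polytabloid m l t) \<noteq> 0"
  proof (rule ccontr)
    assume "\<not> ?thesis"
    then have z: "\<And>t. t \<in> tableaux m l \<Longrightarrow> form ?X v (polytabloid m l t) = 0" by blast
    have "cfun.subspace {w. form ?X v w = 0}"
      by (rule cfun.subspaceI) (simp_all add: form_add form_scale form_zero)
    then have "specht_space m l \<subseteq> {w. form ?X v w = 0}"
      using z by (intro cfun.span_minimal) auto
    moreover have "(\<lambda>x. cnj (v x)) \<in> specht_space m l"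
    proof -
      let ?U = "{w. (\<lambda>x. cnj (w x)) \<in> specht_space m l}"
      have "cfun.subspace ?U"
      proof (rule cfun.subspaceI)
        have "(\<lambda>x. cnj ((0 :: (nat \<Rightarrow> nat set) \<Rightarrow> complex) x)) = 0" by (simp add: fun_eq_iff)
        then show "0 \<in> ?U" unfolding mem_Collect_eq by (simp only: cfun.span_zero)
        show "f + g \<in> ?U" if "f \<in> ?U" "g \<in> ?U" for f g
        proof -
          have "(\<lambda>x. cnj ((f + g) x)) = (\<lambda>x. cnj (f x)) + (\<lambda>x. cnj (g x))" by (simp add: fun_eq_iff)
          then show ?thesis using that cfun.span_add by simp
        qed
        show "fscale c f \<in> ?U" if "f \<in> ?U" for f c
        proof -
          have "(\<lambda>x. cnj (fscale c f x)) = fscale (cnj c) (\<lambda>x. cnj (f x))" by (simp add: fun_eq_iff)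
          then show ?thesis using that cfun.span_scale by simp
        qed
      qed
      moreover have "polytabloid m l ` tableaux m l \<subseteq> ?U"
      proof safe
        fix t assume t: "t \<in> tableaux m l"
        have "(\<lambda>x. cnj (polytabloid m l t x)) = polytabloid m l t"
          by (rule ext) (simp add: polytabloid_apply if_distrib cong: if_cong)
        then show "(\<lambda>x. cnj (polytabloid m l t x)) \<in> specht_space m l"
          using cfun.span_base[OF imageI[OF t, of "polytabloid m l"]] by simp
      qed
      ultimately have "specht_space m l \<subseteq> ?U" by (intro cfun.span_minimal)
      then show ?thesis using v by blast
    qed
    ultimately have "(\<Sum>x\<in>?X. v x * cnj (v x)) = 0" by (auto simp: form_def)
    then have "complex_of_real (\<Sum>x\<in>?X. (cmod (v x))\<^sup>2) = 0"
      by (simp only: of_real_sum complex_norm_square)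
    then have "(\<Sum>x\<in>?X. (cmod (v x))\<^sup>2) = 0" by (simp only: of_real_eq_0_iff)
    then have "\<forall>x\<in>?X. v x = 0"
      by (subst (asm) sum_nonneg_eq_0_iff) (auto simp: finite_tabloids)
    then have "v x = 0 x" for x using vX unfolding free_space_def zero_fun_apply by blast
    then have "v = 0" by (rule ext)
    then show False using v by simp
  qed
  then show ?thesis using col_sym_eq_scale[OF l _ vX] by blast
qed

lemma tableaux_transitive:
  assumes t: "t \<in> tableaux m l" and u: "u \<in> tableaux m l"
  shows "\<exists>\<sigma>. \<sigma> permutes {1..m} \<and> polytabloid m l u = tabloid_rep m l \<sigma> (polytabloid m l t)"
proof -
  define \<sigma> where "\<sigma> a = (if a \<in> {1..m} then u (inv_into (young_diagram l) t a) else a)" for a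
  have "bij_betw (u \<circ> inv_into (young_diagram l) t) {1..m} {1..m}"
    using bij_betw_trans[OF bij_betw_inv_into[OF tableaux_bij[OF t]] tableaux_bij[OF u]] .
  then have "bij_betw \<sigma> {1..m} {1..m}"
    by (rule bij_betw_cong[THEN iffD1, rotated]) (simp add: \<sigma>_def)
  then have p: "\<sigma> permutes {1..m}" by (rule bij_imp_permutes) (auto simp: \<sigma>_def)
  have "polytabloid m l u = polytabloid m l (\<sigma> \<circ> t)"
  proof (rule polytabloid_cong)
    fix c assume c: "c \<in> young_diagram l"
    have "inv_into (young_diagram l) t (t c) = c"
      using tableaux_bij[OF t] c by (simp add: bij_betw_def)
    then show "u c = (\<sigma> \<circ> t) c" using tableau_in[OF t c] by (simp add: \<sigma>_def)
  qed
  then show ?thesis using rep_polytabloid[OF t p] p by metis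
qed

lemma specht_eq_0_if_polytabloid_eq_0:
  assumes t: "t \<in> tableaux m l" and f: "linear_on (specht_space m l) f"
    and z: "\<And>\<sigma>. \<sigma> permutes {1..m} \<Longrightarrow> f (tabloid_rep m l \<sigma> (polytabloid m l t)) = 0"
    and v: "v \<in> specht_space m l"
  shows "f v = 0"
  by (rule linear_on_eq_0_on_span[OF f _ v]) (use tableaux_transitive[OF t] z in fastforce)

lemma polytabloid_in_specht_space: "t \<in> tableaux m l \<Longrightarrow> polytabloid m l t \<in> specht_space m l"
  by (simp add: cfun.span_base)

text \<open>The column antisymmetrizer of a shape that is minimal in the dominance order among those with
  \<open>x l \<noteq> 0\<close> annihilates all other summands.\<close>

lemma specht_independent:
  assumes L: "finite L" "L \<subseteq> partitions m"
    and f: "\<And>l. l \<in> L \<Longrightarrow> linear_on (specht_space m l) (f l)"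
    and nz: "\<And>l. l \<in> L \<Longrightarrow> \<exists>v\<in>specht_space m l. f l v \<noteq> 0"
    and x: "\<And>l. l \<in> L \<Longrightarrow> x l \<in> specht_space m l"
    and z: "\<And>\<sigma>. \<sigma> permutes {1..m} \<Longrightarrow> (\<Sum>l\<in>L. f l (tabloid_rep m l \<sigma> (x l))) = 0"
    and l: "l \<in> L"
  shows "x l = 0"
proof (rule ccontr)
  assume nx: "x l \<noteq> 0"
  define L' where "L' = {l \<in> L. x l \<noteq> 0}"
  define R where "R a b \<longleftrightarrow> a \<noteq> b \<and> dominates b a" for a b
  have dom: "a = b" if "a \<in> L'" "b \<in> L'" "dominates a b" "dominates b a" for a b
    using that dominates_antisym[of a m b m] L(2) by (auto simp: L'_def)
  have "asymp_on L' R" by (rule asymp_onI) (use dom in \<open>auto simp: R_def\<close>)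
  moreover have "transp_on L' R"
    by (rule transp_onI) (use dom dominates_trans in \<open>unfold R_def, blast\<close>)
  moreover have "finite L'" "L' \<noteq> {}" using L nx l by (auto simp: L'_def)
  ultimately obtain k where k: "k \<in> L'" "\<And>l. l \<in> L' \<Longrightarrow> l \<noteq> k \<Longrightarrow> \<not> R l k"
    using Finite_Set.bex_min_element[of L' R] by blast
  have kp: "k \<in> partitions m" and kL: "k \<in> L" and xk: "x k \<noteq> 0" using k(1) L by (auto simp: L'_def)
  obtain t c where t: "t \<in> tableaux m k" and c: "c \<noteq> 0"
      "col_sym m k t (tabloids m k) tact (x k) = fscale c (polytabloid m k t)"
    using specht_detect[OF kp x[OF kL] xk] by blast
  let ?K = "\<lambda>l. col_sym m k t (tabloids m l) tact"
  have K0: "?K l (x l) = 0" if "l \<in> L" "l \<noteq> k" for l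
  proof (cases "x l = 0")
    case True
    then show ?thesis using linear_on_0[OF cfun.subspace_UNIV linear_on_col_sym] by simp
  next
    case False
    then have "\<not> dominates k l" using k(2)[of l] that by (auto simp: L'_def R_def)
    then show ?thesis using col_sym_not_dominates[OF kp t] x[OF that(1)] specht_space_subset by blast
  qed
  have "f k (tabloid_rep m k \<sigma> (polytabloid m k t)) = 0" if s: "\<sigma> permutes {1..m}" for \<sigma>
  proof -
    let ?C = "column_stabilizer m k t"
    have step: "f l (tabloid_rep m l \<sigma> (?K l (x l))) = (\<Sum>q\<in>?C. fscale (of_int (sign q)) (f l (tabloid_rep m l (\<sigma> \<circ> q) (x l))))"
      if l: "l \<in> L" for l
    proof -
      have "tabloid_rep m l \<sigma> (?K l (x l)) = (\<Sum>q\<in>?C. fscale (of_int (sign q)) (tabloid_rep m l (\<sigma> \<circ> q) (x l)))"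
        unfolding col_sym_def push_sum push_scale
        by (rule sum.cong) (simp_all only: tab.rep_comp[OF s column_stabilizer_permutes])
      moreover have inn: "tabloid_rep m l (\<sigma> \<circ> q) (x l) \<in> specht_space m l" if "q \<in> ?C" for q
        by (rule rep_specht_space[OF permutes_compose[OF column_stabilizer_permutes[OF that] s] x[OF l]])
      moreover have "f l (\<Sum>q\<in>?C. fscale (of_int (sign q)) (tabloid_rep m l (\<sigma> \<circ> q) (x l)))
          = (\<Sum>q\<in>?C. f l (fscale (of_int (sign q)) (tabloid_rep m l (\<sigma> \<circ> q) (x l))))"
        by (rule linear_on_sum[OF cfun.subspace_span f[OF l]], rule cfun.span_scale, rule inn)
      moreover have "(\<Sum>q\<in>?C. f l (fscale (of_int (sign q)) (tabloid_rep m l (\<sigma> \<circ> q) (x l))))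
          = (\<Sum>q\<in>?C. fscale (of_int (sign q)) (f l (tabloid_rep m l (\<sigma> \<circ> q) (x l))))"
        by (rule sum.cong[OF refl], rule linear_on_scale[OF f[OF l]], rule inn)
      ultimately show ?thesis by (simp only:)
    qed
    have z0: "f l (tabloid_rep m l \<sigma> (?K l (x l))) = 0" if "l \<in> L" "l \<noteq> k" for l
      using K0[OF that] linear_on_0[OF cfun.subspace_UNIV linear_on_push] linear_on_0[OF cfun.subspace_span f[OF that(1)]]
      by metis
    \<comment> \<open>The maps \<open>f l\<close> are merely linear, so the antisymmetrizer cannot
      be moved past them. Instead the hypothesis is used for all translates by
      \<open>\<sigma> \<circ> q\<close> and these equations are added with signs.\<close>
    have "f k (tabloid_rep m k \<sigma> (?K k (x k))) = (\<Sum>l\<in>L. f l (tabloid_rep m l \<sigma> (?K l (x l))))"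
      using sum.remove[OF L(1) kL, of "\<lambda>l. f l (tabloid_rep m l \<sigma> (?K l (x l)))"] z0 by simp
    also have "\<dots> = (\<Sum>l\<in>L. \<Sum>q\<in>?C. fscale (of_int (sign q)) (f l (tabloid_rep m l (\<sigma> \<circ> q) (x l))))"
      by (rule sum.cong) (simp_all only: step)
    also have "\<dots> = (\<Sum>q\<in>?C. \<Sum>l\<in>L. fscale (of_int (sign q)) (f l (tabloid_rep m l (\<sigma> \<circ> q) (x l))))"
      by (rule sum.swap)
    also have "\<dots> = (\<Sum>q\<in>?C. fscale (of_int (sign q)) (\<Sum>l\<in>L. f l (tabloid_rep m l (\<sigma> \<circ> q) (x l))))"
      by (simp only: cfun.scale_sum_right)
    also have "\<dots> = 0"
      using z[OF permutes_compose[OF column_stabilizer_permutes s]] by simp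
    finally have "f k (tabloid_rep m k \<sigma> (fscale c (polytabloid m k t))) = 0"
      using c(2) by simp
    moreover have "tabloid_rep m k \<sigma> (polytabloid m k t) \<in> specht_space m k"
      by (rule rep_specht_space[OF s polytabloid_in_specht_space[OF t]])
    ultimately have "fscale c (f k (tabloid_rep m k \<sigma> (polytabloid m k t))) = 0"
      using linear_on_scale[OF f[OF kL]] by (simp add: push_scale)
    then show ?thesis using c(1) by simp
  qed
  then have "\<And>v. v \<in> specht_space m k \<Longrightarrow> f k v = 0"
    using specht_eq_0_if_polytabloid_eq_0[OF t f[OF kL]] by blast
  then show False using nz[OF kL] by blast
qed

section \<open>Schur's lemma for Specht modules\<close>

text \<open>The antisymmetrizer multiplies the polytabloid by a nonzero number and annihilates the
  target, so an equivariant map must send the polytabloid to 0.\<close>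

lemma specht_schur_dominates:
  assumes l: "l \<in> partitions m"
    and f: "equivariant_on m (tabloids m l) tact (tabloids m l') tact (specht_space m l) f"
    and fin: "\<And>v. v \<in> specht_space m l \<Longrightarrow> f v \<in> free_space (tabloids m l')"
    and nz: "\<exists>v\<in>specht_space m l. f v \<noteq> 0"
  shows "dominates l l'"
proof (rule ccontr)
  assume nd: "\<not> dominates l l'"
  have lin: "linear_on (specht_space m l) f" using f by (simp add: equivariant_on_def)
  obtain t where t: "t \<in> tableaux m l" using tableaux_nonempty[OF l] by blast
  have "f (polytabloid m l t) = 0" if t: "t \<in> tableaux m l" for t
  proof -
    note e = polytabloid_in_specht_space[OF t]
    have "f (col_sym m l t (tabloids m l) tact (polytabloid m l t)) = 0"
      using tab.equivariant_col_sym[OF f cfun.subspace_span rep_specht_space e] col_sym_not_dominates[OF l t fin[OF e] nd]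
      by simp
    then have "fscale (of_nat (card (column_stabilizer m l t))) (f (polytabloid m l t)) = 0"
      unfolding col_sym_polytabloid[OF t] linear_on_scale[OF lin e] .
    then show ?thesis using column_stabilizer_nonempty[OF t] by simp
  qed
  then have "f v = 0" if "v \<in> specht_space m l" for v
    using linear_on_eq_0_on_span[OF lin _ that] by blast
  then show False using nz by blast
qed

text \<open>A nonzero map gives dominance in one direction. An antisymmetrizer of shape
  \<open>l'\<close> that detects an image vector must also act nontrivially on the tabloids of shape
  \<open>l\<close>, which gives the other direction.\<close>

lemma specht_schur_distinct:
  assumes l: "l \<in> partitions m" and l': "l' \<in> partitions m" and ne: "l \<noteq> l'"
    and f: "equivariant_on m (tabloids m l) tact (tabloids m l') tact (specht_space m l) f"
    and fin: "\<And>v. v \<in> specht_space m l \<Longrightarrow> f v \<in> specht_space m l'" and v: "v \<in> specht_space m l"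
  shows "f v = 0"
proof (rule ccontr)
  assume nz: "f v \<noteq> 0"
  have lin: "linear_on (specht_space m l) f" using f by (simp add: equivariant_on_def)
  have "dominates l l'"
    by (rule specht_schur_dominates[OF l f]) (use fin specht_space_subset v nz in blast)+
  then have nd: "\<not> dominates l' l" using dominates_antisym[OF l l'] ne by blast
  obtain t c where t: "t \<in> tableaux m l'" and c: "c \<noteq> 0"
      "col_sym m l' t (tabloids m l') tact (f v) = fscale c (polytabloid m l' t)"
    using specht_detect[OF l' fin[OF v] nz] by blast
  have "fscale c (polytabloid m l' t) = f (col_sym m l' t (tabloids m l) tact v)"
    using tab.equivariant_col_sym[OF f cfun.subspace_span rep_specht_space v] c by simp
  also have "\<dots> = 0"
    using col_sym_not_dominates[OF l' t subsetD[OF specht_space_subset v] nd] linear_on_0[OF cfun.subspace_span lin]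
    by simp
  finally show False using c(1) polytabloid_nonzero[OF t] by simp
qed

text \<open>The image of the polytabloid is, up to the order of the column stabilizer, a value of
  the antisymmetrizer and hence a multiple of the polytabloid; the translates of the polytabloid
  span.\<close>

lemma specht_schur_scalar:
  assumes l: "l \<in> partitions m"
    and f: "equivariant_on m (tabloids m l) tact (tabloids m l) tact (specht_space m l) f"
    and fin: "\<And>v. v \<in> specht_space m l \<Longrightarrow> f v \<in> specht_space m l"
  shows "\<exists>c. \<forall>v\<in>specht_space m l. f v = fscale c v"
proof -
  have lin: "linear_on (specht_space m l) f" using f by (simp add: equivariant_on_def)
  obtain t where t: "t \<in> tableaux m l" using tableaux_nonempty[OF l] by blast
  note e = polytabloid_in_specht_space[OF t]
  let ?e = "polytabloid m l t" and ?n = "of_nat (card (column_stabilizer m l t)) :: complex"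
  define d where "d = form (tabloids m l) (f ?e) ?e"
  have n: "?n \<noteq> 0" using column_stabilizer_nonempty[OF t] by simp
  have "fscale ?n (f ?e) = f (col_sym m l t (tabloids m l) tact ?e)"
    unfolding col_sym_polytabloid[OF t] linear_on_scale[OF lin e] ..
  also have "\<dots> = fscale d ?e"
    using tab.equivariant_col_sym[OF f cfun.subspace_span rep_specht_space e]
      col_sym_eq_scale[OF l t subsetD[OF specht_space_subset fin[OF e]]] by (simp add: d_def)
  finally have "fscale (inverse ?n) (fscale ?n (f ?e)) = fscale (inverse ?n) (fscale d ?e)" by simp
  then have fe: "f ?e = fscale (inverse ?n * d) ?e" using n by simp
  define c where "c = inverse ?n * d"
  have lin': "linear_on (specht_space m l) (\<lambda>v. f v - fscale c v)"
    unfolding linear_on_def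
    using linear_on_add[OF lin] linear_on_scale[OF lin]
    by (simp add: cfun.scale_right_distrib cfun.scale_right_diff_distrib mult.commute)
  have "f v - fscale c v = 0" if "v \<in> specht_space m l" for v
  proof (rule specht_eq_0_if_polytabloid_eq_0[OF t lin' _ that])
    fix \<sigma> assume "\<sigma> permutes {1..m}"
    then have "f (tabloid_rep m l \<sigma> ?e) = tabloid_rep m l \<sigma> (f ?e)"
      using f e by (simp add: equivariant_on_def)
    then show "f (tabloid_rep m l \<sigma> ?e) - fscale c (tabloid_rep m l \<sigma> ?e) = 0"
      using fe by (simp add: push_scale c_def)
  qed
  then show ?thesis by (intro exI[of _ c]) (simp add: fun_eq_iff)
qed

section \<open>Restriction to the point stabilizer\<close>

definition real_valued :: "('x \<Rightarrow> complex) \<Rightarrow> bool" where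
  "real_valued f \<longleftrightarrow> (\<forall>x. f x \<in> \<real>)"

lemma real_valued_polytabloid: "real_valued (polytabloid m l t)"
  unfolding real_valued_def polytabloid_apply by (auto intro!: sum_in_Reals)

lemma real_valued_push: "real_valued f \<Longrightarrow> real_valued (push X h f)"
  unfolding real_valued_def push_def sum_fun_apply
  by (auto intro!: sum_in_Reals Reals_mult simp: basis_vec_apply)

lemma form_real: "real_valued f \<Longrightarrow> real_valued g \<Longrightarrow> form X f g \<in> \<real>"
  unfolding real_valued_def form_def by (auto intro!: sum_in_Reals Reals_mult)

lemma sum_squares_Reals_nonzero:
  fixes c :: "'i \<Rightarrow> complex"
  assumes fin: "finite I" and r: "\<And>i. i \<in> I \<Longrightarrow> c i \<in> \<real>" and i: "i \<in> I" "c i \<noteq> 0"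
  shows "(\<Sum>i\<in>I. c i * c i) \<noteq> 0"
proof
  assume "(\<Sum>i\<in>I. c i * c i) = 0"
  moreover have "(\<Sum>i\<in>I. c i * c i) = of_real (\<Sum>i\<in>I. (Re (c i))\<^sup>2)"
    unfolding of_real_sum
    by (rule sum.cong) (use r in \<open>auto simp: power2_eq_square complex_is_Real_iff complex_eq_iff\<close>)
  ultimately have "(\<Sum>i\<in>I. (Re (c i))\<^sup>2) = 0" by (metis of_real_eq_0_iff)
  then have "\<forall>i\<in>I. (Re (c i))\<^sup>2 = 0"
    by (subst (asm) sum_nonneg_eq_0_iff) (use fin in auto)
  then have "Re (c i) = 0" using i by simp
  then show False using r[OF i(1)] i(2) by (simp add: complex_is_Real_iff complex_eq_iff)
qed

text \<open>The frame operator of the orbit of \<open>e\<close>: an equivariant map onto the submodule generated by \<open>e\<close>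
  which replaces the orthogonal projection.\<close>

definition frame_op :: "nat \<Rightarrow> 'x set \<Rightarrow> ((nat \<Rightarrow> nat) \<Rightarrow> 'x \<Rightarrow> 'x) \<Rightarrow> ('x \<Rightarrow> complex) \<Rightarrow> ('x \<Rightarrow> complex) \<Rightarrow> 'x \<Rightarrow> complex" where
  "frame_op m X act e y = (\<Sum>\<sigma>\<in>{\<sigma>. \<sigma> permutes {1..m}}. fscale (form X y (push X (act \<sigma>) e)) (push X (act \<sigma>) e))"

lemma linear_on_frame_op: "linear_on W (frame_op m X act e)"
  unfolding linear_on_def frame_op_def
  by (simp add: form_commute[of X _ "push X _ _"] form_add form_scale cfun.scale_left_distrib sum.distrib
      cfun.scale_sum_right)

lemma (in perm_rep) rep_frame_op:
  assumes s: "\<tau> permutes {1..m}"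
  shows "frame_op m X act e (rep \<tau> y) = rep \<tau> (frame_op m X act e y)"
proof -
  let ?G = "{\<sigma>. \<sigma> permutes {1..m}}"
  have bij: "bij_betw (\<lambda>\<sigma>. \<tau> \<circ> \<sigma>) ?G ?G"
    by (rule bij_betw_byWitness[where f' = "\<lambda>\<sigma>. inv' \<tau> \<circ> \<sigma>"])
      (use s permutes_inv_o[OF s] in \<open>auto simp: o_assoc permutes_compose permutes_inv\<close>)
  have "frame_op m X act e (rep \<tau> y) = (\<Sum>\<sigma>\<in>?G. fscale (form X (rep \<tau> y) (rep (\<tau> \<circ> \<sigma>) e)) (rep (\<tau> \<circ> \<sigma>) e))"
    unfolding frame_op_def by (rule sum.reindex_bij_betw[OF bij, symmetric])
  also have "\<dots> = (\<Sum>\<sigma>\<in>?G. fscale (form X y (rep \<sigma> e)) (rep \<tau> (rep \<sigma> e)))"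
    by (rule sum.cong) (simp_all add: rep_comp[OF s] form_rep[OF s])
  finally show ?thesis by (simp add: frame_op_def push_sum push_scale)
qed

text \<open>Pairing the value with \<open>y\<close> gives the sum of the squares of the numbers
  \<open>form X y (rep \<sigma> e)\<close>. All of them are real, and the one for the identity is
  nonzero.\<close>

lemma (in perm_rep) frame_op_nonzero:
  assumes "real_valued y" "real_valued e" "e \<in> free_space X" "form X y e \<noteq> 0"
  shows "frame_op m X act e y \<noteq> 0"
proof
  assume z: "frame_op m X act e y = 0"
  let ?G = "{\<sigma>. \<sigma> permutes {1..m}}"
  have "(\<Sum>\<sigma>\<in>?G. form X y (rep \<sigma> e) * form X y (rep \<sigma> e)) = form X y (frame_op m X act e y)"
    by (simp add: frame_op_def form_sum form_scale)
  then have "(\<Sum>\<sigma>\<in>?G. form X y (rep \<sigma> e) * form X y (rep \<sigma> e)) = 0" using z by (simp add: form_zero)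
  moreover have "(\<Sum>\<sigma>\<in>?G. form X y (rep \<sigma> e) * form X y (rep \<sigma> e)) \<noteq> 0"
    by (rule sum_squares_Reals_nonzero[of _ _ id])
      (use assms in \<open>auto simp: finite_permutations form_real real_valued_push permutes_id rep_id\<close>)
  ultimately show False by simp
qed

lemma frame_op_in_specht_space:
  assumes "t \<in> tableaux m l"
  shows "frame_op m (tabloids m l) tact (polytabloid m l t) y \<in> specht_space m l"
  unfolding frame_op_def
  by (rule cfun.span_sum, rule cfun.span_scale)
    (use rep_specht_space polytabloid_in_specht_space[OF assms] in blast)

lemma form_polytabloid_self:
  assumes t: "t \<in> tableaux m l"
  shows "form (tabloids m l) (polytabloid m l t) (polytabloid m l t) \<noteq> 0"
  unfolding form_def
  by (rule sum_squares_Reals_nonzero[OF finite_tabloids, of _ _ _ "tabloid l t"])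
    (use real_valued_polytabloid[of m l t] polytabloid_self[OF t] t in \<open>auto simp: real_valued_def\<close>)

lemma insert_box:
  assumes "adds_box \<mu> l"
  obtains r where "(r, row_len \<mu> r) \<notin> young_diagram \<mu>"
    "young_diagram l = insert (r, row_len \<mu> r) (young_diagram \<mu>)"
proof -
  obtain r where r: "row_len l = (row_len \<mu>)(r := Suc (row_len \<mu> r))" using adds_box_row assms by blast
  have "(i, j) \<in> young_diagram l \<longleftrightarrow> (i, j) \<in> insert (r, row_len \<mu> r) (young_diagram \<mu>)" for i j
    unfolding insert_iff young_diagram_iff r by auto
  then have "young_diagram l = insert (r, row_len \<mu> r) (young_diagram \<mu>)" by auto
  moreover have "(r, row_len \<mu> r) \<notin> young_diagram \<mu>" by (simp add: young_diagram_iff)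
  ultimately show ?thesis using that by blast
qed

lemma permutes_pred: "\<sigma> permutes {1..n - 1} \<Longrightarrow> \<sigma> permutes {1..(n::nat)}"
  by (rule permutes_subset) auto

lemma permutes_pred_fixes: "\<sigma> permutes {1..n - 1} \<Longrightarrow> n > 0 \<Longrightarrow> \<sigma> n = (n::nat)"
  by (rule permutes_not_in) auto

lemma permutes_fixes_pred:
  assumes "\<sigma> permutes {1..n}" "\<sigma> n = (n::nat)"
  shows "\<sigma> permutes {1..n - 1}"
proof (rule permutes_superset[OF assms(1)])
  show "\<sigma> x = x" if "x \<in> {1..n} - {1..n - 1}" for x
  proof -
    have "x = n" using that by auto
    then show ?thesis using assms(2) by simp
  qed
qed

section \<open>The equivariant maps attached to an added box\<close>

text \<open>\<open>(r, c)\<close> is the added cell. Tableaux of shape \<open>l\<close> with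
  \<open>n\<close> in this cell correspond to tableaux of shape \<open>\<mu>\<close>.\<close>

locale added_box =
  fixes n :: nat and \<mu> l :: "nat list" and r c :: nat
  assumes n: "n > 0" and mu: "\<mu> \<in> partitions (n - 1)" and l: "l \<in> partitions n"
    and new: "(r, c) \<notin> young_diagram \<mu>" and diagram: "young_diagram l = insert (r, c) (young_diagram \<mu>)"
begin

definition ins :: "(nat \<Rightarrow> nat set) \<Rightarrow> nat \<Rightarrow> nat set" where
  "ins s = s(r := insert n (s r))"

text \<open>The adjoint of \<open>lift\<close>: it keeps the coefficients of the tabloids that have
  \<open>n\<close> in row \<open>r\<close> and drops this entry.\<close>

definition pull :: "((nat \<Rightarrow> nat set) \<Rightarrow> complex) \<Rightarrow> (nat \<Rightarrow> nat set) \<Rightarrow> complex" where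
  "pull g = (\<lambda>s. if s \<in> tabloids (n - 1) \<mu> then g (ins s) else 0)"

abbreviation lift :: "((nat \<Rightarrow> nat set) \<Rightarrow> complex) \<Rightarrow> (nat \<Rightarrow> nat set) \<Rightarrow> complex" where
  "lift \<equiv> push (tabloids (n - 1) \<mu>) ins"

lemma range_insert: "{1..n} = insert n {1..n - 1}"
  using n by auto

lemma tableau_restrict: "t \<in> tableaux n l \<Longrightarrow> t (r, c) = n \<Longrightarrow> t \<in> tableaux (n - 1) \<mu>"
proof -
  assume t: "t \<in> tableaux n l" "t (r, c) = n"
  have "bij_betw t (young_diagram l - {(r, c)}) (t ` (young_diagram l - {(r, c)}))"
    using tableaux_bij[OF t(1)] by (auto simp: bij_betw_def intro: inj_on_subset)
  moreover have "t ` (young_diagram l - {(r, c)}) = {1..n} - {t (r, c)}"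
  proof -
    have "t ` (young_diagram l - {(r, c)}) = t ` young_diagram l - t ` {(r, c)}"
      by (rule inj_on_image_set_diff[where C = "young_diagram l"]) (use tableaux_bij[OF t(1)] diagram in \<open>auto simp: bij_betw_def\<close>)
    then show ?thesis using tableaux_bij[OF t(1)] by (simp add: bij_betw_def)
  qed
  ultimately have "bij_betw t (young_diagram l - {(r, c)}) ({1..n} - {t (r, c)})" by simp
  moreover have "young_diagram l - {(r, c)} = young_diagram \<mu>" using diagram new by auto
  moreover have "{1..n} - {t (r, c)} = {1..n - 1}" using t(2) n by auto
  ultimately show ?thesis by (simp add: tableaux_def)
qed

lemma tableau_extend:
  assumes u: "u \<in> tableaux (n - 1) \<mu>"
  shows "u((r, c) := n) \<in> tableaux n l"
proof -
  have "bij_betw (u((r, c) := n)) (young_diagram \<mu>) {1..n - 1}"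
    using tableaux_bij[OF u] by (rule bij_betw_cong[THEN iffD1, rotated]) (use new in auto)
  then have "bij_betw (u((r, c) := n)) (insert (r, c) (young_diagram \<mu>)) (insert n {1..n - 1})"
    using notIn_Un_bij_betw[of "(r, c)" "young_diagram \<mu>" "u((r, c) := n)" "{1..n - 1}"] new n by simp
  then show ?thesis using diagram range_insert by (simp add: tableaux_def)
qed

lemma tabloid_ins: "t (r, c) = n \<Longrightarrow> tabloid l t = ins (tabloid \<mu> t)"
  by (rule ext) (auto simp: tabloid_def ins_def diagram)

lemma ins_tabloids: "s \<in> tabloids (n - 1) \<mu> \<Longrightarrow> ins s \<in> tabloids n l"
proof -
  assume "s \<in> tabloids (n - 1) \<mu>"
  then obtain u where u: "u \<in> tableaux (n - 1) \<mu>" "s = tabloid \<mu> u" by blast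
  have "tabloid \<mu> (u((r, c) := n)) = s"
    unfolding u(2) by (rule column_stabilizer_cong(2)) (use new in auto)
  then have "ins s = tabloid l (u((r, c) := n))" using tabloid_ins[of "u((r, c) := n)"] by simp
  then show ?thesis using tableau_extend[OF u(1)] by blast
qed

lemma not_in_tabloid: "s \<in> tabloids (n - 1) \<mu> \<Longrightarrow> n \<notin> s i"
  using tabloid_subset[of _ "n - 1" \<mu> i] n by fastforce

lemma ins_inj:
  assumes "s \<in> tabloids (n - 1) \<mu>" "s' \<in> tabloids (n - 1) \<mu>" "ins s = ins s'"
  shows "s = s'"
proof
  fix i
  have "ins s i - {n} = ins s' i - {n}" using assms(3) by simp
  then show "s i = s' i"
    using not_in_tabloid[OF assms(1), of i] not_in_tabloid[OF assms(2), of i] by (auto simp: ins_def split: if_splits)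
qed

lemma ins_tact: "\<sigma> permutes {1..n - 1} \<Longrightarrow> ins (tact \<sigma> s) = tact \<sigma> (ins s)"
  using permutes_pred_fixes[of \<sigma> n] n by (auto simp: ins_def fun_eq_iff)

lemma linear_on_pull: "linear_on W pull"
  by (auto simp: linear_on_def pull_def fun_eq_iff)

lemma pull_rep:
  assumes s: "\<sigma> permutes {1..n - 1}"
  shows "pull (tabloid_rep n l \<sigma> g) = tabloid_rep (n - 1) \<mu> \<sigma> (pull g)"
proof
  fix x
  note p = permutes_pred[OF s] and i = permutes_inv[OF s]
  show "pull (tabloid_rep n l \<sigma> g) x = tabloid_rep (n - 1) \<mu> \<sigma> (pull g) x"
    using ins_tabloids[of x] tact_tabloids[OF i, of x \<mu>] ins_tact[OF i, of x]
    by (simp add: pull_def tab.rep_apply[OF p] tab.rep_apply[OF s])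
qed

lemma lift_rep:
  assumes s: "\<sigma> permutes {1..n - 1}"
  shows "lift (tabloid_rep (n - 1) \<mu> \<sigma> f) = tabloid_rep n l \<sigma> (lift f)"
proof -
  have "lift (tabloid_rep (n - 1) \<mu> \<sigma> f) = (\<Sum>x\<in>tabloids (n - 1) \<mu>. fscale (f x) (lift (basis_vec (tact \<sigma> x))))"
    unfolding push_def[of _ "tact \<sigma>"] push_sum push_scale ..
  also have "\<dots> = (\<Sum>x\<in>tabloids (n - 1) \<mu>. fscale (f x) (tabloid_rep n l \<sigma> (basis_vec (ins x))))"
  proof (rule sum.cong[OF refl])
    fix x assume x: "x \<in> tabloids (n - 1) \<mu>"
    show "fscale (f x) (lift (basis_vec (tact \<sigma> x))) = fscale (f x) (tabloid_rep n l \<sigma> (basis_vec (ins x)))"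
      using push_basis_vec[OF finite_tabloids tact_tabloids[OF s x], of ins]
        push_basis_vec[OF finite_tabloids ins_tabloids[OF x], of "tact \<sigma>"] ins_tact[OF s, of x] by simp
  qed
  also have "\<dots> = tabloid_rep n l \<sigma> (lift f)"
    unfolding push_def[of _ ins] push_sum push_scale ..
  finally show ?thesis .
qed

text \<open>Through this adjointness the map upwards is seen to be nonzero by the same computation
  \<open>pull_polytabloid\<close> as the map downwards.\<close>

lemma form_lift: "form (tabloids n l) (lift f) g = form (tabloids (n - 1) \<mu>) f (pull g)"
proof -
  have "form (tabloids n l) g (lift f) = (\<Sum>s\<in>tabloids (n - 1) \<mu>. f s * g (ins s))"
    unfolding push_def form_sum form_scale
    by (rule sum.cong) (simp_all add: form_basis_vec finite_tabloids ins_tabloids)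
  also have "\<dots> = form (tabloids (n - 1) \<mu>) f (pull g)"
    by (simp add: form_def pull_def)
  finally show ?thesis by (simp only: form_commute[of _ "lift f"])
qed

lemma column_stabilizer_restrict:
  assumes t: "t \<in> tableaux n l" and tn: "t (r, c) = n"
  shows "column_stabilizer (n - 1) \<mu> t = {q \<in> column_stabilizer n l t. q n = n}" (is "?L = ?R")
proof
  show "?L \<subseteq> ?R"
  proof
    fix q assume q: "q \<in> ?L"
    then have p: "q permutes {1..n - 1}" by (rule column_stabilizer_permutes)
    have "\<exists>i'. (i', j) \<in> young_diagram l \<and> q (t (i, j)) = t (i', j)" if "(i, j) \<in> young_diagram l" for i j
    proof (cases "(i, j) = (r, c)")
      case True
      then show ?thesis using permutes_pred_fixes[OF p n] tn diagram by auto
    next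
      case False
      then have "(i, j) \<in> young_diagram \<mu>" using that diagram by blast
      then show ?thesis using q diagram unfolding column_stabilizer_def by blast
    qed
    then show "q \<in> ?R"
      using permutes_pred[OF p] permutes_pred_fixes[OF p n] by (auto simp: column_stabilizer_def sym_group_def)
  qed
  show "?R \<subseteq> ?L"
  proof
    fix q assume q: "q \<in> ?R"
    then have p: "q permutes {1..n}" "q n = n" using column_stabilizer_permutes by blast+
    have "\<exists>i'. (i', j) \<in> young_diagram \<mu> \<and> q (t (i, j)) = t (i', j)" if ij: "(i, j) \<in> young_diagram \<mu>" for i j
    proof -
      obtain i' where i': "(i', j) \<in> young_diagram l" "q (t (i, j)) = t (i', j)"
        using q ij diagram unfolding column_stabilizer_def by blast
      have "(i', j) \<noteq> (r, c)"
      proof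
        assume "(i', j) = (r, c)"
        then have "q (t (i, j)) = q n" using i' tn p by simp
        then have "t (i, j) = t (r, c)" using permutes_inj[OF p(1)] tn by (simp add: inj_eq)
        then have "(i, j) = (r, c)"
          using tableaux_bij[OF t] ij diagram by (auto simp: bij_betw_def inj_on_def)
        then show False using ij new by simp
      qed
      then show ?thesis using i' diagram by blast
    qed
    then show "q \<in> ?L"
      using permutes_fixes_pred[OF p] by (auto simp: column_stabilizer_def sym_group_def)
  qed
qed

text \<open>A column permutation \<open>q\<close> contributes a tabloid with \<open>n\<close> in row
  \<open>r\<close> only if it fixes \<open>n\<close>: an entry in \<open>(r, j)\<close> sent to
  \<open>n\<close> stays in its column, so \<open>j = c\<close> and the entry was \<open>n\<close>.
  The remaining \<open>q\<close> form the column stabilizer for \<open>\<mu>\<close>.\<close>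

lemma pull_polytabloid:
  assumes t: "t \<in> tableaux n l" and tn: "t (r, c) = n"
  shows "pull (polytabloid n l t) = polytabloid (n - 1) \<mu> t"
proof
  fix s
  note u = tableau_restrict[OF t tn]
  show "pull (polytabloid n l t) s = polytabloid (n - 1) \<mu> t s"
  proof (cases "s \<in> tabloids (n - 1) \<mu>")
    case False
    then show ?thesis
      using polytabloid_in_free_space[OF u] by (simp add: pull_def free_space_def)
  next
    case True
    have e: "(if ins s = tabloid l (q \<circ> t) then of_int (sign q) else 0 :: complex)
        = (if q n = n \<and> s = tabloid \<mu> (q \<circ> t) then of_int (sign q) else 0)"
      if q: "q \<in> column_stabilizer n l t" for q
    proof -
      have p: "q permutes {1..n}" using q by (rule column_stabilizer_permutes)
      have "q n = n" if "ins s = tabloid l (q \<circ> t)"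
      proof -
        have "n \<in> tabloid l (q \<circ> t) r" using that[symmetric] by (simp add: ins_def)
        then obtain j where j: "(r, j) \<in> young_diagram l" "q (t (r, j)) = n" by (auto simp: tabloid_def)
        have "col_of l t (q (t (r, j))) = col_of l t (t (r, j))"
          using q tableau_in[OF t j(1)] by (simp add: column_stabilizer_iff[OF t])
        then have "j = c"
          using j tn row_col_of_tableau(2)[OF t j(1)] row_col_of_tableau(2)[OF t, of r c] diagram by simp
        then show ?thesis using j tn by simp
      qed
      moreover have "ins s = tabloid l (q \<circ> t) \<longleftrightarrow> s = tabloid \<mu> (q \<circ> t)" if qn: "q n = n"
      proof -
        have "q \<circ> t \<in> tableaux (n - 1) \<mu>"
          using tableau_restrict[OF tableaux_comp[OF t p]] tn qn by simp
        then have "tabloid \<mu> (q \<circ> t) \<in> tabloids (n - 1) \<mu>" by blast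
        moreover have "tabloid l (q \<circ> t) = ins (tabloid \<mu> (q \<circ> t))" using tabloid_ins[of "q \<circ> t"] tn qn by simp
        ultimately show ?thesis using ins_inj[OF True] by auto
      qed
      ultimately show ?thesis by auto
    qed
    have "polytabloid n l t (ins s) = (\<Sum>q\<in>column_stabilizer n l t. if q n = n \<and> s = tabloid \<mu> (q \<circ> t) then of_int (sign q) else 0)"
      unfolding polytabloid_apply by (rule sum.cong) (use e in auto)
    also have "\<dots> = (\<Sum>q | q \<in> column_stabilizer n l t \<and> q n = n. if s = tabloid \<mu> (q \<circ> t) then of_int (sign q) else 0)"
      by (rule sum.mono_neutral_cong_right) auto
    also have "\<dots> = polytabloid (n - 1) \<mu> t s"
      unfolding polytabloid_apply column_stabilizer_restrict[OF t tn] by simp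
    finally show ?thesis using True by (simp add: pull_def)
  qed
qed

lemma corner_tableau: "\<exists>t. t \<in> tableaux n l \<and> t (r, c) = n"
proof -
  obtain u where "u \<in> tableaux (n - 1) \<mu>" using tableaux_nonempty[OF mu] by blast
  then show ?thesis using tableau_extend[of u] by (intro exI[of _ "u((r, c) := n)"]) simp
qed

text \<open>\<open>pull\<close> alone may leave the Specht space of \<open>\<mu>\<close>, for
  instance on polytabloids with \<open>n\<close> in a lower row; the frame operator forces the value
  into it. On the polytabloid of a tableau with \<open>n\<close> in the new cell the result is
  nonzero.\<close>

lemma restriction_map:
  "\<exists>\<theta>. equivariant_on (n - 1) (tabloids n l) tact (tabloids (n - 1) \<mu>) tact (specht_space n l) \<theta> \<and>
     \<theta> ` specht_space n l \<subseteq> specht_space (n - 1) \<mu> \<and> (\<exists>v\<in>specht_space n l. \<theta> v \<noteq> 0)"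
proof -
  obtain t where t: "t \<in> tableaux n l" "t (r, c) = n" using corner_tableau by blast
  note u = tableau_restrict[OF t]
  let ?e = "polytabloid (n - 1) \<mu> t"
  define \<theta> where "\<theta> v = frame_op (n - 1) (tabloids (n - 1) \<mu>) tact ?e (pull v)" for v
  have "linear_on (specht_space n l) \<theta>"
    unfolding \<theta>_def by (rule linear_on_compose[OF linear_on_pull linear_on_frame_op[of UNIV]]) simp
  moreover have "\<theta> (tabloid_rep n l \<sigma> v) = tabloid_rep (n - 1) \<mu> \<sigma> (\<theta> v)"
    if "\<sigma> permutes {1..n - 1}" for \<sigma> v
    unfolding \<theta>_def pull_rep[OF that] tab.rep_frame_op[OF that] ..
  moreover have "\<theta> v \<in> specht_space (n - 1) \<mu>" for v
    unfolding \<theta>_def by (rule frame_op_in_specht_space[OF u])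
  moreover have "\<theta> (polytabloid n l t) \<noteq> 0"
    unfolding \<theta>_def pull_polytabloid[OF t]
    by (rule tab.frame_op_nonzero[OF real_valued_polytabloid real_valued_polytabloid polytabloid_in_free_space[OF u] form_polytabloid_self[OF u]])
  ultimately show ?thesis
    using polytabloid_in_specht_space[OF t(1)] unfolding equivariant_on_def by blast
qed

text \<open>The frame operator is now that of the larger group \<open>S_n\<close>, taken at a
  polytabloid of shape \<open>l\<close>; restricted to \<open>S_{n-1}\<close> it is still
  equivariant.\<close>

lemma corestriction_map:
  "\<exists>j. equivariant_on (n - 1) (tabloids (n - 1) \<mu>) tact (tabloids n l) tact (specht_space (n - 1) \<mu>) j \<and>
     j ` specht_space (n - 1) \<mu> \<subseteq> specht_space n l \<and> (\<exists>v\<in>specht_space (n - 1) \<mu>. j v \<noteq> 0)"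
proof -
  obtain t where t: "t \<in> tableaux n l" "t (r, c) = n" using corner_tableau by blast
  note u = tableau_restrict[OF t]
  define j where "j v = frame_op n (tabloids n l) tact (polytabloid n l t) (lift v)" for v
  have "linear_on (specht_space (n - 1) \<mu>) j"
    unfolding j_def by (rule linear_on_compose[OF linear_on_push linear_on_frame_op[of UNIV]]) simp
  moreover have "j (tabloid_rep (n - 1) \<mu> \<sigma> v) = tabloid_rep n l \<sigma> (j v)"
    if "\<sigma> permutes {1..n - 1}" for \<sigma> v
    unfolding j_def lift_rep[OF that] tab.rep_frame_op[OF permutes_pred[OF that]] ..
  moreover have "j v \<in> specht_space n l" for v
    unfolding j_def by (rule frame_op_in_specht_space[OF t(1)])
  moreover have "j (polytabloid (n - 1) \<mu> t) \<noteq> 0"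
    unfolding j_def
  proof (rule tab.frame_op_nonzero)
    show "form (tabloids n l) (lift (polytabloid (n - 1) \<mu> t)) (polytabloid n l t) \<noteq> 0"
      unfolding form_lift pull_polytabloid[OF t] by (rule form_polytabloid_self[OF u])
  qed (auto intro: real_valued_push real_valued_polytabloid polytabloid_in_free_space[OF t(1)])
  ultimately show ?thesis
    using polytabloid_in_specht_space[OF u] unfolding equivariant_on_def by blast
qed

end

lemma adds_box_locale:
  assumes "n > 0" "\<mu> \<in> partitions (n - 1)" "l \<in> partitions n" "adds_box \<mu> l"
  shows "\<exists>r c. added_box n \<mu> l r c"
  using insert_box[OF assms(4)] assms by (metis added_box.intro)

section \<open>Independent copies in restricted modules and the dimension bound\<close>

definition down_map :: "nat \<Rightarrow> nat list \<Rightarrow> nat list \<Rightarrow> ((nat \<Rightarrow> nat set) \<Rightarrow> complex) \<Rightarrow> (nat \<Rightarrow> nat set) \<Rightarrow> complex" where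
  "down_map n l \<mu> = (SOME \<theta>. equivariant_on (n - 1) (tabloids n l) tact (tabloids (n - 1) \<mu>) tact (specht_space n l) \<theta> \<and>
     \<theta> ` specht_space n l \<subseteq> specht_space (n - 1) \<mu> \<and> (\<exists>v\<in>specht_space n l. \<theta> v \<noteq> 0))"

definition up_map :: "nat \<Rightarrow> nat list \<Rightarrow> nat list \<Rightarrow> ((nat \<Rightarrow> nat set) \<Rightarrow> complex) \<Rightarrow> (nat \<Rightarrow> nat set) \<Rightarrow> complex" where
  "up_map n \<mu> l = (SOME j. equivariant_on (n - 1) (tabloids (n - 1) \<mu>) tact (tabloids n l) tact (specht_space (n - 1) \<mu>) j \<and>
     j ` specht_space (n - 1) \<mu> \<subseteq> specht_space n l \<and> (\<exists>v\<in>specht_space (n - 1) \<mu>. j v \<noteq> 0))"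

lemma
  assumes "n > 0" "\<mu> \<in> partitions (n - 1)" "l \<in> partitions n" "adds_box \<mu> l"
  shows down_map_equivariant: "equivariant_on (n - 1) (tabloids n l) tact (tabloids (n - 1) \<mu>) tact (specht_space n l) (down_map n l \<mu>)"
    and down_map_in: "v \<in> specht_space n l \<Longrightarrow> down_map n l \<mu> v \<in> specht_space (n - 1) \<mu>"
    and down_map_nonzero: "\<exists>v\<in>specht_space n l. down_map n l \<mu> v \<noteq> 0"
    and up_map_equivariant: "equivariant_on (n - 1) (tabloids (n - 1) \<mu>) tact (tabloids n l) tact (specht_space (n - 1) \<mu>) (up_map n \<mu> l)"
    and up_map_in: "v' \<in> specht_space (n - 1) \<mu> \<Longrightarrow> up_map n \<mu> l v' \<in> specht_space n l"
    and up_map_nonzero: "\<exists>v\<in>specht_space (n - 1) \<mu>. up_map n \<mu> l v \<noteq> 0"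
proof -
  obtain r c where "added_box n \<mu> l r c" using adds_box_locale[OF assms] by blast
  then interpret added_box n \<mu> l r c .
  note d = someI_ex[OF restriction_map, folded down_map_def] and u = someI_ex[OF corestriction_map, folded up_map_def]
  show "equivariant_on (n - 1) (tabloids n l) tact (tabloids (n - 1) \<mu>) tact (specht_space n l) (down_map n l \<mu>)"
    "v \<in> specht_space n l \<Longrightarrow> down_map n l \<mu> v \<in> specht_space (n - 1) \<mu>"
    "\<exists>v\<in>specht_space n l. down_map n l \<mu> v \<noteq> 0" using d by blast+
  show "equivariant_on (n - 1) (tabloids (n - 1) \<mu>) tact (tabloids n l) tact (specht_space (n - 1) \<mu>) (up_map n \<mu> l)"
    "v' \<in> specht_space (n - 1) \<mu> \<Longrightarrow> up_map n \<mu> l v' \<in> specht_space n l"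
    "\<exists>v\<in>specht_space (n - 1) \<mu>. up_map n \<mu> l v \<noteq> 0" using u by blast+
qed

lemma push_zero: "push X h 0 = 0"
  by (rule linear_on_0[OF cfun.subspace_UNIV linear_on_push])

text \<open>Equivariance lets the single vanishing sum be translated by all of
  \<open>S_{n-1}\<close>, which is the form of hypothesis that \<open>specht_independent\<close>
  demands.\<close>

lemma up_maps_independent:
  assumes n: "n > 0" and l: "l \<in> partitions n"
    and x: "\<And>\<mu>. \<mu> \<in> {\<mu> \<in> partitions (n - 1). adds_box \<mu> l} \<Longrightarrow> x \<mu> \<in> specht_space (n - 1) \<mu>"
    and z: "(\<Sum>\<mu> | \<mu> \<in> partitions (n - 1) \<and> adds_box \<mu> l. up_map n \<mu> l (x \<mu>)) = 0"
    and mu: "\<mu> \<in> {\<mu> \<in> partitions (n - 1). adds_box \<mu> l}"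
  shows "x \<mu> = 0"
proof (rule specht_independent[of "{\<mu> \<in> partitions (n - 1). adds_box \<mu> l}" "n - 1" "\<lambda>\<mu>. up_map n \<mu> l" x \<mu>, OF _ _ _ _ x])
  note eq = up_map_equivariant[OF n _ l]
  show "(\<Sum>\<mu> | \<mu> \<in> partitions (n - 1) \<and> adds_box \<mu> l. up_map n \<mu> l (tabloid_rep (n - 1) \<mu> \<sigma> (x \<mu>))) = 0"
    if s: "\<sigma> permutes {1..n - 1}" for \<sigma>
  proof -
    have "(\<Sum>\<mu> | \<mu> \<in> partitions (n - 1) \<and> adds_box \<mu> l. up_map n \<mu> l (tabloid_rep (n - 1) \<mu> \<sigma> (x \<mu>)))
       = (\<Sum>\<mu> | \<mu> \<in> partitions (n - 1) \<and> adds_box \<mu> l. tabloid_rep n l \<sigma> (up_map n \<mu> l (x \<mu>)))"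
      by (rule sum.cong) (use eq x s in \<open>auto simp: equivariant_on_def\<close>)
    then show ?thesis using z by (simp add: push_sum[symmetric] push_zero)
  qed
qed (use mu up_map_equivariant[OF n _ l] up_map_nonzero[OF n _ l] in \<open>auto simp: equivariant_on_def\<close>)

lemma dim_specht_pos:
  assumes "l \<in> partitions m" shows "cfun.dim (specht_space m l) \<ge> 1"
proof -
  obtain t where t: "t \<in> tableaux m l" using tableaux_nonempty[OF assms] by blast
  let ?C = "{polytabloid m l t}"
  have i: "cfun.independent ?C" using polytabloid_nonzero[OF t] by simp
  have "?C \<subseteq> specht_space m l" using polytabloid_in_specht_space[OF t] by blast
  then have "card ?C \<le> cfun.dim (specht_space m l)" using fin_dim_independent(2)[OF fin_dim_specht_space _ i] by blast
  moreover have "card ?C = 1" by (rule is_singleton_altdef[THEN iffD1]) (rule is_singletonI)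
  ultimately show ?thesis by (simp only:)
qed

text \<open>The Specht module of \<open>l\<close> contains independent images of the Specht modules
  of all shapes with one box removed, so its dimension satisfies the recursion of
  \<open>num_std\<close> as an inequality.\<close>

lemma dim_specht_ge:
  assumes "l \<in> partitions n" shows "num_std n l \<le> cfun.dim (specht_space n l)"
proof -
  define d where "d n l = cfun.dim (specht_space n l)" for n l
  have step: "(\<Sum>\<mu> | \<mu> \<in> partitions n \<and> adds_box \<mu> l. d n \<mu>) \<le> d (Suc n) l" if l: "l \<in> partitions (Suc n)" for n l
    unfolding d_def
  proof (rule jointly_inj_dim(1))
    let ?I = "{\<mu> \<in> partitions n. adds_box \<mu> l}"
    show "jointly_inj ?I (specht_space n) (\<lambda>\<mu>. up_map (Suc n) \<mu> l)"
      unfolding jointly_inj_def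
    proof (intro allI impI ballI)
      fix x \<mu> assume x: "\<forall>\<mu>\<in>?I. x \<mu> \<in> specht_space n \<mu>" and z: "(\<Sum>\<mu>\<in>?I. up_map (Suc n) \<mu> l (x \<mu>)) = 0" and mu: "\<mu> \<in> ?I"
      show "x \<mu> = 0"
        by (rule up_maps_independent[OF _ l, of x]) (use x z mu in simp_all)
    qed
    show "linear_on (specht_space n \<mu>) (up_map (Suc n) \<mu> l)" if "\<mu> \<in> ?I" for \<mu>
      using up_map_equivariant[of "Suc n" \<mu> l] that l by (simp add: equivariant_on_def)
    show "up_map (Suc n) \<mu> l ` specht_space n \<mu> \<subseteq> specht_space (Suc n) l" if "\<mu> \<in> ?I" for \<mu>
      using up_map_in[of "Suc n" \<mu> l] that l by auto
  qed (auto simp: fin_dim_specht_space)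
  have "l \<in> partitions n \<Longrightarrow> num_std n l \<le> d n l"
  proof (induction n arbitrary: l)
    case 0
    then show ?case using dim_specht_pos[OF 0] by (simp only: d_def num_std.simps)
  next
    case (Suc n)
    have "num_std (Suc n) l \<le> (\<Sum>\<mu> | \<mu> \<in> partitions n \<and> adds_box \<mu> l. d n \<mu>)"
      unfolding num_std.simps by (rule sum_mono) (use Suc.IH in blast)
    then show ?case using step[OF Suc.prems] by simp
  qed
  then show ?thesis using assms by (simp only: d_def)
qed

section \<open>Tensor space\<close>

lemma finite_words [simp]: "finite (words n k)"
  using finite_lists_length_eq[of "{1..n}" k] by (simp add: words_def conj_commute)

lemma card_words: "card (words n k) = n ^ k"
  using card_lists_length_eq[of "{1..n}" k] by (simp add: words_def conj_commute)

lemma words_map: "\<sigma> permutes {1..n} \<Longrightarrow> w \<in> words n k \<Longrightarrow> map \<sigma> w \<in> words n k"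
  using permutes_in_image[of \<sigma> "{1..n}"] by (auto simp: words_def)

lemma perm_rep_words: "m \<le> n \<Longrightarrow> perm_rep m (words n k) map"
proof
  assume mn: "m \<le> n"
  show "map \<sigma> x \<in> words n k" if "\<sigma> permutes {1..m}" "x \<in> words n k" for \<sigma> x
  proof -
    have "\<sigma> permutes {1..n}" by (rule permutes_subset[OF that(1)]) (use mn in auto)
    then show ?thesis using words_map that(2) by blast
  qed
qed auto

interpretation words: perm_rep n "words n k" map for n k
  by (rule perm_rep_words) simp

lemma path_set_Suc_cases:
  assumes "q \<in> path_set n (Suc s)"
  shows "\<exists>p\<in>path_set n s. \<exists>l\<in>nexts n s (last p). q = p @ [l]"
proof -
  have "q \<in> (\<lambda>(p, l). p @ [l]) ` (SIGMA p:path_set n s. nexts n s (last p))"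
    using assms by (simp only: bij_betw_imp_surj_on[OF path_set_Suc])
  then show ?thesis by auto
qed

section \<open>Embeddings indexed by paths\<close>

text \<open>The invariant of the induction over levels: the direct sum over all paths of the Specht
  modules of their endpoints embeds into tensor space.\<close>

definition tensor_family :: "nat \<Rightarrow> nat \<Rightarrow> (nat list list \<Rightarrow> ((nat \<Rightarrow> nat set) \<Rightarrow> complex) \<Rightarrow> nat list \<Rightarrow> complex) \<Rightarrow> bool" where
  "tensor_family n s \<phi> \<longleftrightarrow>
     (\<forall>p\<in>path_set n s.
        equivariant_on (level_size n s) (tabloids (level_size n s) (last p)) tact (words n (s div 2)) map
          (specht_space (level_size n s) (last p)) (\<phi> p) \<and>
        \<phi> p ` specht_space (level_size n s) (last p) \<subseteq> free_space (words n (s div 2))) \<and>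
     jointly_inj (path_set n s) (\<lambda>p. specht_space (level_size n s) (last p)) \<phi>"

text \<open>At level 0 tensor space is the trivial module on the empty word, and the one-row shape
  has a single tabloid \<open>x0\<close>, whose coefficient is the coordinate.\<close>

lemma tensor_family_base:
  assumes n: "n > 0" shows "\<exists>\<phi>. tensor_family n 0 \<phi>"
proof -
  let ?X = "tabloids n [n]" and ?S = "specht_space n [n]"
  define x0 :: "nat \<Rightarrow> nat set" where "x0 i = (if i = 0 then {1..n} else {})" for i
  have X: "x = x0" if x: "x \<in> ?X" for x
  proof
    fix i
    obtain t where t: "t \<in> tableaux n [n]" "x = tabloid [n] t" using x by blast
    have "row_of [n] t a = 0" if "a \<in> {1..n}" for a
      using tableau_cell(1)[OF t(1) that] by (simp add: young_diagram_def)
    then show "x i = x0 i" unfolding t(2) tabloid_row_of[OF t(1)] x0_def by auto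
  qed
  obtain t where t: "t \<in> tableaux n [n]" using tableaux_nonempty[OF single_row_partition[OF n]] by blast
  then have x0: "x0 \<in> ?X" using X[of "tabloid [n] t"] by auto
  define \<phi> :: "nat list list \<Rightarrow> ((nat \<Rightarrow> nat set) \<Rightarrow> complex) \<Rightarrow> nat list \<Rightarrow> complex" where "\<phi> p v = fscale (v x0) (basis_vec [])" for p v
  have W: "words n 0 = {[]}" by (auto simp: words_def)
  have eq: "equivariant_on n ?X tact (words n 0) map ?S (\<phi> p)" for p
    unfolding equivariant_on_def
  proof (intro conjI allI impI)
    show "linear_on ?S (\<phi> p)" by (simp add: linear_on_def \<phi>_def cfun.scale_left_distrib)
    fix \<sigma> v assume s: "\<sigma> permutes {1..n}" and "v \<in> ?S"
    have "push ?X (tact \<sigma>) v x0 = v x0"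
      using X[OF tact_tabloids[OF permutes_inv[OF s] x0]] x0 by (simp add: tab.rep_apply[OF s])
    moreover have "push (words n 0) (map \<sigma>) (basis_vec []) = basis_vec []"
      by (simp add: push_basis_vec W)
    ultimately show "\<phi> p (push ?X (tact \<sigma>) v) = push (words n 0) (map \<sigma>) (\<phi> p v)"
      by (simp add: \<phi>_def push_scale)
  qed
  have im: "\<phi> p v \<in> free_space (words n 0)" for p v
    unfolding \<phi>_def by (rule cfun.subspace_scale) (simp_all add: W)
  have inj: "v = 0" if v: "v \<in> ?S" "\<phi> p v = 0" for v p
  proof
    fix x
    have "v x0 = 0" using fun_cong[OF v(2), of "[]"] by (simp add: \<phi>_def basis_vec_apply)
    then show "v x = 0 x"
      using v(1) specht_space_subset[of n "[n]"] X[of x] by (cases "x \<in> ?X") (auto simp: free_space_def)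
  qed
  have "tensor_family n 0 \<phi>"
    unfolding tensor_family_def jointly_inj_def path_set_0[OF n] using eq im inj by (simp add: level_size_def image_subset_iff)
  then show ?thesis by blast
qed

text \<open>The space stays and the group shrinks: precomposition with the \<open>up_map\<close>s
  splits the copy attached to \<open>p\<close> into copies for the paths that extend
  \<open>p\<close>.\<close>

lemma tensor_family_half_step:
  assumes n: "n > 0" and s: "even s" and fam: "tensor_family n s \<phi>"
  shows "\<exists>\<phi>. tensor_family n (Suc s) \<phi>"
proof -
  let ?W = "words n (s div 2)"
  have half: "Suc s div 2 = s div 2" using s by simp
  have lev: "level_size n s = n" "level_size n (Suc s) = n - 1" using s by (simp_all add: level_size_def)
  have part: "last p \<in> partitions n" if "p \<in> path_set n s" for p
    using path_set_last_partitions[OF that] lev by simp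
  note F = fam[unfolded tensor_family_def lev]
  define \<psi> where "\<psi> q x = \<phi> (butlast q) (up_map n (last q) (last (butlast q)) x)" for q x
  have decomp: "\<exists>p\<in>path_set n s. \<exists>\<mu>\<in>nexts n s (last p). q = p @ [\<mu>]" if "q \<in> path_set n (Suc s)" for q
    using path_set_Suc_cases[OF that] .
  have nx: "\<mu> \<in> partitions (n - 1)" "adds_box \<mu> (last p)" if "\<mu> \<in> nexts n s (last p)" for p \<mu>
    using that s by (auto simp: nexts_even)
  have "equivariant_on (n - 1) (tabloids (n - 1) (last q)) tact ?W map (specht_space (n - 1) (last q)) (\<psi> q) \<and>
      \<psi> q ` specht_space (n - 1) (last q) \<subseteq> free_space ?W" if q: "q \<in> path_set n (Suc s)" for q
  proof -
    obtain p \<mu> where p: "p \<in> path_set n s" and mu: "\<mu> \<in> nexts n s (last p)" and qp: "q = p @ [\<mu>]"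
      using decomp[OF q] by blast
    note a = n nx(1)[OF mu] part[OF p] nx(2)[OF mu]
    have ps: "\<psi> q = (\<lambda>x. \<phi> p (up_map n \<mu> (last p) x))" by (simp add: \<psi>_def[abs_def] qp)
    have E: "equivariant_on n (tabloids n (last p)) tact ?W map (specht_space n (last p)) (\<phi> p)"
        and I: "\<phi> p ` specht_space n (last p) \<subseteq> free_space ?W" using F p by blast+
    have inn: "up_map n \<mu> (last p) x \<in> specht_space n (last p)" if "x \<in> specht_space (n - 1) \<mu>" for x
      using up_map_in[OF a] that by blast
    have "linear_on (specht_space (n - 1) \<mu>) (\<psi> q)"
      unfolding ps
      by (rule linear_on_compose[of _ _ "specht_space n (last p)"])
        (use up_map_equivariant[OF a] E inn in \<open>auto simp: equivariant_on_def\<close>)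
    moreover have "\<psi> q (tabloid_rep (n - 1) \<mu> \<sigma> x) = push ?W (map \<sigma>) (\<psi> q x)"
      if "\<sigma> permutes {1..n - 1}" "x \<in> specht_space (n - 1) \<mu>" for \<sigma> x
      using up_map_equivariant[OF a] E inn[OF that(2)] that permutes_pred[OF that(1)]
      by (simp add: ps equivariant_on_def)
    moreover have "\<psi> q x \<in> free_space ?W" if "x \<in> specht_space (n - 1) \<mu>" for x
      using I inn[OF that] by (auto simp: ps)
    ultimately show ?thesis by (auto simp: equivariant_on_def qp)
  qed
  moreover have "jointly_inj (path_set n (Suc s)) (\<lambda>q. specht_space (n - 1) (last q)) \<psi>"
    unfolding jointly_inj_def
  proof (intro allI impI ballI)
    fix x q
    assume x: "\<forall>q\<in>path_set n (Suc s). x q \<in> specht_space (n - 1) (last q)"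
      and z: "(\<Sum>q\<in>path_set n (Suc s). \<psi> q (x q)) = 0" and q: "q \<in> path_set n (Suc s)"
    have xin: "x (p @ [\<mu>]) \<in> specht_space (n - 1) \<mu>" if "p \<in> path_set n s" "\<mu> \<in> nexts n s (last p)" for p \<mu>
      using x bij_betwE[OF path_set_Suc[of n s]] that by fastforce
    \<comment> \<open>The extended paths are grouped by their initial segment \<open>p\<close>. The
      old family separates the groups, and within a group the \<open>up_map\<close>s are
      independent.\<close>
    define y where "y p = (\<Sum>\<mu>\<in>nexts n s (last p). up_map n \<mu> (last p) (x (p @ [\<mu>])))" for p
    have yin: "up_map n \<mu> (last p) (x (p @ [\<mu>])) \<in> specht_space n (last p)"
      if "p \<in> path_set n s" "\<mu> \<in> nexts n s (last p)" for p \<mu>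
      using up_map_in[OF n nx(1)[OF that(2)] part[OF that(1)] nx(2)[OF that(2)] xin[OF that]] .
    have "(\<Sum>q\<in>path_set n (Suc s). \<psi> q (x q)) = (\<Sum>p\<in>path_set n s. \<Sum>\<mu>\<in>nexts n s (last p). \<phi> p (up_map n \<mu> (last p) (x (p @ [\<mu>]))))"
      by (simp add: sum_path_set_Suc[OF n] \<psi>_def)
    also have "\<dots> = (\<Sum>p\<in>path_set n s. \<phi> p (y p))"
    proof (rule sum.cong[OF refl])
      fix p assume p: "p \<in> path_set n s"
      have "linear_on (specht_space n (last p)) (\<phi> p)" using F p by (simp add: equivariant_on_def)
      then show "(\<Sum>\<mu>\<in>nexts n s (last p). \<phi> p (up_map n \<mu> (last p) (x (p @ [\<mu>])))) = \<phi> p (y p)"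
        unfolding y_def by (rule linear_on_sum[symmetric, OF cfun.subspace_span]) (rule yin[OF p])
    qed
    finally have "(\<Sum>p\<in>path_set n s. \<phi> p (y p)) = 0" using z by simp
    moreover have "y p \<in> specht_space n (last p)" if "p \<in> path_set n s" for p
      unfolding y_def by (rule cfun.span_sum) (rule yin[OF that])
    moreover have "jointly_inj (path_set n s) (\<lambda>p. specht_space n (last p)) \<phi>" using F by blast
    ultimately have y0: "y p = 0" if "p \<in> path_set n s" for p
      using jointly_injD[of "path_set n s" "\<lambda>p. specht_space n (last p)" \<phi> y p] that by blast
    obtain p \<mu> where p: "p \<in> path_set n s" and mu: "\<mu> \<in> nexts n s (last p)" and qp: "q = p @ [\<mu>]"
      using decomp[OF q] by blast
    have "(\<lambda>\<mu>. x (p @ [\<mu>])) \<mu> = 0"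
      by (rule up_maps_independent[OF n part[OF p]])
        (use mu xin[OF p] y0[OF p] s in \<open>auto simp: nexts_even y_def\<close>)
    then show "x q = 0" by (simp add: qp)
  qed
  ultimately have "tensor_family n (Suc s) \<psi>" by (simp add: tensor_family_def lev half)
  then show ?thesis by blast
qed

text \<open>Frobenius reciprocity for \<open>V\<^bsup>\<otimes>(k+1)\<^esup> = Ind (Res V\<^sup>\<otimes>\<^sup>k)\<close>: the coefficients of the words ending in \<open>i\<close> are
  obtained from the case \<open>i = n\<close> by translation with the transposition of \<open>i\<close> and \<open>n\<close>.\<close>

definition induced_map :: "nat \<Rightarrow> nat \<Rightarrow> 'x set \<Rightarrow> ((nat \<Rightarrow> nat) \<Rightarrow> 'x \<Rightarrow> 'x) \<Rightarrow> (('x \<Rightarrow> complex) \<Rightarrow> nat list \<Rightarrow> complex) \<Rightarrow>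
    ('x \<Rightarrow> complex) \<Rightarrow> nat list \<Rightarrow> complex" where
  "induced_map n k X act \<psi> x w = (if w \<in> words n (Suc k)
     then \<psi> (push X (act (transpose (last w) n)) x) (map (transpose (last w) n) (butlast w)) else 0)"

lemma words_snoc: "w @ [i] \<in> words n (Suc k) \<longleftrightarrow> w \<in> words n k \<and> i \<in> {1..n}"
  by (auto simp: words_def)

lemma words_Suc_cases:
  assumes "w \<in> words n (Suc k)"
  obtains u i where "w = u @ [i]" "u \<in> words n k" "i \<in> {1..n}"
proof (cases w rule: rev_cases)
  case Nil then show ?thesis using assms by (simp add: words_def)
next
  case (snoc u i) then show ?thesis using assms that words_snoc by metis
qed

text \<open>A permutation carries the slice of words ending in \<open>i'\<close> to the slice ending
  in its image \<open>i\<close>. Conjugated to the last letter \<open>m\<close> by the two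
  transpositions it fixes \<open>m\<close>, and there \<open>\<psi>\<close> is equivariant.\<close>

lemma (in perm_rep) induced_map_equivariant:
  assumes n: "m > 0" and S: "\<And>\<sigma> v. \<sigma> permutes {1..m} \<Longrightarrow> v \<in> S \<Longrightarrow> rep \<sigma> v \<in> S"
    and SX: "S \<subseteq> free_space X"
    and psi: "equivariant_on (m - 1) X act (words m k) map S \<psi>"
  shows "equivariant_on m X act (words m (Suc k)) map S (induced_map m k X act \<psi>)"
proof -
  have tp: "transpose i m permutes {1..m}" if "i \<in> {1..m}" for i
    using that n by (intro permutes_swap_id) auto
  have lin: "linear_on S \<psi>" using psi by (simp add: equivariant_on_def)
  have lw: "last w \<in> {1..m}" if w: "w \<in> words m (Suc k)" for w
    using w by (rule words_Suc_cases) auto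
  have "linear_on S (induced_map m k X act \<psi>)"
    unfolding linear_on_def
  proof (intro conjI ballI allI ext)
    fix v w u assume vw: "v \<in> S" "w \<in> S"
    show "induced_map m k X act \<psi> (v + w) u = (induced_map m k X act \<psi> v + induced_map m k X act \<psi> w) u"
    proof (cases "u \<in> words m (Suc k)")
      case True
      note t = tp[OF lw[OF True]]
      show ?thesis
        using True linear_on_add[OF lin S[OF t vw(1)] S[OF t vw(2)]] by (simp add: induced_map_def push_add)
    qed (simp add: induced_map_def)
  next
    fix c w u assume w: "w \<in> S"
    show "induced_map m k X act \<psi> (fscale c w) u = fscale c (induced_map m k X act \<psi> w) u"
    proof (cases "u \<in> words m (Suc k)")
      case True
      note t = tp[OF lw[OF True]]
      show ?thesis
        using True linear_on_scale[OF lin S[OF t w]] by (simp add: induced_map_def push_scale)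
    qed (simp add: induced_map_def)
  qed
  moreover have "induced_map m k X act \<psi> (rep \<sigma> v) = push (words m (Suc k)) (map \<sigma>) (induced_map m k X act \<psi> v)"
    if s: "\<sigma> permutes {1..m}" and v: "v \<in> S" for \<sigma> v
  proof
    fix w
    show "induced_map m k X act \<psi> (rep \<sigma> v) w = push (words m (Suc k)) (map \<sigma>) (induced_map m k X act \<psi> v) w"
    proof (cases "w \<in> words m (Suc k)")
      case False
      then show ?thesis by (simp add: induced_map_def words.rep_apply[OF s])
    next
      case True
      note si = permutes_inv[OF s]
      obtain u i where w: "w = u @ [i]" "u \<in> words m k" "i \<in> {1..m}" using words_Suc_cases[OF True] .
      define i' where "i' = inv' \<sigma> i"
      have i': "i' \<in> {1..m}" "\<sigma> i' = i"
        using w(3) permutes_in_image[OF si] permutes_inverses(1)[OF s] by (auto simp: i'_def)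
      let ?t = "transpose i m" and ?t' = "transpose i' m"
      note t = tp[OF w(3)] and t' = tp[OF i'(1)]
      \<comment> \<open>This fixes \<open>m\<close>: the path is \<open>m\<close> to
        \<open>i'\<close> to \<open>i\<close> to \<open>m\<close>.\<close>
      define \<rho> where "\<rho> = ?t \<circ> \<sigma> \<circ> ?t'"
      have "\<rho> permutes {1..m}" unfolding \<rho>_def by (intro permutes_compose t t' s)
      moreover have "\<rho> m = m" by (simp add: \<rho>_def i'(2))
      ultimately have r: "\<rho> permutes {1..m - 1}" by (rule permutes_fixes_pred)
      have rm: "\<rho> permutes {1..m}" by fact
      have x': "rep ?t' v \<in> S" by (rule S[OF t' v])
      have "?t \<circ> \<sigma> = \<rho> \<circ> ?t'" by (simp add: \<rho>_def fun_eq_iff)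
      then have "rep ?t (rep \<sigma> v) = rep \<rho> (rep ?t' v)"
        using rep_comp[OF t s, of v] rep_comp[OF rm t', of v] by simp
      then have "\<psi> (rep ?t (rep \<sigma> v)) = push (words m k) (map \<rho>) (\<psi> (rep ?t' v))"
        using psi r x' by (simp add: equivariant_on_def)
      moreover have tu: "map ?t u \<in> words m k" using words_map[OF t w(2)] .
      moreover have "inv' \<rho> \<circ> ?t = ?t' \<circ> inv' \<sigma>"
      proof -
        have "inv' \<rho> = ?t' \<circ> inv' \<sigma> \<circ> ?t"
          by (rule inv_unique_comp) (use permutes_inverses[OF s] in \<open>auto simp: \<rho>_def fun_eq_iff\<close>)
        then show ?thesis by (simp add: fun_eq_iff)
      qed
      then have "map (inv' \<rho>) (map ?t u) = map ?t' (map (inv' \<sigma>) u)" by (simp only: map_map)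
      ultimately have "\<psi> (rep ?t (rep \<sigma> v)) (map ?t u) = \<psi> (rep ?t' v) (map ?t' (map (inv' \<sigma>) u))"
        by (simp add: words.rep_apply[OF rm] del: map_map)
      moreover have "map (inv' \<sigma>) w \<in> words m (Suc k)" using words_map[OF si True] .
      ultimately show ?thesis
        using True by (simp add: induced_map_def words.rep_apply[OF s] w(1) i'_def[symmetric] del: map_map)
    qed
  qed
  ultimately show ?thesis by (simp add: equivariant_on_def)
qed

text \<open>A sum of induced maps vanishes only if all its slices vanish. The slice for the last
  letter \<open>i\<close> is the old family applied to the translates by the transposition of
  \<open>i\<close> and \<open>n\<close>, so the old joint injectivity gives \<open>d i p = 0\<close>
  for every \<open>i\<close>. Running over all \<open>i\<close> amounts to running over all of
  \<open>S_n\<close>, and \<open>specht_independent\<close> applies to the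
  \<open>down_map\<close>s.\<close>

lemma tensor_family_up_step:
  assumes n: "n > 0" and s: "odd s" and fam: "tensor_family n s \<phi>"
  shows "\<exists>\<phi>. tensor_family n (Suc s) \<phi>"
proof -
  define k where "k = s div 2"
  have half: "Suc s div 2 = Suc k" using s by (simp add: k_def)
  have lev: "level_size n s = n - 1" "level_size n (Suc s) = n" using s by (simp_all add: level_size_def)
  have part: "last p \<in> partitions (n - 1)" if "p \<in> path_set n s" for p
    using path_set_last_partitions[OF that] lev by simp
  note F = fam[unfolded tensor_family_def lev, folded k_def]
  define \<psi> where "\<psi> p l x = \<phi> p (down_map n l (last p) x)" for p l x
  define \<chi> where "\<chi> q = induced_map n k (tabloids n (last q)) tact (\<psi> (butlast q) (last q))" for q
  have decomp: "\<exists>p\<in>path_set n s. \<exists>l\<in>nexts n s (last p). q = p @ [l]" if "q \<in> path_set n (Suc s)" for q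
    using path_set_Suc_cases[OF that] .
  have nx: "l \<in> partitions n" "adds_box (last p) l" if "l \<in> nexts n s (last p)" for p l
    using that s by (auto simp: nexts_odd)
  have "equivariant_on n (tabloids n (last q)) tact (words n (Suc k)) map (specht_space n (last q)) (\<chi> q) \<and>
      \<chi> q ` specht_space n (last q) \<subseteq> free_space (words n (Suc k))" if q: "q \<in> path_set n (Suc s)" for q
  proof -
    obtain p l where p: "p \<in> path_set n s" and l: "l \<in> nexts n s (last p)" and qp: "q = p @ [l]"
      using decomp[OF q] by blast
    note a = n part[OF p] nx[OF l]
    have E: "equivariant_on (n - 1) (tabloids (n - 1) (last p)) tact (words n k) map (specht_space (n - 1) (last p)) (\<phi> p)"
      using F p by blast
    have inn: "down_map n l (last p) x \<in> specht_space (n - 1) (last p)" if "x \<in> specht_space n l" for x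
      using down_map_in[OF a] that by blast
    have "linear_on (specht_space n l) (\<psi> p l)"
      unfolding \<psi>_def[abs_def]
      by (rule linear_on_compose[of _ _ "specht_space (n - 1) (last p)"])
        (use down_map_equivariant[OF a] E inn in \<open>auto simp: equivariant_on_def\<close>)
    moreover have "\<psi> p l (tabloid_rep n l \<sigma> x) = push (words n k) (map \<sigma>) (\<psi> p l x)"
      if "\<sigma> permutes {1..n - 1}" "x \<in> specht_space n l" for \<sigma> x
      using down_map_equivariant[OF a] E inn[OF that(2)] that
      by (simp add: \<psi>_def equivariant_on_def)
    ultimately have "equivariant_on (n - 1) (tabloids n l) tact (words n k) map (specht_space n l) (\<psi> p l)"
      by (simp add: equivariant_on_def)
    then have "equivariant_on n (tabloids n l) tact (words n (Suc k)) map (specht_space n l) (\<chi> q)"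
      unfolding \<chi>_def qp using tab.induced_map_equivariant[OF n rep_specht_space specht_space_subset] by simp
    moreover have "\<chi> q x \<in> free_space (words n (Suc k))" for x
      by (simp add: \<chi>_def free_space_def induced_map_def)
    ultimately show ?thesis by (auto simp: qp)
  qed
  moreover have "jointly_inj (path_set n (Suc s)) (\<lambda>q. specht_space n (last q)) \<chi>"
    unfolding jointly_inj_def
  proof (intro allI impI ballI)
    fix x q
    assume x: "\<forall>q\<in>path_set n (Suc s). x q \<in> specht_space n (last q)"
      and z: "(\<Sum>q\<in>path_set n (Suc s). \<chi> q (x q)) = 0" and q: "q \<in> path_set n (Suc s)"
    have xin: "x (p @ [l]) \<in> specht_space n l" if "p \<in> path_set n s" "l \<in> nexts n s (last p)" for p l
      using x bij_betwE[OF path_set_Suc[of n s]] that by fastforce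
    define y where "y i p l = tabloid_rep n l (transpose i n) (x (p @ [l]))" for i p l
    have tp: "transpose i n permutes {1..n}" if "i \<in> {1..n}" for i
      using that n by (intro permutes_swap_id) auto
    have yin: "y i p l \<in> specht_space n l" if "p \<in> path_set n s" "l \<in> nexts n s (last p)" "i \<in> {1..n}" for i p l
      unfolding y_def by (rule rep_specht_space[OF tp[OF that(3)] xin[OF that(1,2)]])
    have din: "down_map n l (last p) (y i p l) \<in> specht_space (n - 1) (last p)"
      if "p \<in> path_set n s" "l \<in> nexts n s (last p)" "i \<in> {1..n}" for i p l
      using down_map_in[OF n part[OF that(1)] nx[OF that(2)] yin[OF that]] .
    define d where "d i p = (\<Sum>l\<in>nexts n s (last p). down_map n l (last p) (y i p l))" for i p
    have d0: "d i p = 0" if i: "i \<in> {1..n}" and p: "p \<in> path_set n s" for i p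
    proof -
      have phid: "\<phi> p (d i p) = (\<Sum>l\<in>nexts n s (last p). \<phi> p (down_map n l (last p) (y i p l)))" if p: "p \<in> path_set n s" for p
      proof -
        have "linear_on (specht_space (n - 1) (last p)) (\<phi> p)" using F p by (simp add: equivariant_on_def)
        then show ?thesis unfolding d_def
          by (rule linear_on_sum[OF cfun.subspace_span]) (rule din[OF p _ i])
      qed
      have din': "d i p \<in> specht_space (n - 1) (last p)" if "p \<in> path_set n s" for p
        unfolding d_def by (rule cfun.span_sum) (rule din[OF that _ i])
      have "(\<Sum>p\<in>path_set n s. \<phi> p (d i p)) w = 0" for w
      proof (cases "w \<in> words n k")
        case False
        have "\<phi> p (d i p) w = 0" if "p \<in> path_set n s" for p
        proof -
          have "\<phi> p (d i p) \<in> free_space (words n k)" using F that din'[OF that] by blast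
          then show ?thesis using False by (simp add: free_space_def)
        qed
        then show ?thesis by (simp add: sum_fun_apply)
      next
        case True
        \<comment> \<open>The transposition built into \<open>induced_map\<close> is undone in
          advance, so that the value at \<open>w'\<close> is that of the slice \<open>i\<close> at
          \<open>w\<close>.\<close>
        define w' where "w' = map (transpose i n) w @ [i]"
        have w': "w' \<in> words n (Suc k)"
          using words_map[OF tp[OF i] True] i by (simp add: w'_def words_snoc)
        have "map (transpose i n) (map (transpose i n) w) = w"
          by (simp add: o_def)
        then have chi: "\<chi> (p @ [l]) (x (p @ [l])) w' = \<phi> p (down_map n l (last p) (y i p l)) w" for p l
          using w' by (simp add: \<chi>_def induced_map_def w'_def \<psi>_def y_def del: map_map)
        have "(\<Sum>p\<in>path_set n s. \<phi> p (d i p)) w = (\<Sum>p\<in>path_set n s. \<Sum>l\<in>nexts n s (last p). \<phi> p (down_map n l (last p) (y i p l)) w)"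
          unfolding sum_fun_apply by (rule sum.cong) (simp_all add: phid sum_fun_apply)
        also have "\<dots> = (\<Sum>q\<in>path_set n (Suc s). \<chi> q (x q)) w'"
          unfolding sum_path_set_Suc[OF n] sum_fun_apply chi ..
        finally show ?thesis using z by simp
      qed
      then have "(\<Sum>p\<in>path_set n s. \<phi> p (d i p)) = 0" by (intro ext) simp
      moreover have "jointly_inj (path_set n s) (\<lambda>p. specht_space (n - 1) (last p)) \<phi>" using F by blast
      ultimately show ?thesis
        using jointly_injD[of "path_set n s" "\<lambda>p. specht_space (n - 1) (last p)" \<phi> "d i" p] din' p by blast
    qed
    obtain p l where p: "p \<in> path_set n s" and l: "l \<in> nexts n s (last p)" and qp: "q = p @ [l]"
      using decomp[OF q] by blast
    have "(\<lambda>l. x (p @ [l])) l = 0"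
    proof (rule specht_independent[where L = "nexts n s (last p)" and f = "\<lambda>l. down_map n l (last p)" and m = n])
      show "nexts n s (last p) \<subseteq> partitions n" using nx(1) by blast
      show "linear_on (specht_space n l) (down_map n l (last p))" if "l \<in> nexts n s (last p)" for l
        using down_map_equivariant[OF n part[OF p] nx[OF that]] by (simp add: equivariant_on_def)
      show "\<exists>v\<in>specht_space n l. down_map n l (last p) v \<noteq> 0" if "l \<in> nexts n s (last p)" for l
        using down_map_nonzero[OF n part[OF p] nx[OF that]] .
      show "(\<Sum>l\<in>nexts n s (last p). down_map n l (last p) (tabloid_rep n l \<sigma> (x (p @ [l])))) = 0"
        if sg: "\<sigma> permutes {1..n}" for \<sigma>
      proof -
        \<comment> \<open>With \<open>i\<close> the preimage of \<open>n\<close>,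
          \<open>\<sigma>\<close> is an element \<open>\<rho>\<close> of \<open>S_{n-1}\<close>
          times the transposition of \<open>i\<close> and \<open>n\<close>: these transpositions
          represent the cosets of \<open>S_{n-1}\<close>.\<close>
        define i where "i = inv' \<sigma> n"
        have i: "i \<in> {1..n}" "\<sigma> i = n"
          using n permutes_in_image[OF permutes_inv[OF sg]] permutes_inverses(1)[OF sg] by (auto simp: i_def)
        define \<rho> where "\<rho> = \<sigma> \<circ> transpose i n"
        have rn: "\<rho> permutes {1..n}" unfolding \<rho>_def by (rule permutes_compose[OF tp[OF i(1)] sg])
        have r: "\<rho> permutes {1..n - 1}" by (rule permutes_fixes_pred[OF rn]) (simp add: \<rho>_def i(2))
        have "\<sigma> = \<rho> \<circ> transpose i n" by (simp add: \<rho>_def fun_eq_iff)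
        then have "tabloid_rep n l \<sigma> (x (p @ [l])) = tabloid_rep n l \<rho> (y i p l)" for l
          unfolding y_def using tab.rep_comp[OF rn tp[OF i(1)]] by metis
        then have "down_map n l (last p) (tabloid_rep n l \<sigma> (x (p @ [l])))
            = tabloid_rep (n - 1) (last p) \<rho> (down_map n l (last p) (y i p l))" if "l \<in> nexts n s (last p)" for l
          using down_map_equivariant[OF n part[OF p] nx[OF that]] r yin[OF p that i(1)]
          by (simp add: equivariant_on_def)
        then have "(\<Sum>l\<in>nexts n s (last p). down_map n l (last p) (tabloid_rep n l \<sigma> (x (p @ [l]))))
            = tabloid_rep (n - 1) (last p) \<rho> (d i p)"
          by (simp add: d_def push_sum)
        then show ?thesis using d0[OF i(1) p] push_zero by simp
      qed
    qed (use l xin[OF p] in auto)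
    then show "x q = 0" by (simp add: qp)
  qed
  ultimately have "tensor_family n (Suc s) \<chi>" by (simp add: tensor_family_def lev half)
  then show ?thesis by blast
qed

lemma tensor_family_exists: "n > 0 \<Longrightarrow> \<exists>\<phi>. tensor_family n s \<phi>"
proof (induction s)
  case 0 then show ?case by (rule tensor_family_base)
next
  case (Suc s)
  then show ?case using tensor_family_half_step tensor_family_up_step by blast
qed

text \<open>The case of equality in \<open>jointly_inj_dim\<close>: the lower bounds
  \<open>num_std\<close> already sum to the dimension of tensor space.\<close>

lemma tensor_family_surj:
  assumes n: "n > 0" and fam: "tensor_family n s \<phi>" and w: "w \<in> free_space (words n (s div 2))"
  shows "\<exists>x. (\<forall>p\<in>path_set n s. x p \<in> specht_space (level_size n s) (last p)) \<and> (\<Sum>p\<in>path_set n s. \<phi> p (x p)) = w"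
proof (rule jointly_inj_dim(2))
  let ?S = "\<lambda>p. specht_space (level_size n s) (last p)" and ?N = "free_space (words n (s div 2))"
  show "jointly_inj (path_set n s) ?S \<phi>" using fam by (simp add: tensor_family_def)
  show "linear_on (?S p) (\<phi> p)" "\<phi> p ` ?S p \<subseteq> ?N" if "p \<in> path_set n s" for p
    using fam that by (auto simp: tensor_family_def equivariant_on_def)
  have "cfun.dim ?N = (\<Sum>p\<in>path_set n s. num_std (level_size n s) (last p))"
    by (simp add: dim_free_space card_words sum_num_std_path_set[OF n])
  also have "\<dots> \<le> (\<Sum>p\<in>path_set n s. cfun.dim (?S p))"
    by (rule sum_mono) (rule dim_specht_ge[OF path_set_last_partitions])
  finally show "cfun.dim ?N \<le> (\<Sum>p\<in>path_set n s. cfun.dim (?S p))" .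
  show "cfun.subspace (?S p)" "fin_dim (?S p)" for p by (rule cfun.subspace_span, rule fin_dim_specht_space)
qed (use n w in \<open>auto simp: fin_dim_free_space\<close>)

section \<open>Composition of partition diagrams\<close>

abbreviation two_rows :: "nat \<Rightarrow> vertex set" where
  "two_rows k \<equiv> Top ` {1..k} \<union> Bot ` {1..k}"

abbreviation three_rows :: "nat \<Rightarrow> vertex set" where
  "three_rows k \<equiv> Top ` {1..k} \<union> Mid ` {1..k} \<union> Bot ` {1..k}"

fun stack_label :: "nat list \<Rightarrow> nat list \<Rightarrow> nat list \<Rightarrow> vertex \<Rightarrow> nat" where
  "stack_label u v w (Top r) = u ! (r - 1)"
| "stack_label u v w (Mid r) = v ! (r - 1)"
| "stack_label u v w (Bot r) = w ! (r - 1)"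

definition constant_on_blocks :: "'a set set \<Rightarrow> ('a \<Rightarrow> 'b) \<Rightarrow> bool" where
  "constant_on_blocks P f \<longleftrightarrow> (\<forall>b\<in>P. \<forall>x\<in>b. \<forall>y\<in>b. f x = f y)"

lemma compatible_iff: "compatible d u w \<longleftrightarrow> constant_on_blocks d (vertex_label u w)"
  by (simp add: compatible_def constant_on_blocks_def)

lemma constant_on_image_blocks:
  assumes "\<And>b x. b \<in> P \<Longrightarrow> x \<in> b \<Longrightarrow> f (g x) = h x"
  shows "constant_on_blocks ((image g) ` P) f \<longleftrightarrow> constant_on_blocks P h"
proof -
  have "constant_on_blocks ((image g) ` P) f \<longleftrightarrow> (\<forall>b\<in>P. \<forall>x\<in>b. \<forall>y\<in>b. f (g x) = f (g y))"
    by (simp add: constant_on_blocks_def)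
  also have "\<dots> \<longleftrightarrow> constant_on_blocks P h"
    unfolding constant_on_blocks_def by (intro ball_cong refl) (simp add: assms)
  finally show ?thesis .
qed

lemma finite_diagrams [simp]: "finite (diagrams k)"
  unfolding diagrams_def by (rule finitely_many_partition_on) simp

lemma diagramsD: "d \<in> diagrams k \<Longrightarrow> partition_on (two_rows k) d"
  by (simp add: diagrams_def)

lemma words_nth: "u \<in> words n k \<Longrightarrow> i < k \<Longrightarrow> u ! i \<in> {1..n}"
  using nth_mem[of i u] unfolding words_def by blast

locale stacked =
  fixes k :: nat and d1 d2 :: "vertex set set"
  assumes d1: "d1 \<in> diagrams k" and d2: "d2 \<in> diagrams k"
begin

definition link :: "(vertex \<times> vertex) set" where
  "link = {(x, y). \<exists>b\<in>stacked_blocks d1 d2. x \<in> b \<and> y \<in> b}\<^sup>+"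

lemma Union_stacked_blocks: "\<Union>(stacked_blocks d1 d2) = three_rows k"
proof -
  have "\<Union>((image as_upper) ` d1) = as_upper ` two_rows k"
    using partition_onD1[OF diagramsD[OF d1]] by auto
  moreover have "\<Union>((image as_lower) ` d2) = as_lower ` two_rows k"
    using partition_onD1[OF diagramsD[OF d2]] by auto
  moreover have "as_upper ` two_rows k = Top ` {1..k} \<union> Mid ` {1..k}" "as_lower ` two_rows k = Mid ` {1..k} \<union> Bot ` {1..k}"
    by (simp_all add: image_Un image_image)
  ultimately show ?thesis unfolding stacked_blocks_def Union_Un_distrib by auto
qed

text \<open>The generating relation is symmetric, and it is reflexive on the three rows because the
  blocks cover them; its transitive closure is therefore an equivalence.\<close>

lemma equiv_link: "equiv (three_rows k) link"
proof (rule equivI)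
  let ?E = "{(x, y). \<exists>b\<in>stacked_blocks d1 d2. x \<in> b \<and> y \<in> b}"
  have "?E \<subseteq> three_rows k \<times> three_rows k" using Union_stacked_blocks by blast
  then show "link \<subseteq> three_rows k \<times> three_rows k" unfolding link_def by (rule trancl_subset_Sigma)
  have "(x, x) \<in> ?E" if "x \<in> three_rows k" for x using that Union_stacked_blocks by blast
  then show "refl_on (three_rows k) link" unfolding refl_on_def link_def by blast
  have "sym ?E" by (auto simp: sym_def)
  then show "sym link" unfolding link_def by (rule sym_trancl)
  show "trans link" unfolding link_def by (rule trans_trancl)
qed

lemma stack_components_eq: "stack_components d1 d2 = three_rows k // link"
  by (simp add: stack_components_def link_def Union_stacked_blocks)

lemma partition_components: "partition_on (three_rows k) (stack_components d1 d2)"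
  unfolding stack_components_eq by (rule partition_on_quotient[OF equiv_link])

lemma diagram_comp_in: "diagram_comp d1 d2 \<in> diagrams k"
proof -
  have "(- range Mid) \<inter> three_rows k = two_rows k" by auto
  moreover have "(\<lambda>C. C - range Mid) ` stack_components d1 d2 = (\<inter>) (- range Mid) ` stack_components d1 d2"
    by (rule image_cong) auto
  ultimately show ?thesis
    using partition_on_restrict[OF partition_components, of "- range Mid"]
    by (simp only: diagrams_def diagram_comp_def mem_Collect_eq)
qed

text \<open>Constancy propagates along chains of overlapping blocks, and any two members of a block
  are linked.\<close>

lemma constant_on_components:
  "constant_on_blocks (stacked_blocks d1 d2) f \<longleftrightarrow> constant_on_blocks (stack_components d1 d2) f"
proof
  assume c: "constant_on_blocks (stacked_blocks d1 d2) f"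
  have "f x = f y" if "(x, y) \<in> link" for x y
    using that unfolding link_def
  proof induction
    case (base y) then show ?case using c by (auto simp: constant_on_blocks_def)
  next
    case (step y z) then show ?case using c by (auto simp: constant_on_blocks_def)
  qed
  then show "constant_on_blocks (stack_components d1 d2) f"
    unfolding constant_on_blocks_def stack_components_eq
    using quotient_eq_iff[OF equiv_link] by metis
next
  assume c: "constant_on_blocks (stack_components d1 d2) f"
  show "constant_on_blocks (stacked_blocks d1 d2) f"
    unfolding constant_on_blocks_def
  proof (intro ballI)
    fix b x y assume b: "b \<in> stacked_blocks d1 d2" "x \<in> b" "y \<in> b"
    then have l: "(x, y) \<in> link" unfolding link_def by blast
    have x: "x \<in> three_rows k" using b Union_stacked_blocks by blast
    have "link `` {x} \<in> stack_components d1 d2" unfolding stack_components_eq by (rule quotientI[OF x])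
    moreover have "x \<in> link `` {x}" using equiv_class_self[OF equiv_link x] .
    ultimately show "f x = f y" using c l unfolding constant_on_blocks_def by blast
  qed
qed

text \<open>A middle word \<open>v\<close> matching both diagrams is a labelling of the stacked
  picture that is constant on its components; in this form such words can be counted.\<close>

lemma stack_label_compatible:
  "constant_on_blocks (stack_components d1 d2) (stack_label u v w) \<longleftrightarrow> compatible d1 u v \<and> compatible d2 v w"
proof -
  have up: "stack_label u v w (as_upper x) = vertex_label u v x" if "x \<in> two_rows k" for x
    using that by auto
  have low: "stack_label u v w (as_lower x) = vertex_label v w x" if "x \<in> two_rows k" for x
    using that by auto
  have sub: "x \<in> two_rows k" if "b \<in> d" "x \<in> b" "d \<in> diagrams k" for x b d
    using partition_onD1[OF diagramsD[OF that(3)]] that by blast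
  have "constant_on_blocks ((image as_upper) ` d1) (stack_label u v w) \<longleftrightarrow> compatible d1 u v"
    unfolding compatible_iff by (rule constant_on_image_blocks) (use up sub[OF _ _ d1] in blast)
  moreover have "constant_on_blocks ((image as_lower) ` d2) (stack_label u v w) \<longleftrightarrow> compatible d2 v w"
    unfolding compatible_iff by (rule constant_on_image_blocks) (use low sub[OF _ _ d2] in blast)
  moreover have "constant_on_blocks (stacked_blocks d1 d2) (stack_label u v w) \<longleftrightarrow>
      constant_on_blocks ((image as_upper) ` d1) (stack_label u v w) \<and> constant_on_blocks ((image as_lower) ` d2) (stack_label u v w)"
    unfolding stacked_blocks_def constant_on_blocks_def by (rule ball_Un)
  ultimately show ?thesis using constant_on_components by blast
qed

lemma outer_label: "x \<in> three_rows k - range Mid \<Longrightarrow> stack_label u v w x = vertex_label u w x"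
  by (cases x) auto

lemma component_subset: "C \<in> stack_components d1 d2 \<Longrightarrow> C \<subseteq> three_rows k"
  using partition_onD1[OF partition_components] by blast

lemma compatible_diagram_comp:
  "compatible (diagram_comp d1 d2) u w \<longleftrightarrow>
     (\<forall>C\<in>stack_components d1 d2. \<forall>x\<in>C - range Mid. \<forall>y\<in>C - range Mid. vertex_label u w x = vertex_label u w y)"
proof
  assume c: "compatible (diagram_comp d1 d2) u w"
  show "\<forall>C\<in>stack_components d1 d2. \<forall>x\<in>C - range Mid. \<forall>y\<in>C - range Mid. vertex_label u w x = vertex_label u w y"
  proof (intro ballI)
    fix C x y assume C: "C \<in> stack_components d1 d2" "x \<in> C - range Mid" "y \<in> C - range Mid"
    then have "C - range Mid \<in> diagram_comp d1 d2" unfolding diagram_comp_def by blast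
    then show "vertex_label u w x = vertex_label u w y" using c C unfolding compatible_def by blast
  qed
next
  assume c: "\<forall>C\<in>stack_components d1 d2. \<forall>x\<in>C - range Mid. \<forall>y\<in>C - range Mid. vertex_label u w x = vertex_label u w y"
  show "compatible (diagram_comp d1 d2) u w"
    unfolding compatible_def
  proof (intro ballI)
    fix b x y assume b: "b \<in> diagram_comp d1 d2" "x \<in> b" "y \<in> b"
    then obtain C where "C \<in> stack_components d1 d2" "b = C - range Mid" unfolding diagram_comp_def by blast
    then show "vertex_label u w x = vertex_label u w y" using c b by blast
  qed
qed

text \<open>The labels of the middle row are determined on the components that meet the top or bottom row and
  arbitrary on the others.\<close>

lemma count_middle_words:
  assumes u: "u \<in> words n k" and w: "w \<in> words n k"
  shows "card {v \<in> words n k. compatible d1 u v \<and> compatible d2 v w}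
       = (if compatible (diagram_comp d1 d2) u w then n ^ removed_components d1 d2 else 0)"
proof -
  define A where "A = {v \<in> words n k. constant_on_blocks (stack_components d1 d2) (stack_label u v w)}"
  define M where "M = {C \<in> stack_components d1 d2. C \<subseteq> range Mid}"
  have A: "{v \<in> words n k. compatible d1 u v \<and> compatible d2 v w} = A"
    by (simp add: A_def stack_label_compatible)
  show ?thesis
  proof (cases "compatible (diagram_comp d1 d2) u w")
    case False
    have "v \<notin> A" for v
    proof
      assume "v \<in> A"
      then have c: "\<And>C x y. C \<in> stack_components d1 d2 \<Longrightarrow> x \<in> C \<Longrightarrow> y \<in> C \<Longrightarrow> stack_label u v w x = stack_label u v w y"
        unfolding A_def constant_on_blocks_def by blast
      have "vertex_label u w x = vertex_label u w y"
        if "C \<in> stack_components d1 d2" "x \<in> C - range Mid" "y \<in> C - range Mid" for C x y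
      proof -
        have "x \<in> three_rows k - range Mid" "y \<in> three_rows k - range Mid"
          using that component_subset[OF that(1)] by blast+
        then show ?thesis using c[of C x y] that outer_label by simp
      qed
      then show False using False compatible_diagram_comp by blast
    qed
    then have "A = {}" by blast
    then show ?thesis using A False by simp
  next
    case True
    define cl where "cl x = link `` {x}" for x
    have cl: "cl x \<in> stack_components d1 d2" "x \<in> cl x" if "x \<in> three_rows k" for x
      using that quotientI[of x _ link] equiv_class_self[OF equiv_link] by (simp_all add: stack_components_eq cl_def)
    have cl_eq: "cl x = C" if C: "C \<in> stack_components d1 d2" and x: "x \<in> C" for C x
    proof -
      have "x \<in> three_rows k" using component_subset[OF C] x by blast
      then show ?thesis
        using partition_onD2[OF partition_components] cl[of x] C x unfolding disjoint_def by blast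
    qed
    have outer: "vertex_label u w x \<in> {1..n}" if "x \<in> three_rows k - range Mid" for x
    proof -
      have "u ! (r - 1) \<in> {1..n}" "w ! (r - 1) \<in> {1..n}" if "r \<in> {1..k}" for r
        using words_nth[OF u, of "r - 1"] words_nth[OF w, of "r - 1"] that by auto
      then show ?thesis using that by auto
    qed
    \<comment> \<open>\<open>L g\<close> is the labelling of all three rows determined by a choice
      \<open>g\<close> of labels for the removed components; every other component takes the label
      of one of its outer vertices. \<open>F\<close> reads off the free labels of a middle word and
      \<open>G\<close> the middle row of \<open>L g\<close>; they are inverse to each other.\<close>
    define L where "L g x = (if cl x \<in> M then g (cl x) else vertex_label u w (SOME y. y \<in> cl x - range Mid))" for g x
    define F where "F v = (\<lambda>C\<in>M. stack_label u v w (SOME x. x \<in> C))" for v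
    define G where "G g = map (\<lambda>r. L g (Mid r)) [1..<Suc k]" for g
    have some: "(SOME y. y \<in> cl x - range Mid) \<in> cl x - range Mid" if "x \<in> three_rows k" "cl x \<notin> M" for x
    proof -
      have "cl x - range Mid \<noteq> {}" using cl(1)[OF that(1)] that(2) by (auto simp: M_def)
      then show ?thesis by (metis (no_types, lifting) ex_in_conv someI_ex)
    qed
    have Lout: "L g x = vertex_label u w x" if "x \<in> three_rows k - range Mid" for g x
    proof -
      have "cl x \<notin> M" using cl(2) that by (auto simp: M_def)
      moreover have "x \<in> cl x - range Mid" using that cl(2) by blast
      moreover have "x \<in> three_rows k" using that by blast
      ultimately have "vertex_label u w (SOME y. y \<in> cl x - range Mid) = vertex_label u w x"
        using some[of x] cl(1)[of x] True unfolding compatible_diagram_comp by blast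
      then show ?thesis using \<open>cl x \<notin> M\<close> by (simp add: L_def)
    qed
    have GL: "stack_label u (G g) w x = L g x" if x: "x \<in> three_rows k" for g x
    proof (cases "x \<in> range Mid")
      case True
      then obtain r where "x = Mid r" "r \<in> {1..k}" using x by auto
      moreover have "r - 1 < length [1..<Suc k]" "1 + (r - 1) = r" using calculation(2) by auto
      ultimately show ?thesis by (simp add: G_def nth_upt del: upt_Suc)
    next
      case False
      then show ?thesis using Lout outer_label x by simp
    qed
    have LF: "L (F v) x = stack_label u v w x" if v: "v \<in> A" and x: "x \<in> three_rows k" for v x
    proof -
      have const: "stack_label u v w y = stack_label u v w x" if "y \<in> cl x" for y
        using v cl[OF x] that unfolding A_def constant_on_blocks_def by blast
      show ?thesis
      proof (cases "cl x \<in> M")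
        case True
        have "(SOME y. y \<in> cl x) \<in> cl x" using cl(2)[OF x] by (rule someI)
        then show ?thesis using True const by (simp add: L_def F_def)
      next
        case False
        note s = some[OF x False]
        have "(SOME y. y \<in> cl x - range Mid) \<in> three_rows k - range Mid"
          using s component_subset[OF cl(1)[OF x]] by blast
        then have "vertex_label u w (SOME y. y \<in> cl x - range Mid) = stack_label u v w (SOME y. y \<in> cl x - range Mid)"
          by (rule outer_label[symmetric])
        also have "\<dots> = stack_label u v w x" using const s by blast
        finally show ?thesis using False by (simp only: L_def if_False)
      qed
    qed
    have Grange: "G g \<in> words n k" if g: "g \<in> M \<rightarrow>\<^sub>E {1..n}" for g
    proof -
      have "L g x \<in> {1..n}" if x: "x \<in> three_rows k" for x
      proof (cases "cl x \<in> M")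
        case True then show ?thesis using g by (auto simp: L_def)
      next
        case False
        have "(SOME y. y \<in> cl x - range Mid) \<in> three_rows k - range Mid"
          using some[OF x False] component_subset[OF cl(1)[OF x]] by blast
        then show ?thesis using outer False by (simp add: L_def)
      qed
      then have "L g (Mid r) \<in> {1..n}" if "r \<in> {1..k}" for r using that by blast
      then show ?thesis by (auto simp: words_def G_def simp del: upt_Suc)
    qed
    have Gconst: "constant_on_blocks (stack_components d1 d2) (stack_label u (G g) w)" for g
      unfolding constant_on_blocks_def
    proof (intro ballI)
      fix C x y assume C: "C \<in> stack_components d1 d2" "x \<in> C" "y \<in> C"
      then have "L g x = L g y" using cl_eq[OF C(1,2)] cl_eq[OF C(1,3)] by (simp add: L_def)
      moreover have "x \<in> three_rows k" "y \<in> three_rows k" using component_subset[OF C(1)] C by blast+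
      ultimately show "stack_label u (G g) w x = stack_label u (G g) w y"
        by (simp only: GL)
    qed
    have ne: "(SOME x. x \<in> C) \<in> C" if "C \<in> M" for C
    proof -
      have "C \<noteq> {}" using that partition_onD3[OF partition_components] by (auto simp: M_def)
      then show ?thesis by (metis ex_in_conv someI_ex)
    qed
    have "bij_betw F A (M \<rightarrow>\<^sub>E {1..n})"
    proof (rule bij_betw_byWitness[where f' = G])
      show "\<forall>v\<in>A. G (F v) = v"
      proof
        fix v assume v: "v \<in> A"
        then have len: "length v = k" by (simp add: A_def words_def)
        show "G (F v) = v"
        proof (rule nth_equalityI)
          fix i assume "i < length (G (F v))"
          then have i: "i < k" by (simp add: G_def del: upt_Suc)
          then have "G (F v) ! i = L (F v) (Mid (Suc i))"
            by (simp add: G_def nth_upt plus_1_eq_Suc del: upt_Suc)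
          also have "\<dots> = stack_label u v w (Mid (Suc i))" by (rule LF[OF v]) (use i in auto)
          finally show "G (F v) ! i = v ! i" by simp
        qed (simp add: len G_def del: upt_Suc)
      qed
      show "\<forall>g\<in>M \<rightarrow>\<^sub>E {1..n}. F (G g) = g"
      proof
        fix g assume g: "g \<in> M \<rightarrow>\<^sub>E {1..n}"
        show "F (G g) = g"
        proof
          fix C show "F (G g) C = g C"
          proof (cases "C \<in> M")
            case True
            then have C: "C \<in> stack_components d1 d2" by (simp add: M_def)
            have "stack_label u (G g) w (SOME x. x \<in> C) = L g (SOME x. x \<in> C)"
              by (rule GL) (rule subsetD[OF component_subset[OF C] ne[OF True]])
            also have "\<dots> = g C" using cl_eq[OF C ne[OF True]] True by (simp add: L_def)
            finally show ?thesis using True by (simp add: F_def)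
          next
            case False
            then show ?thesis using g by (auto simp: F_def PiE_def extensional_def)
          qed
        qed
      qed
      show "F ` A \<subseteq> M \<rightarrow>\<^sub>E {1..n}"
      proof (clarsimp simp del: atLeastAtMost_iff)
        fix v assume v: "v \<in> A"
        have "stack_label u v w (SOME x. x \<in> C) \<in> {1..n}" if "C \<in> M" for C
        proof -
          have "(SOME x. x \<in> C) \<in> Mid ` {1..k}"
          proof -
            have "C \<subseteq> Mid ` {1..k}"
            proof
              fix x assume "x \<in> C"
              then have "x \<in> three_rows k" "x \<in> range Mid" using that component_subset[of C] by (auto simp: M_def)
              then show "x \<in> Mid ` {1..k}" by blast
            qed
            then show ?thesis using ne[OF that] by blast
          qed
          then obtain r where "(SOME x. x \<in> C) = Mid r" "r \<in> {1..k}" by blast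
          moreover have "v ! (r - 1) \<in> {1..n}" if "r \<in> {1..k}" for r
            using words_nth[of v n k "r - 1"] v that by (auto simp: A_def)
          ultimately show ?thesis by simp
        qed
        then show "F v \<in> M \<rightarrow>\<^sub>E {1..n}" by (simp only: F_def restrict_PiE_iff) blast
      qed
      show "G ` (M \<rightarrow>\<^sub>E {1..n}) \<subseteq> A" using Grange Gconst by (auto simp: A_def)
    qed
    then have "card A = card (M \<rightarrow>\<^sub>E {1..n})" by (rule bij_betw_same_card)
    moreover have "finite M"
      using finite_elements[OF _ partition_components] by (simp add: M_def)
    ultimately have "card A = n ^ card M" by (simp add: card_PiE)
    then show ?thesis using A True by (simp add: removed_components_def M_def)
  qed
qed

lemma same_component_comp:
  assumes "C \<in> stack_components d1 d2" "x \<in> C" "y \<in> C" "x \<notin> range Mid" "y \<notin> range Mid"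
  shows "\<exists>b\<in>diagram_comp d1 d2. x \<in> b \<and> y \<in> b"
  using assms unfolding diagram_comp_def by (intro bexI[of _ "C - range Mid"]) auto

end

text \<open>Each factor ties its outer vertex \<open>k + 1\<close> to the same middle vertex, so the
  top and the bottom vertex \<open>k + 1\<close> lie in one component.\<close>

lemma half_diagram_comp_in:
  assumes d1: "d1 \<in> half_diagrams k" and d2: "d2 \<in> half_diagrams k"
  shows "diagram_comp d1 d2 \<in> half_diagrams k"
proof -
  interpret stacked "k + 1" d1 d2
    using assms by unfold_locales (auto simp: half_diagrams_def)
  let ?t = "Top (k + 1)" and ?b = "Bot (k + 1)" and ?m = "Mid (k + 1)"
  obtain b1 where b1: "b1 \<in> d1" "?t \<in> b1" "?b \<in> b1" using assms(1) by (auto simp: half_diagrams_def)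
  obtain b2 where b2: "b2 \<in> d2" "?t \<in> b2" "?b \<in> b2" using assms(2) by (auto simp: half_diagrams_def)
  have "as_upper ` b1 \<in> stacked_blocks d1 d2" "?t \<in> as_upper ` b1" "?m \<in> as_upper ` b1"
    using b1 image_eqI[of ?t as_upper ?t b1] image_eqI[of ?m as_upper ?b b1] by (auto simp: stacked_blocks_def)
  then have l1: "(?t, ?m) \<in> link" unfolding link_def by blast
  have "as_lower ` b2 \<in> stacked_blocks d1 d2" "?m \<in> as_lower ` b2" "?b \<in> as_lower ` b2"
    using b2 image_eqI[of ?m as_lower ?t b2] image_eqI[of ?b as_lower ?b b2] by (auto simp: stacked_blocks_def)
  then have l2: "(?m, ?b) \<in> link" unfolding link_def by blast
  have "?t \<in> three_rows (k + 1)" by auto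
  then have "link `` {?t} \<in> stack_components d1 d2" "?t \<in> link `` {?t}"
    using quotientI[of ?t _ link] equiv_class_self[OF equiv_link] by (auto simp: stack_components_eq)
  moreover have "?b \<in> link `` {?t}" using l1 l2 unfolding link_def by (auto intro: trancl_trans)
  ultimately have "\<exists>b\<in>diagram_comp d1 d2. ?t \<in> b \<and> ?b \<in> b"
    by (rule same_component_comp) auto
  then show ?thesis using diagram_comp_in by (simp add: half_diagrams_def)
qed

lemma identity_diagram_in: "identity_diagram k \<in> diagrams k"
  unfolding diagrams_def identity_diagram_def mem_Collect_eq
  by (rule partition_onI) (auto simp: disjnt_def)

lemma identity_half_diagram_in: "identity_diagram (k + 1) \<in> half_diagrams k"
  using identity_diagram_in[of "k + 1"] unfolding half_diagrams_def identity_diagram_def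
  by (auto intro!: bexI[of _ "k + 1"])

lemma compatible_identity:
  assumes "u \<in> words n k" "w \<in> words n k"
  shows "compatible (identity_diagram k) u w \<longleftrightarrow> u = w"
proof
  assume c: "compatible (identity_diagram k) u w"
  show "u = w"
  proof (rule nth_equalityI)
    show "length u = length w" using assms by (simp add: words_def)
    fix i assume "i < length u"
    then have "{Top (Suc i), Bot (Suc i)} \<in> identity_diagram k"
      using assms by (auto simp: words_def identity_diagram_def)
    from bspec[OF c[unfolded compatible_def] this]
    have "vertex_label u w (Top (Suc i)) = vertex_label u w (Bot (Suc i))" by blast
    then show "u ! i = w ! i" by simp
  qed
qed (auto simp: compatible_def identity_diagram_def)

section \<open>Orbit matrices\<close>

text \<open>The coarsest diagram compatible with \<open>u\<close> and \<open>w\<close>. These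
  partitions distinguish the orbits of the symmetric group on pairs of words
  (\<open>kernel_partition_orbit\<close>).\<close>

definition kernel_partition :: "nat \<Rightarrow> nat list \<Rightarrow> nat list \<Rightarrow> vertex set set" where
  "kernel_partition k u w = (\<lambda>x. {y \<in> two_rows k. vertex_label u w y = vertex_label u w x}) ` two_rows k"

lemma kernel_partition_in: "kernel_partition k u w \<in> diagrams k"
  unfolding diagrams_def kernel_partition_def mem_Collect_eq
proof (rule partition_onI)
  let ?c = "\<lambda>x. {y \<in> two_rows k. vertex_label u w y = vertex_label u w x}"
  show "\<Union>(?c ` two_rows k) = two_rows k" by blast
  show "disjnt p q" if pq: "p \<in> ?c ` two_rows k" "q \<in> ?c ` two_rows k" "p \<noteq> q" for p q
  proof (rule ccontr)
    assume nd: "\<not> disjnt p q"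
    obtain x where x: "p = ?c x" using pq(1) by blast
    obtain y where y: "q = ?c y" using pq(2) by blast
    obtain z where "z \<in> p" "z \<in> q" using nd unfolding disjnt_def by blast
    then have "vertex_label u w x = vertex_label u w y" using x y by simp
    then show False using pq(3) x y by simp
  qed
  show "{} \<notin> ?c ` two_rows k" by blast
qed

lemma compatible_iff_refines:
  assumes d: "d \<in> diagrams k"
  shows "compatible d u w \<longleftrightarrow> refines (two_rows k) d (kernel_partition k u w)"
proof
  assume c: "compatible d u w"
  have "\<exists>Y\<in>kernel_partition k u w. X \<subseteq> Y" if X: "X \<in> d" for X
  proof -
    have sub: "X \<subseteq> two_rows k" using partition_onD1[OF diagramsD[OF d]] X by blast
    obtain x where x: "x \<in> X" using partition_onD3[OF diagramsD[OF d]] X by (metis ex_in_conv)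
    have "X \<subseteq> {y \<in> two_rows k. vertex_label u w y = vertex_label u w x}"
      using c X x sub unfolding compatible_def by blast
    moreover have "{y \<in> two_rows k. vertex_label u w y = vertex_label u w x} \<in> kernel_partition k u w"
      unfolding kernel_partition_def by (rule imageI) (use x sub in blast)
    ultimately show ?thesis by (intro bexI)
  qed
  then show "refines (two_rows k) d (kernel_partition k u w)"
    using diagramsD[OF d] diagramsD[OF kernel_partition_in] by (simp add: refines_def)
next
  assume r: "refines (two_rows k) d (kernel_partition k u w)"
  show "compatible d u w"
    unfolding compatible_def
  proof (intro ballI)
    fix b x y assume b: "b \<in> d" "x \<in> b" "y \<in> b"
    then obtain Y where "Y \<in> kernel_partition k u w" "b \<subseteq> Y" using r unfolding refines_def by blast
    then obtain z where "b \<subseteq> {y \<in> two_rows k. vertex_label u w y = vertex_label u w z}"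
      unfolding kernel_partition_def by blast
    then have "vertex_label u w x = vertex_label u w z" "vertex_label u w y = vertex_label u w z" using b by blast+
    then show "vertex_label u w x = vertex_label u w y" by simp
  qed
qed

text \<open>Moebius inversion, by removing a maximal element.\<close>

lemma order_sum_inversion:
  fixes c :: "'d \<Rightarrow> complex" and below :: "'d \<Rightarrow> 'd \<Rightarrow> bool"
  assumes "finite D"
    and "\<And>x. x \<in> D \<Longrightarrow> below x x"
    and "\<And>x y. x \<in> D \<Longrightarrow> y \<in> D \<Longrightarrow> below x y \<Longrightarrow> below y x \<Longrightarrow> x = y"
    and "\<And>x y z. x \<in> D \<Longrightarrow> y \<in> D \<Longrightarrow> z \<in> D \<Longrightarrow> below x y \<Longrightarrow> below y z \<Longrightarrow> below x z"
  shows "\<exists>a. (\<forall>x. x \<notin> D \<longrightarrow> a x = 0) \<and> (\<forall>p\<in>D. c p = (\<Sum>d\<in>D. if below d p then a d else 0))"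
  using assms
proof (induction "card D" arbitrary: D)
  case 0
  then have "D = {}" using card_0_eq by metis
  then show ?case by (intro exI[of _ "\<lambda>_. 0"]) blast
next
  case (Suc m)
  define R where "R x y \<longleftrightarrow> x \<noteq> y \<and> below y x" for x y
  have "asymp_on D R" by (rule asymp_onI) (use Suc.prems(3) in \<open>auto simp: R_def\<close>)
  moreover have "transp_on D R"
  proof (rule transp_onI)
    fix x y z assume xyz: "x \<in> D" "y \<in> D" "z \<in> D" "R x y" "R y z"
    then have "below z x" using Suc.prems(4)[of z y x] by (auto simp: R_def)
    moreover have "x \<noteq> z" using xyz Suc.prems(3)[of x y] by (auto simp: R_def)
    ultimately show "R x z" by (auto simp: R_def)
  qed
  moreover have "D \<noteq> {}" using Suc.hyps(2) by auto
  ultimately obtain p0 where p0: "p0 \<in> D" "\<And>x. x \<in> D \<Longrightarrow> x \<noteq> p0 \<Longrightarrow> \<not> R x p0"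
    using Finite_Set.bex_min_element[OF Suc.prems(1)] by metis
  have "m = card (D - {p0})" using Suc.hyps(2) p0(1) Suc.prems(1) by simp
  then have "\<exists>a. (\<forall>x. x \<notin> D - {p0} \<longrightarrow> a x = 0) \<and>
      (\<forall>p\<in>D - {p0}. c p = (\<Sum>d\<in>D - {p0}. if below d p then a d else 0))"
    by (rule Suc.hyps(1)) (erule DiffE | rule finite_Diff | fact Suc.prems | (rule Suc.prems; assumption))+
  then obtain a where a: "\<And>x. x \<notin> D - {p0} \<Longrightarrow> a x = 0"
      "\<And>p. p \<in> D - {p0} \<Longrightarrow> c p = (\<Sum>d\<in>D - {p0}. if below d p then a d else 0)" by blast
  \<comment> \<open>\<open>p0\<close> lies below no other element, so its coefficient enters the
    equation at \<open>p0\<close> only and is solved for last.\<close>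
  define e where "e = a(p0 := c p0 - (\<Sum>d\<in>D - {p0}. if below d p0 then a d else 0))"
  have eq: "(\<Sum>d\<in>D. if below d p then e d else 0) = (if below p0 p then e p0 else 0) + (\<Sum>d\<in>D - {p0}. if below d p then a d else 0)" for p
  proof -
    have "(\<Sum>d\<in>D - {p0}. if below d p then e d else 0) = (\<Sum>d\<in>D - {p0}. if below d p then a d else 0)"
      by (rule sum.cong) (auto simp: e_def)
    then show ?thesis using sum.remove[OF Suc.prems(1) p0(1), of "\<lambda>d. if below d p then e d else 0"] by simp
  qed
  have "c p = (\<Sum>d\<in>D. if below d p then e d else 0)" if p: "p \<in> D" for p
  proof (cases "p = p0")
    case True
    then show ?thesis using eq[of p0] Suc.prems(2)[OF p0(1)] by (simp add: e_def)
  next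
    case False
    then have "\<not> below p0 p" using p0(2)[OF p] by (auto simp: R_def)
    then show ?thesis using eq[of p] a(2)[of p] p False by simp
  qed
  moreover have "e x = 0" if "x \<notin> D" for x using a(1)[of x] that p0(1) by (auto simp: e_def)
  ultimately show ?case by blast
qed

text \<open>By \<open>compatible_iff_refines\<close> the sum at a pair of words runs over the
  diagrams that refine its kernel, so inversion on the refinement order finds the coefficients. The
  sets \<open>D\<close> and \<open>Z\<close> are kept general so that the half-integer algebra, with
  words ending in \<open>n\<close>, is covered.\<close>

lemma kernel_expansion:
  fixes t :: "nat list \<Rightarrow> nat list \<Rightarrow> complex"
  assumes D: "D \<subseteq> diagrams k" and Z: "\<And>u w. (u, w) \<in> Z \<Longrightarrow> kernel_partition k u w \<in> D"
    and t: "\<And>u w u' w'. (u, w) \<in> Z \<Longrightarrow> (u', w') \<in> Z \<Longrightarrow> kernel_partition k u w = kernel_partition k u' w' \<Longrightarrow> t u w = t u' w'"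
  shows "\<exists>a\<in>free_space D. \<forall>(u, w)\<in>Z. t u w = (\<Sum>d\<in>D. if compatible d u w then a d else 0)"
proof -
  \<comment> \<open>A diagram in \<open>D\<close> need not be the kernel of any pair in
    \<open>Z\<close>; the value prescribed there is arbitrary and does no harm.\<close>
  define c where "c p = (let z = (SOME z. z \<in> Z \<and> kernel_partition k (fst z) (snd z) = p) in t (fst z) (snd z))" for p
  have c: "c (kernel_partition k u w) = t u w" if uw: "(u, w) \<in> Z" for u w
  proof -
    define z where "z = (SOME z. z \<in> Z \<and> kernel_partition k (fst z) (snd z) = kernel_partition k u w)"
    have "z \<in> Z \<and> kernel_partition k (fst z) (snd z) = kernel_partition k u w"
      unfolding z_def by (rule someI[of _ "(u, w)"]) (use uw in simp)
    then have "t (fst z) (snd z) = t u w" using t[of "fst z" "snd z" u w] uw by simp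
    then show ?thesis by (simp add: c_def z_def[symmetric])
  qed
  have "finite D" using D finite_subset finite_diagrams by blast
  moreover have "refines (two_rows k) x x" if "x \<in> D" for x
    using refines_refl diagramsD D that by blast
  ultimately have "\<exists>a. (\<forall>x. x \<notin> D \<longrightarrow> a x = 0) \<and> (\<forall>p\<in>D. c p = (\<Sum>d\<in>D. if refines (two_rows k) d p then a d else 0))"
    by (rule order_sum_inversion[OF _ _ refines_asym refines_trans])
  then obtain a where a: "\<forall>x. x \<notin> D \<longrightarrow> a x = 0"
      "\<forall>p\<in>D. c p = (\<Sum>d\<in>D. if refines (two_rows k) d p then a d else 0)" by blast
  have "t u w = (\<Sum>d\<in>D. if compatible d u w then a d else 0)" if uw: "(u, w) \<in> Z" for u w
  proof -
    have "t u w = (\<Sum>d\<in>D. if refines (two_rows k) d (kernel_partition k u w) then a d else 0)"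
      using a(2) Z[OF uw] c[OF uw] by auto
    also have "\<dots> = (\<Sum>d\<in>D. if compatible d u w then a d else 0)"
      by (rule sum.cong) (use compatible_iff_refines D in auto)
    finally show ?thesis .
  qed
  then show ?thesis using a(1) by (intro bexI[of _ a]) (auto simp: free_space_def)
qed

text \<open>The assignment of \<open>g x\<close> to \<open>f x\<close> is a well-defined bijection
  between the two sets of values, and their complements in \<open>{1..n}\<close> have equal
  size.\<close>

lemma extend_to_permutation:
  assumes V: "f ` V \<subseteq> {1..n}" "g ` V \<subseteq> {1..n::nat}" and eq: "\<And>x y. x \<in> V \<Longrightarrow> y \<in> V \<Longrightarrow> f x = f y \<longleftrightarrow> g x = g y"
  shows "\<exists>\<sigma>. \<sigma> permutes {1..n} \<and> (\<forall>x\<in>V. \<sigma> (f x) = g x)"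
proof -
  define h where "h a = g (SOME x. x \<in> V \<and> f x = a)" for a
  have h: "h (f x) = g x" if x: "x \<in> V" for x
  proof -
    have "(SOME y. y \<in> V \<and> f y = f x) \<in> V \<and> f (SOME y. y \<in> V \<and> f y = f x) = f x"
      by (rule someI[of _ x]) (use x in simp)
    then show ?thesis using eq x unfolding h_def by blast
  qed
  have bh: "bij_betw h (f ` V) (g ` V)"
    unfolding bij_betw_def inj_on_def using h eq by (auto simp: image_image)
  have fin: "finite (f ` V)" "finite (g ` V)" using V finite_subset by blast+
  have "card ({1..n} - f ` V) = card ({1..n} - g ` V)"
    using V fin bij_betw_same_card[OF bh] by (simp add: card_Diff_subset)
  then obtain h' where bh': "bij_betw h' ({1..n} - f ` V) ({1..n} - g ` V)"
    using finite_same_card_bij[of "{1..n} - f ` V" "{1..n} - g ` V"] by auto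
  define \<sigma> where "\<sigma> a = (if a \<in> f ` V then h a else if a \<in> {1..n} then h' a else a)" for a
  have "bij_betw \<sigma> (f ` V) (g ` V)"
    using bh by (rule bij_betw_cong[THEN iffD1, rotated]) (simp add: \<sigma>_def)
  moreover have "bij_betw \<sigma> ({1..n} - f ` V) ({1..n} - g ` V)"
    using bh' by (rule bij_betw_cong[THEN iffD1, rotated]) (simp add: \<sigma>_def)
  ultimately have "bij_betw \<sigma> (f ` V \<union> ({1..n} - f ` V)) (g ` V \<union> ({1..n} - g ` V))"
    by (rule bij_betw_combine) auto
  moreover have "f ` V \<union> ({1..n} - f ` V) = {1..n}" "g ` V \<union> ({1..n} - g ` V) = {1..n}" using V by auto
  ultimately have "bij_betw \<sigma> {1..n} {1..n}" by simp
  then have "\<sigma> permutes {1..n}"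
    by (rule bij_imp_permutes) (use V in \<open>auto simp: \<sigma>_def\<close>)
  moreover have "\<sigma> (f x) = g x" if "x \<in> V" for x using h[OF that] that by (simp add: \<sigma>_def)
  ultimately show ?thesis by blast
qed

lemma kernel_partition_eqD:
  assumes e: "kernel_partition k u w = kernel_partition k u' w'" and x: "x \<in> two_rows k" and y: "y \<in> two_rows k"
  shows "vertex_label u w x = vertex_label u w y \<longleftrightarrow> vertex_label u' w' x = vertex_label u' w' y"
proof -
  have mem: "vertex_label u w x = vertex_label u w y \<longleftrightarrow> (\<exists>b\<in>kernel_partition k u w. x \<in> b \<and> y \<in> b)" for u w
    using x y unfolding kernel_partition_def by auto
  show ?thesis unfolding mem[of u w] mem[of u' w'] e ..
qed

text \<open>With equal kernels the two labellings differ by a bijection of the letters in use, which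
  extends to a permutation of all letters.\<close>

lemma kernel_partition_orbit:
  assumes uw: "u \<in> words n k" "w \<in> words n k" "u' \<in> words n k" "w' \<in> words n k"
    and e: "kernel_partition k u w = kernel_partition k u' w'"
  shows "\<exists>\<sigma>. \<sigma> permutes {1..n} \<and> map \<sigma> u = u' \<and> map \<sigma> w = w'"
proof -
  have r: "vertex_label u w ` two_rows k \<subseteq> {1..n}" if "u \<in> words n k" "w \<in> words n k" for u w
    using words_nth[OF that(1)] words_nth[OF that(2)] by (auto simp: image_image)
  obtain \<sigma> where s: "\<sigma> permutes {1..n}" "\<And>x. x \<in> two_rows k \<Longrightarrow> \<sigma> (vertex_label u w x) = vertex_label u' w' x"
    using extend_to_permutation[OF r[OF uw(1,2)] r[OF uw(3,4)] kernel_partition_eqD[OF e]] by metis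
  have len: "length u = k" "length w = k" "length u' = k" "length w' = k" using uw by (auto simp: words_def)
  have "map \<sigma> u = u'"
  proof (rule nth_equalityI)
    fix i assume "i < length (map \<sigma> u)"
    then show "map \<sigma> u ! i = u' ! i" using s(2)[of "Top (Suc i)"] len by auto
  qed (simp add: len)
  moreover have "map \<sigma> w = w'"
  proof (rule nth_equalityI)
    fix i assume "i < length (map \<sigma> w)"
    then show "map \<sigma> w ! i = w' ! i" using s(2)[of "Bot (Suc i)"] len by auto
  qed (simp add: len)
  ultimately show ?thesis using s(1) by blast
qed

lemma compatible_map:
  assumes "\<sigma> permutes {1..n}" "d \<in> diagrams k" "length u = k" "length w = k"
  shows "compatible d (map \<sigma> u) (map \<sigma> w) \<longleftrightarrow> compatible d u w"
proof -
  have "vertex_label (map \<sigma> u) (map \<sigma> w) x = \<sigma> (vertex_label u w x)" if "x \<in> two_rows k" for x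
    using that assms(3,4) by auto
  moreover have "x \<in> two_rows k" if "b \<in> d" "x \<in> b" for b x
    using partition_onD1[OF diagramsD[OF assms(2)]] that by blast
  ultimately have "vertex_label (map \<sigma> u) (map \<sigma> w) x = \<sigma> (vertex_label u w x)" if "b \<in> d" "x \<in> b" for b x
    using that by blast
  then show ?thesis
    unfolding compatible_def by (simp add: inj_eq[OF permutes_inj[OF assms(1)]])
qed

section \<open>Transfer of module structures\<close>

definition algebra_closed :: "(complex, 'a) module \<Rightarrow> bool" where
  "algebra_closed R \<longleftrightarrow> one R \<in> carrier R \<and>
     (\<forall>a\<in>carrier R. \<forall>b\<in>carrier R. add R a b \<in> carrier R \<and> monoid.mult R a b \<in> carrier R) \<and>
     (\<forall>c. \<forall>a\<in>carrier R. smult R c a \<in> carrier R)"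

lemma (in based_action) algebra_closed_alg: "algebra_closed alg"
proof -
  have "carrier alg = free_space B" by (simp add: based_algebra_def)
  moreover have "one alg = basis_vec e" by (simp add: based_algebra_def)
  moreover have "add alg a b = a + b" "smult alg c a = fscale c a" for a b c by (simp_all add: based_algebra_def)
  ultimately show ?thesis
    unfolding algebra_closed_def
    using mult_in unit_in cfun.subspace_add[OF subspace_free_space] cfun.subspace_scale[OF subspace_free_space]
    by (simp only: basis_vec_in_free_space) blast
qed

text \<open>The module axioms are equations, so they are inherited along an injective linear map
  that intertwines the actions; on \<open>N\<close> itself only closure has to be checked.\<close>

locale module_embedding =
  fixes R :: "(complex, 'a) module" and M :: "('a, 'x) amod" and N :: "('a, 'y) amod"
    and J :: "('y \<Rightarrow> complex) \<Rightarrow> 'x \<Rightarrow> complex"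
  assumes R: "algebra_closed R" and N: "cfun.subspace (mspace N)"
    and act_in: "\<And>a f. a \<in> carrier R \<Longrightarrow> f \<in> mspace N \<Longrightarrow> mact N a f \<in> mspace N"
    and J_linear: "linear_on (mspace N) J" and J_in: "\<And>f. f \<in> mspace N \<Longrightarrow> J f \<in> mspace M"
    and J_inj: "\<And>f. f \<in> mspace N \<Longrightarrow> J f = 0 \<Longrightarrow> f = 0"
    and J_act: "\<And>a f. a \<in> carrier R \<Longrightarrow> f \<in> mspace N \<Longrightarrow> J (mact N a f) = mact M a (J f)"
begin

lemma J_eqD: "f \<in> mspace N \<Longrightarrow> g \<in> mspace N \<Longrightarrow> J f = J g \<Longrightarrow> f = g"
  using J_inj[OF cfun.subspace_diff[OF N, of f g]] linear_on_diff[OF N J_linear, of f g] by simp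

lemma bilinear_transfer:
  assumes M: "bilinear_action R M" shows "bilinear_action R N"
proof -
  note NN = cfun.subspace_add[OF N] cfun.subspace_scale[OF N]
  note lin = linear_on_add[OF J_linear] linear_on_scale[OF J_linear]
  have M1: "linear_on (mspace M) (mact M a)" if "a \<in> carrier R" for a
    using M that by (simp add: bilinear_action_def)
  have "linear_on (mspace N) (mact N a)" if a: "a \<in> carrier R" for a
    unfolding linear_on_def
  proof (intro conjI ballI allI)
    fix v w assume vw: "v \<in> mspace N" "w \<in> mspace N"
    show "mact N a (v + w) = mact N a v + mact N a w"
      by (rule J_eqD) (use vw a NN act_in J_act lin J_in linear_on_add[OF M1[OF a]] in simp_all)
  next
    fix c w assume w: "w \<in> mspace N"
    show "mact N a (fscale c w) = fscale c (mact N a w)"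
      by (rule J_eqD) (use w a NN act_in J_act lin J_in linear_on_scale[OF M1[OF a]] in simp_all)
  qed
  moreover have "mact N (add R a b) w = mact N a w + mact N b w"
    if "a \<in> carrier R" "b \<in> carrier R" "w \<in> mspace N" for a b w
  proof (rule J_eqD)
    have ab: "add R a b \<in> carrier R" using R that by (simp add: algebra_closed_def)
    show "mact N (add R a b) w \<in> mspace N" "mact N a w + mact N b w \<in> mspace N"
      using that ab act_in NN by simp_all
    show "J (mact N (add R a b) w) = J (mact N a w + mact N b w)"
      using M that ab by (simp add: J_act J_in lin act_in bilinear_action_def)
  qed
  moreover have "mact N (smult R c a) w = fscale c (mact N a w)"
    if "a \<in> carrier R" "w \<in> mspace N" for a c w
  proof (rule J_eqD)
    have ca: "smult R c a \<in> carrier R" using R that by (simp add: algebra_closed_def)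
    show "mact N (smult R c a) w \<in> mspace N" "fscale c (mact N a w) \<in> mspace N"
      using that ca act_in NN by simp_all
    show "J (mact N (smult R c a) w) = J (fscale c (mact N a w))"
      using M that ca by (simp add: J_act J_in lin act_in bilinear_action_def)
  qed
  moreover have "mact N (one R) w = w" if "w \<in> mspace N" for w
  proof (rule J_eqD)
    have o: "one R \<in> carrier R" using R by (simp add: algebra_closed_def)
    show "mact N (one R) w \<in> mspace N" using that o act_in by simp
    show "J (mact N (one R) w) = J w"
      using M that o by (simp add: J_act J_in bilinear_action_def)
  qed (fact that)
  ultimately show ?thesis using N act_in unfolding bilinear_action_def by blast
qed

lemma right_module_transfer:
  assumes M: "right_module R M" shows "right_module R N"
  unfolding right_module_def
proof (intro conjI ballI)
  show "bilinear_action R N" using M bilinear_transfer by (simp add: right_module_def)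
  fix a b w assume a: "a \<in> carrier R" "b \<in> carrier R" "w \<in> mspace N"
  have ab: "monoid.mult R a b \<in> carrier R" using R a by (simp add: algebra_closed_def)
  show "mact N (monoid.mult R a b) w = mact N b (mact N a w)"
  proof (rule J_eqD)
    show "J (mact N (monoid.mult R a b) w) = J (mact N b (mact N a w))"
      using M a ab by (simp add: J_act J_in act_in right_module_def)
  qed (use a ab act_in in simp_all)
qed

lemma left_module_transfer:
  assumes M: "left_module R M" shows "left_module R N"
  unfolding left_module_def
proof (intro conjI ballI)
  show "bilinear_action R N" using M bilinear_transfer by (simp add: left_module_def)
  fix a b w assume a: "a \<in> carrier R" "b \<in> carrier R" "w \<in> mspace N"
  have ab: "monoid.mult R a b \<in> carrier R" using R a by (simp add: algebra_closed_def)
  show "mact N (monoid.mult R a b) w = mact N a (mact N b w)"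
  proof (rule J_eqD)
    show "J (mact N (monoid.mult R a b) w) = J (mact N a (mact N b w))"
      using M a ab by (simp add: J_act J_in act_in left_module_def)
  qed (use a ab act_in in simp_all)
qed

end

text \<open>Only \<open>M\<close> is known to be a bimodule. The map \<open>J\<close> runs from
  \<open>N\<close> to \<open>M\<close>, so that the axioms can be pulled back to \<open>N\<close>;
  the isomorphism is its inverse.\<close>

lemma bimodule_isomorphicI:
  assumes M: "bimodule R S M" and R: "algebra_closed R" and S: "algebra_closed S"
    and N: "cfun.subspace (bspace N)"
    and lact_in: "\<And>a f. a \<in> carrier R \<Longrightarrow> f \<in> bspace N \<Longrightarrow> lact N a f \<in> bspace N"
    and ract_in: "\<And>a f. a \<in> carrier S \<Longrightarrow> f \<in> bspace N \<Longrightarrow> ract N a f \<in> bspace N"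
    and lin: "linear_on (bspace N) J" and bij: "bij_betw J (bspace N) (bspace M)"
    and J_lact: "\<And>a f. a \<in> carrier R \<Longrightarrow> f \<in> bspace N \<Longrightarrow> J (lact N a f) = lact M a (J f)"
    and J_ract: "\<And>a f. a \<in> carrier S \<Longrightarrow> f \<in> bspace N \<Longrightarrow> J (ract N a f) = ract M a (J f)"
  shows "bimodule_isomorphic R S M N"
proof -
  have J_in: "J f \<in> bspace M" if "f \<in> bspace N" for f using bij that bij_betwE by blast
  have inj: "f = g" if "f \<in> bspace N" "g \<in> bspace N" "J f = J g" for f g
    using bij that by (auto simp: bij_betw_def inj_on_def)
  have J0: "f = 0" if "f \<in> bspace N" "J f = 0" for f
    using inj[OF that(1) cfun.subspace_0[OF N]] linear_on_0[OF N lin] that by simp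
  interpret l: module_embedding R "\<lparr>mspace = bspace M, mact = lact M\<rparr>" "\<lparr>mspace = bspace N, mact = lact N\<rparr>" J
    by unfold_locales (simp_all add: R N lact_in lin J_in J0 J_lact)
  interpret r: module_embedding S "\<lparr>mspace = bspace M, mact = ract M\<rparr>" "\<lparr>mspace = bspace N, mact = ract N\<rparr>" J
    by unfold_locales (simp_all add: S N ract_in lin J_in J0 J_ract)
  have "ract N b (lact N a w) = lact N a (ract N b w)" if "a \<in> carrier R" "b \<in> carrier S" "w \<in> bspace N" for a b w
    by (rule inj) (use that M in \<open>simp_all add: lact_in ract_in J_lact J_ract J_in bimodule_def\<close>)
  then have bN: "bimodule R S N"
    using M l.left_module_transfer r.right_module_transfer unfolding bimodule_def by blast
  define \<Phi> where "\<Phi> = inv_into (bspace N) J"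
  have b: "bij_betw \<Phi> (bspace M) (bspace N)" unfolding \<Phi>_def by (rule bij_betw_inv_into[OF bij])
  have P: "J (\<Phi> w) = w" if "w \<in> bspace M" for w
    unfolding \<Phi>_def using bij_betw_inv_into_right[OF bij that] .
  have P_in: "\<Phi> w \<in> bspace N" if "w \<in> bspace M" for w using b that bij_betwE by blast
  have PJ: "\<Phi> w = f" if "f \<in> bspace N" "J f = w" for f w
    unfolding \<Phi>_def using bij_betw_inv_into_left[OF bij that(1)] that(2) by simp
  have "linear_on (bspace M) \<Phi>"
    unfolding linear_on_def
  proof (intro conjI ballI allI)
    show "\<Phi> (v + w) = \<Phi> v + \<Phi> w" if "v \<in> bspace M" "w \<in> bspace M" for v w
      by (rule PJ) (use that P P_in cfun.subspace_add[OF N] linear_on_add[OF lin] in simp_all)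
    show "\<Phi> (fscale c w) = fscale c (\<Phi> w)" if "w \<in> bspace M" for c w
      by (rule PJ) (use that P P_in cfun.subspace_scale[OF N] linear_on_scale[OF lin] in simp_all)
  qed
  moreover have "\<Phi> (lact M a w) = lact N a (\<Phi> w)" if "a \<in> carrier R" "w \<in> bspace M" for a w
    by (rule PJ) (use that P P_in lact_in J_lact in simp_all)
  moreover have "\<Phi> (ract M a w) = ract N a (\<Phi> w)" if "a \<in> carrier S" "w \<in> bspace M" for a w
    by (rule PJ) (use that P P_in ract_in J_ract in simp_all)
  ultimately show ?thesis using M bN b unfolding bimodule_isomorphic_def by blast
qed

text \<open>The second factor consists of all functions on a finite set, so a tensor is the same as
  a family of slices in \<open>W\<close>: expand it as the sum over \<open>y\<close> of its slice at
  \<open>y\<close> tensored with \<open>basis_vec y\<close>.\<close>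

lemma outer_tensor_space:
  fixes W :: "('x \<Rightarrow> complex) set" and Y :: "'y set"
  assumes W: "cfun.subspace W" and Y: "finite Y"
  shows "cfun.span {\<lambda>(x, y). w x * u y | w u. w \<in> W \<and> u \<in> free_space Y}
       = {T. (\<forall>y. (\<lambda>x. T (x, y)) \<in> W) \<and> (\<forall>x y. y \<notin> Y \<longrightarrow> T (x, y) = 0)}" (is "cfun.span ?G = ?R")
proof
  have slice: "(\<lambda>x. (S + T) (x, y)) = (\<lambda>x. S (x, y)) + (\<lambda>x. T (x, y))" "(\<lambda>x. fscale c S (x, y)) = fscale c (\<lambda>x. S (x, y))"
    "(\<lambda>x. (0 :: 'x \<times> 'y \<Rightarrow> complex) (x, y)) = 0"
    for S T :: "'x \<times> 'y \<Rightarrow> complex" and y c by (simp_all add: fun_eq_iff)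
  have "cfun.subspace ?R"
    by (rule cfun.subspaceI)
      (simp_all add: slice cfun.subspace_0[OF W] cfun.subspace_add[OF W] cfun.subspace_scale[OF W] del: plus_fun_apply fscale_apply zero_fun_apply,
       simp_all)
  moreover have "?G \<subseteq> ?R"
  proof
    fix T assume "T \<in> ?G"
    then obtain w u where T: "T = (\<lambda>(x, y). w x * u y)" "w \<in> W" "u \<in> free_space Y" by blast
    have "(\<lambda>x. T (x, y)) = fscale (u y) w" for y by (simp add: T fun_eq_iff mult.commute)
    then show "T \<in> ?R" using T(2,3) cfun.subspace_scale[OF W] by (simp add: T(1) free_space_def)
  qed
  ultimately show "cfun.span ?G \<subseteq> ?R" by (intro cfun.span_minimal)
  show "?R \<subseteq> cfun.span ?G"
  proof
    fix T assume T: "T \<in> ?R"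
    have "T = (\<Sum>y\<in>Y. (\<lambda>(x, y'). T (x, y) * basis_vec y y'))"
    proof
      fix z :: "'x \<times> 'y" obtain x y' where z: "z = (x, y')" by (cases z)
      have "(\<Sum>y\<in>Y. (\<lambda>(x, y'). T (x, y) * basis_vec y y')) z = (\<Sum>y\<in>Y. if y = y' then T (x, y) else 0)"
        unfolding sum_fun_apply z by (rule sum.cong) (auto simp: basis_vec_apply)
      also have "\<dots> = T z" using T Y by (auto simp: z)
      finally show "T z = (\<Sum>y\<in>Y. (\<lambda>(x, y'). T (x, y) * basis_vec y y')) z" by simp
    qed
    moreover have "(\<Sum>y\<in>Y. (\<lambda>(x, y'). T (x, y) * basis_vec y y')) \<in> cfun.span ?G"
    proof (rule cfun.span_sum, rule cfun.span_base)
      fix y assume "y \<in> Y"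
      then have "basis_vec y \<in> free_space Y" by simp
      moreover have "(\<lambda>x. T (x, y)) \<in> W" using T by blast
      ultimately show "(\<lambda>(x, y'). T (x, y) * basis_vec y y') \<in> ?G"
        by (intro CollectI exI[of _ "\<lambda>x. T (x, y)"] exI[of _ "basis_vec y"]) simp
    qed
    ultimately show "T \<in> cfun.span ?G" by simp
  qed
qed

lemma equivariant_perm_action:
  assumes f: "equivariant_on m X act Y act' S f" and S: "cfun.subspace S"
    and inv: "\<And>\<sigma> v. \<sigma> permutes {1..m} \<Longrightarrow> v \<in> S \<Longrightarrow> push X (act \<sigma>) v \<in> S" and v: "v \<in> S"
    and X: "perm_rep m X act" and Y: "perm_rep m Y act'"
  shows "f (perm_action m X act a v) = perm_action m Y act' a (f v)"
proof -
  have l: "linear_on S f" using f by (simp add: equivariant_on_def)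
  have p: "\<sigma> permutes {1..m}" if "\<sigma> \<in> carrier (sym_group m)" for \<sigma> using that by (simp add: sym_group_def)
  have "f (perm_action m X act a v) = (\<Sum>\<sigma>\<in>carrier (sym_group m). f (fscale (a \<sigma>) (push X (act \<sigma>) v)))"
    unfolding perm_rep.perm_action_eq[OF X]
    by (rule linear_on_sum[OF S l]) (use inv[OF p v] cfun.subspace_scale[OF S] in blast)
  also have "\<dots> = perm_action m Y act' a (f v)"
    unfolding perm_rep.perm_action_eq[OF Y]
    by (rule sum.cong) (use inv[OF p v] linear_on_scale[OF l] f v p in \<open>auto simp: equivariant_on_def\<close>)
  finally show ?thesis .
qed

section \<open>The double centralizer decomposition\<close>

text \<open>\<open>K b\<close> is the matrix of the basis element \<open>b\<close> acting on row vectors indexed by \<open>W\<close>.\<close>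

locale matrix_duality = perm_rep m W act
  for m :: nat and W :: "'w set" and act :: "(nat \<Rightarrow> nat) \<Rightarrow> 'w \<Rightarrow> 'w" +
  fixes B :: "'b set" and mu :: "'b \<Rightarrow> 'b \<Rightarrow> 'b" and q :: "'b \<Rightarrow> 'b \<Rightarrow> complex" and e :: 'b
    and K :: "'b \<Rightarrow> 'w \<Rightarrow> 'w \<Rightarrow> complex"
    and act_r :: "('b \<Rightarrow> complex) \<Rightarrow> ('w \<Rightarrow> complex) \<Rightarrow> 'w \<Rightarrow> complex"
    and P :: "'p set" and sh :: "'p \<Rightarrow> nat list"
    and \<phi> :: "'p \<Rightarrow> ((nat \<Rightarrow> nat set) \<Rightarrow> complex) \<Rightarrow> 'w \<Rightarrow> complex"
  assumes fin_B: "finite B" and mu_closed: "\<And>a b. a \<in> B \<Longrightarrow> b \<in> B \<Longrightarrow> mu a b \<in> B" and e_in: "e \<in> B"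
    and K_comp: "\<And>a b u w. a \<in> B \<Longrightarrow> b \<in> B \<Longrightarrow> u \<in> W \<Longrightarrow> w \<in> W \<Longrightarrow>
        (\<Sum>v\<in>W. K a u v * K b v w) = q a b * K (mu a b) u w"
    and K_unit: "\<And>u w. u \<in> W \<Longrightarrow> w \<in> W \<Longrightarrow> K e u w = (if u = w then 1 else 0)"
    and K_inv: "\<And>b \<sigma> u w. b \<in> B \<Longrightarrow> \<sigma> permutes {1..m} \<Longrightarrow> u \<in> W \<Longrightarrow> w \<in> W \<Longrightarrow>
        K b (act \<sigma> u) (act \<sigma> w) = K b u w"
    and K_full: "\<And>t. (\<And>\<sigma> u w. \<sigma> permutes {1..m} \<Longrightarrow> u \<in> W \<Longrightarrow> w \<in> W \<Longrightarrow> t (act \<sigma> u) (act \<sigma> w) = t u w) \<Longrightarrow>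
        \<exists>a\<in>free_space B. \<forall>u\<in>W. \<forall>w\<in>W. t u w = (\<Sum>b\<in>B. a b * K b u w)"
    and act_r_apply: "\<And>a f w. a \<in> free_space B \<Longrightarrow> f \<in> free_space W \<Longrightarrow> w \<in> W \<Longrightarrow>
        act_r a f w = (\<Sum>b\<in>B. a b * (\<Sum>u\<in>W. f u * K b u w))"
    and act_r_outside: "\<And>a f w. a \<in> free_space B \<Longrightarrow> f \<in> free_space W \<Longrightarrow> w \<notin> W \<Longrightarrow> act_r a f w = 0"
    and fin_P: "finite P" and sh_part: "\<And>p. p \<in> P \<Longrightarrow> sh p \<in> partitions m"
    and phi_equivariant: "\<And>p. p \<in> P \<Longrightarrow>
        equivariant_on m (tabloids m (sh p)) tact W act (specht_space m (sh p)) (\<phi> p)"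
    and phi_in: "\<And>p v. p \<in> P \<Longrightarrow> v \<in> specht_space m (sh p) \<Longrightarrow> \<phi> p v \<in> free_space W"
    and phi_inj: "jointly_inj P (\<lambda>p. specht_space m (sh p)) \<phi>"
    and phi_surj: "\<And>w. w \<in> free_space W \<Longrightarrow>
        \<exists>x. (\<forall>p\<in>P. x p \<in> specht_space m (sh p)) \<and> (\<Sum>p\<in>P. \<phi> p (x p)) = w"
begin

abbreviation S :: "nat list \<Rightarrow> ((nat \<Rightarrow> nat set) \<Rightarrow> complex) set" where
  "S l \<equiv> specht_space m l"

definition matop :: "('w \<Rightarrow> 'w \<Rightarrow> complex) \<Rightarrow> ('w \<Rightarrow> complex) \<Rightarrow> 'w \<Rightarrow> complex" where
  "matop k f = (\<lambda>w. if w \<in> W then \<Sum>u\<in>W. f u * k u w else 0)"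

lemma matop_in: "matop k f \<in> free_space W"
  by (simp add: matop_def free_space_def)

lemma linear_on_matop: "linear_on U (matop k)"
  unfolding linear_on_def matop_def
  by (auto simp: fun_eq_iff algebra_simps sum.distrib sum_distrib_left)

lemma act_r_matop:
  assumes "a \<in> free_space B" "f \<in> free_space W"
  shows "act_r a f = (\<Sum>b\<in>B. fscale (a b) (matop (K b) f))"
proof
  fix w show "act_r a f w = (\<Sum>b\<in>B. fscale (a b) (matop (K b) f)) w"
    using act_r_apply[OF assms, of w] act_r_outside[OF assms, of w]
    by (cases "w \<in> W") (simp_all add: sum_fun_apply matop_def)
qed

sublocale right: based_action B mu q e "free_space W" "\<lambda>b. matop (K b)" act_r
proof
  show "matop (K e) w = w" if "w \<in> free_space W" for w
  proof
    fix x show "matop (K e) w x = w x"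
    proof (cases "x \<in> W")
      case True
      have "(\<Sum>u\<in>W. w u * K e u x) = (\<Sum>u\<in>W. if u = x then w u else 0)"
        by (rule sum.cong) (use K_unit True in auto)
      then show ?thesis using True finite_X by (simp add: matop_def)
    next
      case False
      then show ?thesis using that by (simp add: matop_def free_space_def)
    qed
  qed
qed (simp_all add: fin_B mu_closed e_in matop_in linear_on_matop act_r_matop)

abbreviation "alg_r \<equiv> based_algebra B mu q e"

lemma carrier_alg_r: "carrier alg_r = free_space B"
  by (simp add: based_algebra_def)

lemma matop_matop:
  assumes "a \<in> B" "b \<in> B"
  shows "matop (K b) (matop (K a) f) = fscale (q a b) (matop (K (mu a b)) f)"
proof
  fix w show "matop (K b) (matop (K a) f) w = fscale (q a b) (matop (K (mu a b)) f) w"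
  proof (cases "w \<in> W")
    case True
    have "matop (K b) (matop (K a) f) w = (\<Sum>v\<in>W. \<Sum>u\<in>W. f u * (K a u v * K b v w))"
      using True by (simp add: matop_def sum_distrib_right mult.assoc)
    also have "\<dots> = (\<Sum>u\<in>W. \<Sum>v\<in>W. f u * (K a u v * K b v w))" by (rule sum.swap)
    also have "\<dots> = (\<Sum>u\<in>W. f u * (q a b * K (mu a b) u w))"
      by (rule sum.cong) (simp_all add: sum_distrib_left[symmetric] K_comp assms True)
    finally show ?thesis using True by (simp add: matop_def sum_distrib_left mult.left_commute)
  qed (simp add: matop_def)
qed

lemma right_module_tensor: "right_module alg_r \<lparr>mspace = free_space W, mact = act_r\<rparr>"
  by (rule right.right_moduleI) (rule matop_matop)

lemma matop_rep:
  assumes inv: "\<And>u w. u \<in> W \<Longrightarrow> w \<in> W \<Longrightarrow> k (act \<sigma> u) (act \<sigma> w) = k u w" and s: "\<sigma> permutes {1..m}"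
  shows "matop k (rep \<sigma> f) = rep \<sigma> (matop k f)"
proof
  fix w show "matop k (rep \<sigma> f) w = rep \<sigma> (matop k f) w"
  proof (cases "w \<in> W")
    case True
    have w': "act (inv' \<sigma>) w \<in> W" using act_closed[OF permutes_inv[OF s] True] .
    have "matop k (rep \<sigma> f) w = (\<Sum>u\<in>W. rep \<sigma> f u * k u w)"
      using True by (simp add: matop_def)
    also have "\<dots> = (\<Sum>u\<in>W. rep \<sigma> f (act \<sigma> u) * k (act \<sigma> u) w)"
      by (rule sum.reindex_bij_betw[OF act_bij[OF s], symmetric])
    also have "\<dots> = (\<Sum>u\<in>W. f u * k u (act (inv' \<sigma>) w))"
      by (rule sum.cong) (use inv[OF _ w'] act_inv2[OF s True] rep_apply_act[OF s] in auto)
    finally show ?thesis using True w' by (simp add: rep_apply[OF s] matop_def)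
  qed (simp add: matop_def rep_apply[OF s])
qed

lemma act_r_rep:
  assumes s: "\<sigma> permutes {1..m}" and a: "a \<in> free_space B" and f: "f \<in> free_space W"
  shows "act_r a (rep \<sigma> f) = rep \<sigma> (act_r a f)"
  unfolding act_r_matop[OF a f] act_r_matop[OF a rep_in[OF s]] push_sum push_scale
proof (rule sum.cong[OF refl])
  fix b assume "b \<in> B"
  then have "matop (K b) (rep \<sigma> f) = rep \<sigma> (matop (K b) f)"
    by (intro matop_rep s K_inv)
  then show "fscale (a b) (matop (K b) (rep \<sigma> f)) = fscale (a b) (rep \<sigma> (matop (K b) f))" by simp
qed

lemma act_r_equivariant: "a \<in> free_space B \<Longrightarrow> equivariant_on m W act W act (free_space W) (act_r a)"
  using right.act_linear act_r_rep by (simp add: equivariant_on_def)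

text \<open>Equivariance makes the matrix of \<open>T\<close> constant on orbits of pairs, and
  \<open>K_full\<close> expands such matrices. This is the fullness half of the double centralizer
  property.\<close>

lemma equivariant_is_act_r:
  assumes T: "equivariant_on m W act W act (free_space W) T" and T_in: "\<And>f. f \<in> free_space W \<Longrightarrow> T f \<in> free_space W"
  shows "\<exists>a\<in>free_space B. \<forall>f\<in>free_space W. act_r a f = T f"
proof -
  define t where "t u w = T (basis_vec u) w" for u w
  have "t (act \<sigma> u) (act \<sigma> w) = t u w" if s: "\<sigma> permutes {1..m}" and uw: "u \<in> W" "w \<in> W" for \<sigma> u w
  proof -
    have "T (rep \<sigma> (basis_vec u)) = rep \<sigma> (T (basis_vec u))"
      using T s uw by (simp add: equivariant_on_def)
    then show ?thesis
      using rep_apply_act[OF s uw(2)] uw by (simp add: t_def push_basis_vec[OF finite_X uw(1)])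
  qed
  then obtain a where a: "a \<in> free_space B" "\<And>u w. u \<in> W \<Longrightarrow> w \<in> W \<Longrightarrow> t u w = (\<Sum>b\<in>B. a b * K b u w)"
    using K_full by blast
  have "act_r a f = T f" if f: "f \<in> free_space W" for f
  proof (rule linear_on_free_space_eqI[OF finite_X _ _ _ f])
    show "linear_on (free_space W) (act_r a)" by (rule right.act_linear[OF a(1)])
    show "linear_on (free_space W) T" using T by (simp add: equivariant_on_def)
    fix u assume u: "u \<in> W"
    then have bu: "basis_vec u \<in> free_space W" by simp
    show "act_r a (basis_vec u) = T (basis_vec u)"
    proof
      fix w show "act_r a (basis_vec u) w = T (basis_vec u) w"
      proof (cases "w \<in> W")
        case True
        have "(\<Sum>v\<in>W. basis_vec u v * K b v w) = K b u w" for b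
        proof -
          have "(\<Sum>v\<in>W. basis_vec u v * K b v w) = (\<Sum>v\<in>W. if v = u then K b v w else 0)"
            by (rule sum.cong) (auto simp: basis_vec_apply)
          then show ?thesis using u finite_X by simp
        qed
        then show ?thesis using act_r_apply[OF a(1) bu True] a(2)[OF u True] by (simp add: t_def)
      next
        case False
        then show ?thesis using act_r_outside[OF a(1) bu False] T_in[OF bu] by (simp add: free_space_def)
      qed
    qed
  qed
  then show ?thesis using a(1) by blast
qed

section \<open>Coordinates along the family of embeddings\<close>

lemma phi_linear: "p \<in> P \<Longrightarrow> linear_on (S (sh p)) (\<phi> p)"
  using phi_equivariant by (simp add: equivariant_on_def)

text \<open>The coordinates of \<open>w\<close> along the family. They are unique by
  \<open>phi_inj\<close>, so this choice is linear and equivariant on tensor space.\<close>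

definition dec :: "('w \<Rightarrow> complex) \<Rightarrow> 'p \<Rightarrow> (nat \<Rightarrow> nat set) \<Rightarrow> complex" where
  "dec w = (SOME x. (\<forall>p\<in>P. x p \<in> S (sh p)) \<and> (\<Sum>p\<in>P. \<phi> p (x p)) = w)"

lemma dec:
  assumes "w \<in> free_space W"
  shows "p \<in> P \<Longrightarrow> dec w p \<in> S (sh p)" "(\<Sum>p\<in>P. \<phi> p (dec w p)) = w"
  using someI_ex[OF phi_surj[OF assms]] unfolding dec_def[symmetric] by blast+

lemma dec_unique:
  assumes x: "\<And>p. p \<in> P \<Longrightarrow> x p \<in> S (sh p)" and w: "(\<Sum>p\<in>P. \<phi> p (x p)) = w" and p: "p \<in> P"
  shows "dec w p = x p"
proof -
  have wW: "w \<in> free_space W"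
    unfolding w[symmetric] by (rule cfun.subspace_sum[OF subspace_free_space]) (use phi_in x in blast)
  show ?thesis
    by (rule jointly_inj_unique[OF phi_inj cfun.subspace_span phi_linear dec(1)[OF wW] x _ p])
      (use dec(2)[OF wW] w in simp_all)
qed

lemma dec_linear: "p \<in> P \<Longrightarrow> linear_on (free_space W) (\<lambda>w. dec w p)"
  unfolding linear_on_def
proof (intro conjI ballI allI)
  assume p: "p \<in> P"
  fix v w assume v: "v \<in> free_space W" and w: "w \<in> free_space W"
  show "dec (v + w) p = dec v p + dec w p"
  proof (rule dec_unique[where x = "\<lambda>p. dec v p + dec w p", OF _ _ p])
    show "(\<Sum>p\<in>P. \<phi> p (dec v p + dec w p)) = v + w"
      using linear_on_add[OF phi_linear] dec[OF v] dec[OF w] by (simp add: sum.distrib)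
  qed (use dec[OF v] dec[OF w] cfun.span_add in blast)
next
  assume p: "p \<in> P"
  fix c w assume w: "w \<in> free_space W"
  show "dec (fscale c w) p = fscale c (dec w p)"
  proof (rule dec_unique[where x = "\<lambda>p. fscale c (dec w p)", OF _ _ p])
    show "(\<Sum>p\<in>P. \<phi> p (fscale c (dec w p))) = fscale c w"
      using linear_on_scale[OF phi_linear] dec[OF w] by (simp add: cfun.scale_sum_right[symmetric])
  qed (use dec[OF w] cfun.span_scale in blast)
qed

lemma dec_rep:
  assumes s: "\<sigma> permutes {1..m}" and w: "w \<in> free_space W" and p: "p \<in> P"
  shows "dec (rep \<sigma> w) p = tabloid_rep m (sh p) \<sigma> (dec w p)"
proof (rule dec_unique[where x = "\<lambda>p. tabloid_rep m (sh p) \<sigma> (dec w p)", OF _ _ p])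
  have "(\<Sum>p\<in>P. \<phi> p (tabloid_rep m (sh p) \<sigma> (dec w p))) = (\<Sum>p\<in>P. rep \<sigma> (\<phi> p (dec w p)))"
    by (rule sum.cong) (use phi_equivariant s dec(1)[OF w] in \<open>auto simp: equivariant_on_def\<close>)
  then show "(\<Sum>p\<in>P. \<phi> p (tabloid_rep m (sh p) \<sigma> (dec w p))) = rep \<sigma> w"
    using dec(2)[OF w] by (simp add: push_sum[symmetric])
qed (rule rep_specht_space[OF s dec(1)[OF w]])

text \<open>The scalar from Schur's lemma; it is meaningful when \<open>sh p = sh p'\<close> and
  \<open>a\<close> lies in the algebra.\<close>

definition coef :: "('b \<Rightarrow> complex) \<Rightarrow> 'p \<Rightarrow> 'p \<Rightarrow> complex" where
  "coef a p p' = (SOME c. \<forall>v\<in>S (sh p). dec (act_r a (\<phi> p v)) p' = fscale c v)"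

abbreviation Psh :: "nat list \<Rightarrow> 'p set" where
  "Psh l \<equiv> {p \<in> P. sh p = l}"

text \<open>Each coordinate of the left-hand side depends equivariantly on \<open>v\<close>, so it
  is 0 for a different shape and a scalar multiple of \<open>v\<close> for the same shape.\<close>

lemma act_r_phi:
  assumes a: "a \<in> free_space B" and p: "p \<in> P" and v: "v \<in> S (sh p)"
  shows "act_r a (\<phi> p v) = (\<Sum>p'\<in>Psh (sh p). fscale (coef a p p') (\<phi> p' v))"
proof -
  have w: "act_r a (\<phi> p v) \<in> free_space W" if "v \<in> S (sh p)" for v using right.act_in[OF a phi_in[OF p that]] .
  have eq: "equivariant_on m (tabloids m (sh p)) tact (tabloids m (sh p')) tact (S (sh p)) (\<lambda>v. dec (act_r a (\<phi> p v)) p')"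
    if p': "p' \<in> P" for p'
    unfolding equivariant_on_def
  proof (intro conjI allI impI)
    have "linear_on (S (sh p)) (\<lambda>v. act_r a (\<phi> p v))"
      by (rule linear_on_compose[OF phi_linear[OF p] right.act_linear[OF a]]) (use phi_in[OF p] in blast)
    then show "linear_on (S (sh p)) (\<lambda>v. dec (act_r a (\<phi> p v)) p')"
      by (rule linear_on_compose[OF _ dec_linear[OF p']]) (use w in blast)
    fix \<sigma> v assume s: "\<sigma> permutes {1..m}" and v: "v \<in> S (sh p)"
    show "dec (act_r a (\<phi> p (tabloid_rep m (sh p) \<sigma> v))) p'
        = tabloid_rep m (sh p') \<sigma> (dec (act_r a (\<phi> p v)) p')"
      using phi_equivariant[OF p] s v act_r_rep[OF s a phi_in[OF p v]] dec_rep[OF s w[OF v] p']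
      by (simp add: equivariant_on_def)
  qed
  have val: "\<phi> p' (dec (act_r a (\<phi> p v)) p') = (if sh p' = sh p then fscale (coef a p p') (\<phi> p' v) else 0)"
    if p': "p' \<in> P" for p'
  proof (cases "sh p' = sh p")
    case True
    have "\<exists>c. \<forall>v\<in>S (sh p). dec (act_r a (\<phi> p v)) p' = fscale c v"
      by (rule specht_schur_scalar[OF sh_part[OF p]])
        (use eq[OF p'] True dec(1)[OF w p'] in simp_all)
    then have "\<forall>v\<in>S (sh p). dec (act_r a (\<phi> p v)) p' = fscale (coef a p p') v"
      unfolding coef_def by (rule someI_ex)
    then have "dec (act_r a (\<phi> p v)) p' = fscale (coef a p p') v" using v by (rule bspec)
    then show ?thesis using True linear_on_scale[OF phi_linear[OF p']] v by simp
  next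
    case False
    have "dec (act_r a (\<phi> p v)) p' = 0"
      by (rule specht_schur_distinct[OF sh_part[OF p] sh_part[OF p'] False[symmetric] eq[OF p'] dec(1)[OF w p'] v])
    then show ?thesis using False linear_on_0[OF cfun.subspace_span phi_linear[OF p']] by simp
  qed
  have "act_r a (\<phi> p v) = (\<Sum>p'\<in>P. \<phi> p' (dec (act_r a (\<phi> p v)) p'))" using dec(2)[OF w[OF v]] by simp
  also have "\<dots> = (\<Sum>p'\<in>P. if sh p' = sh p then fscale (coef a p p') (\<phi> p' v) else 0)"
    by (rule sum.cong) (use val in auto)
  also have "\<dots> = (\<Sum>p'\<in>Psh (sh p). fscale (coef a p p') (\<phi> p' v))"
    by (rule sum.inter_filter[symmetric, OF fin_P])
  finally show ?thesis .
qed

section \<open>The multiplicity modules\<close>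

definition mult_dim :: "nat list \<Rightarrow> nat" where
  "mult_dim l = card (Psh l)"

text \<open>The indices of shape \<open>l\<close> are numbered so that the multiplicity modules of
  all shapes consist of functions on \<open>nat\<close> and have one common type.\<close>

definition enum :: "nat list \<Rightarrow> nat \<Rightarrow> 'p" where
  "enum l = (SOME h. bij_betw h {..<mult_dim l} (Psh l))"

lemma enum: "bij_betw (enum l) {..<mult_dim l} (Psh l)"
proof -
  have "\<exists>h. bij_betw h {..<mult_dim l} (Psh l)"
    using ex_bij_betw_nat_finite[of "Psh l"] fin_P by (simp add: mult_dim_def atLeast0LessThan)
  then show ?thesis unfolding enum_def by (rule someI_ex)
qed

definition mult_module :: "nat list \<Rightarrow> ('b \<Rightarrow> complex, nat) amod" where
  "mult_module l = \<lparr> mspace = free_space {..<mult_dim l},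
     mact = (\<lambda>a f y. if y < mult_dim l then \<Sum>y'<mult_dim l. f y' * coef a (enum l y') (enum l y) else 0) \<rparr>"

lemma enum_in: "y < mult_dim l \<Longrightarrow> enum l y \<in> P" "y < mult_dim l \<Longrightarrow> sh (enum l y) = l"
  using bij_betwE[OF enum[of l]] by auto

lemma mult_act_in: "mact (mult_module l) a f \<in> free_space {..<mult_dim l}"
  by (simp add: mult_module_def free_space_def)

text \<open>For a fixed vector \<open>v\<close> of the Specht module, evaluating the family \<open>\<phi>\<close> at \<open>v\<close> embeds the multiplicity
  space into tensor space.\<close>

definition mult_embed :: "nat list \<Rightarrow> ((nat \<Rightarrow> nat set) \<Rightarrow> complex) \<Rightarrow> (nat \<Rightarrow> complex) \<Rightarrow> 'w \<Rightarrow> complex" where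
  "mult_embed l v f = (\<Sum>y<mult_dim l. fscale (f y) (\<phi> (enum l y) v))"

lemma mult_embed_linear: "linear_on U (mult_embed l v)"
  unfolding linear_on_def mult_embed_def
  by (simp add: cfun.scale_left_distrib sum.distrib cfun.scale_sum_right)

lemma mult_embed_in: "v \<in> S l \<Longrightarrow> mult_embed l v f \<in> free_space W"
  unfolding mult_embed_def
  by (intro cfun.subspace_sum cfun.subspace_scale subspace_free_space) (simp add: phi_in enum_in)

definition slot :: "'p \<Rightarrow> nat" where
  "slot p = inv_into {..<mult_dim (sh p)} (enum (sh p)) p"

lemma slot: "p \<in> P \<Longrightarrow> slot p < mult_dim (sh p)" "p \<in> P \<Longrightarrow> enum (sh p) (slot p) = p"
  using bij_betw_inv_into_right[OF enum[of "sh p"], of p] bij_betwE[OF bij_betw_inv_into[OF enum[of "sh p"]]]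
  by (auto simp: slot_def)

lemma slot_enum: "y < mult_dim l \<Longrightarrow> slot (enum l y) = y"
  using bij_betw_inv_into_left[OF enum[of l], of y] enum_in[of y l] by (simp add: slot_def)

lemma sum_enum: "(\<Sum>y<mult_dim l. g y (enum l y)) = (\<Sum>p\<in>Psh l. g (slot p) p)"
proof -
  have "(\<Sum>p\<in>Psh l. g (slot p) p) = (\<Sum>y<mult_dim l. g (slot (enum l y)) (enum l y))"
    by (rule sum.reindex_bij_betw[OF enum, symmetric])
  then show ?thesis by (simp add: slot_enum)
qed

lemma dec_mult_embed:
  assumes v: "v \<in> S l" and y: "y < mult_dim l"
  shows "dec (mult_embed l v f) (enum l y) = fscale (f y) v"
proof -
  let ?x = "\<lambda>p. if sh p = l then fscale (f (slot p)) v else 0"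
  have "(\<Sum>p\<in>P. \<phi> p (?x p)) = (\<Sum>p\<in>P. if sh p = l then fscale (f (slot p)) (\<phi> p v) else 0)"
    by (rule sum.cong) (use linear_on_scale[OF phi_linear] linear_on_0[OF cfun.subspace_span phi_linear] v in auto)
  also have "\<dots> = (\<Sum>p\<in>Psh l. fscale (f (slot p)) (\<phi> p v))" by (rule sum.inter_filter[symmetric, OF fin_P])
  also have "\<dots> = mult_embed l v f" unfolding mult_embed_def by (rule sum_enum[symmetric])
  finally have s: "(\<Sum>p\<in>P. \<phi> p (?x p)) = mult_embed l v f" .
  have "dec (mult_embed l v f) (enum l y) = ?x (enum l y)"
    by (rule dec_unique[OF _ s enum_in(1)[OF y]]) (use v cfun.span_scale cfun.span_zero in auto)
  then show ?thesis using enum_in[OF y] slot_enum[OF y] by simp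
qed

lemma mult_embed_act:
  assumes a: "a \<in> free_space B" and v: "v \<in> S l"
  shows "mult_embed l v (mact (mult_module l) a f) = act_r a (mult_embed l v f)"
proof -
  have ph: "\<phi> (enum l y) v \<in> free_space W" if "y < mult_dim l" for y
    using phi_in[OF enum_in(1)[OF that]] enum_in(2)[OF that] v by simp
  have "act_r a (mult_embed l v f) = (\<Sum>y<mult_dim l. act_r a (fscale (f y) (\<phi> (enum l y) v)))"
    unfolding mult_embed_def
    by (rule linear_on_sum[OF subspace_free_space right.act_linear[OF a]])
      (intro cfun.subspace_scale[OF subspace_free_space] ph, simp)
  also have "\<dots> = (\<Sum>y<mult_dim l. \<Sum>y'<mult_dim l. fscale (f y * coef a (enum l y) (enum l y')) (\<phi> (enum l y') v))"
  proof (rule sum.cong[OF refl])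
    fix y assume "y \<in> {..<mult_dim l}"
    then have y: "y < mult_dim l" by simp
    have "act_r a (\<phi> (enum l y) v) = (\<Sum>p'\<in>Psh l. fscale (coef a (enum l y) p') (\<phi> p' v))"
      using act_r_phi[OF a enum_in(1)[OF y], of v] v enum_in(2)[OF y] by simp
    also have "\<dots> = (\<Sum>y'<mult_dim l. fscale (coef a (enum l y) (enum l y')) (\<phi> (enum l y') v))"
      by (rule sum_enum[symmetric])
    finally show "act_r a (fscale (f y) (\<phi> (enum l y) v)) = (\<Sum>y'<mult_dim l. fscale (f y * coef a (enum l y) (enum l y')) (\<phi> (enum l y') v))"
      using linear_on_scale[OF right.act_linear[OF a] ph[OF y]] by (simp add: cfun.scale_sum_right)
  qed
  also have "\<dots> = (\<Sum>y'<mult_dim l. \<Sum>y<mult_dim l. fscale (f y * coef a (enum l y) (enum l y')) (\<phi> (enum l y') v))"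
    by (rule sum.swap)
  also have "\<dots> = mult_embed l v (mact (mult_module l) a f)"
    unfolding mult_embed_def by (rule sum.cong) (simp_all add: mult_module_def cfun.scale_sum_left)
  finally show ?thesis by simp
qed

lemma specht_nonzero: "l \<in> partitions m \<Longrightarrow> \<exists>v\<in>S l. v \<noteq> 0"
  using tableaux_nonempty polytabloid_in_specht_space polytabloid_nonzero by blast

lemma mult_embed_inj:
  assumes v: "v \<in> S l" "v \<noteq> 0" and f: "f \<in> free_space {..<mult_dim l}" and z: "mult_embed l v f = 0"
  shows "f = 0"
proof
  fix y
  show "f y = 0 y"
  proof (cases "y < mult_dim l")
    case True
    have "fscale (f y) v = dec 0 (enum l y)" using dec_mult_embed[OF v(1) True, of f] z by simp
    also have "\<dots> = 0"
      using linear_on_0[OF subspace_free_space dec_linear[OF enum_in(1)[OF True]]] .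
    finally show ?thesis using v(2) by simp
  qed (use f in \<open>simp add: free_space_def\<close>)
qed

text \<open>The multiplicity space inherits its module axioms from tensor space through the
  evaluation at one nonzero vector of the Specht module.\<close>

lemma mult_module_embedding:
  assumes v: "v \<in> S l" "v \<noteq> 0"
  shows "module_embedding alg_r \<lparr>mspace = free_space W, mact = act_r\<rparr> (mult_module l) (mult_embed l v)"
proof
  have sp: "mspace (mult_module l) = free_space {..<mult_dim l}" by (simp add: mult_module_def)
  show "algebra_closed alg_r" by (rule right.algebra_closed_alg)
  show "cfun.subspace (mspace (mult_module l))" by (simp add: sp)
  show "linear_on (mspace (mult_module l)) (mult_embed l v)" by (rule mult_embed_linear)
  show "mact (mult_module l) a f \<in> mspace (mult_module l)" for a f using mult_act_in sp by simp
  show "mult_embed l v f \<in> mspace \<lparr>mspace = free_space W, mact = act_r\<rparr>" for f using mult_embed_in[OF v(1)] by simp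
  show "f = 0" if "f \<in> mspace (mult_module l)" "mult_embed l v f = 0" for f
    using mult_embed_inj[OF v] that sp by simp
  show "mult_embed l v (mact (mult_module l) a f) = mact \<lparr>mspace = free_space W, mact = act_r\<rparr> a (mult_embed l v f)"
    if "a \<in> carrier alg_r" for a f
    using mult_embed_act[OF _ v(1)] that by (simp add: carrier_alg_r)
qed

text \<open>The operator \<open>T\<close> transports the copy of the Specht module at
  \<open>enum l y0\<close> identically to the copy at \<open>enum l y1\<close> and kills all other
  copies. It is equivariant, so an algebra element realises it; on the multiplicity space this
  element is a matrix unit.\<close>

lemma matrix_unit:
  assumes y: "y0 < mult_dim l" "y1 < mult_dim l" and l: "l \<in> partitions m" and u: "u \<in> free_space {..<mult_dim l}"
  shows "\<exists>a\<in>free_space B. mact (mult_module l) a u = fscale (u y0) (basis_vec y1)"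
proof -
  let ?p0 = "enum l y0" and ?p1 = "enum l y1"
  note p0 = enum_in[OF y(1)] and p1 = enum_in[OF y(2)]
  define T where "T w = \<phi> ?p1 (dec w ?p0)" for w
  have d: "dec w ?p0 \<in> S (sh ?p1)" if "w \<in> free_space W" for w
    using dec(1)[OF that p0(1)] p0(2) p1(2) by simp
  have T_in: "T w \<in> free_space W" if "w \<in> free_space W" for w
    unfolding T_def by (rule phi_in[OF p1(1) d[OF that]])
  have "equivariant_on m W act W act (free_space W) T"
    unfolding equivariant_on_def
  proof (intro conjI allI impI)
    show "linear_on (free_space W) T"
      unfolding T_def[abs_def]
      by (rule linear_on_compose[OF dec_linear[OF p0(1)] phi_linear[OF p1(1)]]) (use d in blast)
    fix \<sigma> w assume s: "\<sigma> permutes {1..m}" and w: "w \<in> free_space W"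
    show "T (rep \<sigma> w) = rep \<sigma> (T w)"
      using phi_equivariant[OF p1(1)] s d[OF w] p0(2) p1(2)
      by (simp add: T_def dec_rep[OF s w p0(1)] equivariant_on_def)
  qed
  then obtain a where a: "a \<in> free_space B" "\<And>f. f \<in> free_space W \<Longrightarrow> act_r a f = T f"
    using equivariant_is_act_r T_in by blast
  obtain v where v: "v \<in> S l" "v \<noteq> 0" using specht_nonzero[OF l] by blast
  interpret em: module_embedding alg_r "\<lparr>mspace = free_space W, mact = act_r\<rparr>" "mult_module l" "mult_embed l v"
    by (rule mult_module_embedding[OF v])
  have sp: "mspace (mult_module l) = free_space {..<mult_dim l}" by (simp add: mult_module_def)
  have "mult_embed l v (mact (mult_module l) a u) = T (mult_embed l v u)"
    unfolding mult_embed_act[OF a(1) v(1)] by (rule a(2)[OF mult_embed_in[OF v(1)]])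
  also have "\<dots> = fscale (u y0) (\<phi> ?p1 v)"
    unfolding T_def dec_mult_embed[OF v(1) y(1)]
    by (rule linear_on_scale[OF phi_linear[OF p1(1)]]) (use v p1 in simp)
  also have "\<dots> = mult_embed l v (fscale (u y0) (basis_vec y1))"
  proof -
    have "mult_embed l v (fscale (u y0) (basis_vec y1)) = (\<Sum>y<mult_dim l. if y = y1 then fscale (u y0) (\<phi> ?p1 v) else 0)"
      unfolding mult_embed_def by (rule sum.cong) (auto simp: basis_vec_apply)
    then show ?thesis using y(2) by simp
  qed
  finally have eq: "mult_embed l v (mact (mult_module l) a u) = mult_embed l v (fscale (u y0) (basis_vec y1))" .
  have "basis_vec y1 \<in> free_space {..<mult_dim l}" using y(2) by simp
  then have "fscale (u y0) (basis_vec y1) \<in> free_space {..<mult_dim l}"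
    by (rule cfun.subspace_scale[OF subspace_free_space])
  then have "mact (mult_module l) a u = fscale (u y0) (basis_vec y1)"
    by (intro em.J_eqD[OF _ _ eq]) (simp_all only: sp mult_act_in)
  then show ?thesis using a(1) by blast
qed

text \<open>From one nonzero coordinate of a vector in a submodule the matrix units produce every
  basis vector.\<close>

lemma mult_module_irreducible:
  assumes l: "l \<in> partitions m" and ne: "Psh l \<noteq> {}"
  shows "irreducible_right_module alg_r (mult_module l)"
proof -
  have sp: "mspace (mult_module l) = free_space {..<mult_dim l}" by (simp add: mult_module_def)
  have d: "0 < mult_dim l" using ne fin_P by (simp add: mult_dim_def card_gt_0_iff)
  obtain v where v: "v \<in> S l" "v \<noteq> 0" using specht_nonzero[OF l] by blast
  interpret em: module_embedding alg_r "\<lparr>mspace = free_space W, mact = act_r\<rparr>" "mult_module l" "mult_embed l v"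
    by (rule mult_module_embedding[OF v])
  have r: "right_module alg_r (mult_module l)" by (rule em.right_module_transfer[OF right_module_tensor])
  have "basis_vec 0 \<in> free_space {..<mult_dim l}" using d by simp
  moreover have "basis_vec (0::nat) \<noteq> 0" by (metis basis_vec_apply zero_fun_apply zero_neq_one)
  ultimately have nz: "mspace (mult_module l) \<noteq> {0}" using sp by blast
  have "U = {0} \<or> U = mspace (mult_module l)"
    if U: "cfun.subspace U" "U \<subseteq> mspace (mult_module l)" "\<forall>a\<in>carrier alg_r. mact (mult_module l) a ` U \<subseteq> U" for U
  proof (cases "U = {0}")
    case False
    then obtain u where u: "u \<in> U" "u \<noteq> 0" using cfun.subspace_0[OF U(1)] by blast
    have uf: "u \<in> free_space {..<mult_dim l}" using u U(2) sp by blast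
    obtain y0 where y0: "u y0 \<noteq> 0" using u(2) by (auto simp: fun_eq_iff)
    then have y0d: "y0 < mult_dim l" using uf by (force simp: free_space_def)
    have bU: "basis_vec y1 \<in> U" if y1: "y1 < mult_dim l" for y1
    proof -
      obtain a where a: "a \<in> free_space B" "mact (mult_module l) a u = fscale (u y0) (basis_vec y1)"
        using matrix_unit[OF y0d y1 l uf] by blast
      then have "fscale (u y0) (basis_vec y1) \<in> U" using U(3) u(1) carrier_alg_r by (metis image_subset_iff)
      then have "fscale (inverse (u y0)) (fscale (u y0) (basis_vec y1)) \<in> U" by (rule cfun.subspace_scale[OF U(1)])
      then show ?thesis using y0 by simp
    qed
    have "cfun.span (basis_vec ` {..<mult_dim l}) \<subseteq> U"
      by (rule cfun.span_minimal[OF _ U(1)]) (use bU in auto)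
    then show ?thesis using U(2) sp free_space_span[of "{..<mult_dim l}"] by auto
  qed simp
  then show ?thesis using r nz unfolding irreducible_right_module_def by blast
qed

lemma mult_module_dim: "module_dim (mult_module l) = card (Psh l)"
  by (simp add: module_dim_def mult_module_def dim_free_space) (simp add: mult_dim_def)

section \<open>The bimodule isomorphism\<close>

definition summands :: "nat list set \<Rightarrow> ((nat \<Rightarrow> nat) \<Rightarrow> complex, 'b \<Rightarrow> complex, nat list \<times> (nat \<Rightarrow> nat set) \<times> nat) bimod" where
  "summands I = direct_sum I (\<lambda>l. outer_tensor (specht m l) (mult_module l))"

lemma summands_space:
  "bspace (summands I) = {F. (\<forall>l\<in>I. \<forall>y. (\<lambda>x. F (l, (x, y))) \<in> S l) \<and>
      (\<forall>l x y. l \<notin> I \<or> y \<ge> mult_dim l \<longrightarrow> F (l, (x, y)) = 0)}"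
proof -
  have "bspace (outer_tensor (specht m l) (mult_module l))
      = {T. (\<forall>y. (\<lambda>x. T (x, y)) \<in> S l) \<and> (\<forall>x y. y \<notin> {..<mult_dim l} \<longrightarrow> T (x, y) = 0)}" for l
    using outer_tensor_space[OF cfun.subspace_span, of "{..<mult_dim l}" "polytabloid m l ` tableaux m l"]
    by (simp add: outer_tensor_def specht_def mult_module_def)
  then show ?thesis
    unfolding summands_def direct_sum_def by (auto simp: not_less) metis
qed

lemma summands_lact:
  "lact (summands I) a F (l, (x, y)) = (if l \<in> I then perm_action m (tabloids m l) tact a (\<lambda>x'. F (l, (x', y))) x else 0)"
  by (simp add: summands_def direct_sum_def outer_tensor_def specht_def)

lemma summands_ract:
  "ract (summands I) a F (l, (x, y)) = (if l \<in> I \<and> y < mult_dim l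
     then \<Sum>y'<mult_dim l. F (l, (x, y')) * coef a (enum l y') (enum l y) else 0)"
  by (simp add: summands_def direct_sum_def outer_tensor_def mult_module_def)

text \<open>The isomorphism in the direction from the direct sum to tensor space, where
  compatibility with the actions comes straight from \<open>phi_equivariant\<close> and
  \<open>act_r_phi\<close>.\<close>

definition assemble :: "(nat list \<times> (nat \<Rightarrow> nat set) \<times> nat \<Rightarrow> complex) \<Rightarrow> 'w \<Rightarrow> complex" where
  "assemble F = (\<Sum>p\<in>P. \<phi> p (\<lambda>x. F (sh p, (x, slot p))))"

abbreviation slice :: "(nat list \<times> (nat \<Rightarrow> nat set) \<times> nat \<Rightarrow> complex) \<Rightarrow> 'p \<Rightarrow> (nat \<Rightarrow> nat set) \<Rightarrow> complex" where
  "slice F p \<equiv> (\<lambda>x. F (sh p, (x, slot p)))"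

lemma perm_action_in:
  assumes v: "v \<in> S l" shows "perm_action m (tabloids m l) tact a v \<in> S l"
  unfolding tab.perm_action_eq
  by (rule cfun.span_sum, rule cfun.span_scale) (use rep_specht_space[OF _ v] in \<open>simp add: sym_group_def\<close>)

text \<open>The group acts slice by slice, as the \<open>\<phi>\<close> are equivariant. The right
  action mixes only slices of equal shape, by the matrix \<open>coef\<close>, in the same way as
  \<open>act_r_phi\<close> mixes the copies in tensor space.\<close>

lemma duality:
  assumes I: "I = sh ` P"
  shows "bimodule_isomorphic (group_algebra (sym_group m)) alg_r
      \<lparr>bspace = free_space W, lact = perm_action m W act, ract = act_r\<rparr> (summands I)"
proof (rule bimodule_isomorphicI[where J = assemble])
  let ?M = "\<lparr>bspace = free_space W, lact = perm_action m W act, ract = act_r\<rparr>" and ?N = "summands I"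
  interpret G: based_action "carrier (sym_group m)" "monoid.mult (sym_group m)" "\<lambda>_ _. 1" "one (sym_group m)"
      "free_space W" rep "perm_action m W act"
    by (rule perm_based_action) (simp_all add: rep_in)
  show "algebra_closed (group_algebra (sym_group m))" using G.algebra_closed_alg by (simp add: group_algebra_def)
  show "algebra_closed alg_r" by (rule right.algebra_closed_alg)
  have self: "perm_rep m W act" by unfold_locales
  have "act_r b (perm_action m W act a w) = perm_action m W act a (act_r b w)"
    if "b \<in> free_space B" "w \<in> free_space W" for a b w
    by (rule equivariant_perm_action[OF act_r_equivariant[OF that(1)] subspace_free_space _ that(2) self self]) (rule rep_in)
  then show "bimodule (group_algebra (sym_group m)) alg_r ?M"
    unfolding bimodule_def using perm_left_module[of "free_space W"] right_module_tensor rep_in by (simp add: carrier_alg_r)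
  have slice_in: "slice F p \<in> S (sh p)" if "F \<in> bspace ?N" "p \<in> P" for F p
    using that I unfolding summands_space by blast
  have slices: "(\<lambda>x. (F + G) (l, (x, y))) = (\<lambda>x. F (l, (x, y))) + (\<lambda>x. G (l, (x, y)))"
    "(\<lambda>x. fscale c F (l, (x, y))) = fscale c (\<lambda>x. F (l, (x, y)))"
    for F G :: "nat list \<times> (nat \<Rightarrow> nat set) \<times> nat \<Rightarrow> complex" and l y c by (simp_all add: fun_eq_iff)
  show subN: "cfun.subspace (bspace ?N)"
  proof (rule cfun.subspaceI)
    have "(\<lambda>x. 0) \<in> S l" for l using cfun.span_zero[of "polytabloid m l ` tableaux m l"] by (simp only: zero_fun_def)
    then show "0 \<in> bspace ?N" by (simp add: summands_space)
    show "F + G \<in> bspace ?N" if "F \<in> bspace ?N" "G \<in> bspace ?N" for F G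
      using that unfolding summands_space mem_Collect_eq slices by (simp add: cfun.span_add)
    show "fscale c F \<in> bspace ?N" if "F \<in> bspace ?N" for c F
      using that unfolding summands_space mem_Collect_eq slices by (simp add: cfun.span_scale)
  qed
  show "linear_on (bspace ?N) assemble"
    unfolding linear_on_def
  proof (intro conjI ballI allI)
    fix F G assume FG: "F \<in> bspace ?N" "G \<in> bspace ?N"
    have "assemble (F + G) = (\<Sum>p\<in>P. \<phi> p (slice F p) + \<phi> p (slice G p))"
      unfolding assemble_def slices
      by (rule sum.cong) (use linear_on_add[OF phi_linear] slice_in FG in auto)
    then show "assemble (F + G) = assemble F + assemble G" by (simp add: assemble_def sum.distrib)
  next
    fix c F assume F: "F \<in> bspace ?N"
    have "assemble (fscale c F) = (\<Sum>p\<in>P. fscale c (\<phi> p (slice F p)))"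
      unfolding assemble_def slices
      by (rule sum.cong) (use linear_on_scale[OF phi_linear] slice_in F in auto)
    then show "assemble (fscale c F) = fscale c (assemble F)" by (simp add: assemble_def cfun.scale_sum_right)
  qed
  have asm_in: "assemble F \<in> free_space W" if "F \<in> bspace ?N" for F
    unfolding assemble_def by (rule cfun.subspace_sum[OF subspace_free_space]) (rule phi_in[OF _ slice_in[OF that]])
  show "bij_betw assemble (bspace ?N) (bspace ?M)"
  proof (rule bij_betw_imageI)
    show "inj_on assemble (bspace ?N)"
    proof (rule inj_onI)
      fix F G assume F: "F \<in> bspace ?N" and G: "G \<in> bspace ?N" and e: "assemble F = assemble G"
      have sl: "slice F p = slice G p" if p: "p \<in> P" for p
        by (rule jointly_inj_unique[OF phi_inj cfun.subspace_span phi_linear slice_in[OF F] slice_in[OF G] _ p])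
          (use e in \<open>simp_all add: assemble_def\<close>)
      show "F = G"
      proof
        fix z :: "nat list \<times> (nat \<Rightarrow> nat set) \<times> nat"
        obtain l x y where z: "z = (l, (x, y))" by (metis surj_pair)
        show "F z = G z"
        proof (cases "l \<in> I \<and> y < mult_dim l")
          case True
          then have "enum l y \<in> P" "sh (enum l y) = l" "slot (enum l y) = y" using enum_in slot_enum by auto
          then show ?thesis using fun_cong[OF sl[of "enum l y"], of x] by (simp add: z)
        next
          case False
          then have "F z = 0" "G z = 0" using F G unfolding summands_space z by (auto simp: not_less)
          then show ?thesis by simp
        qed
      qed
    qed
    show "assemble ` bspace ?N = bspace ?M"
    proof
      show "assemble ` bspace ?N \<subseteq> bspace ?M" using asm_in by auto
      show "bspace ?M \<subseteq> assemble ` bspace ?N"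
      proof
        fix w assume "w \<in> bspace ?M"
        then have w: "w \<in> free_space W" by simp
        \<comment> \<open>The preimage of \<open>w\<close> has the coordinates of \<open>w\<close>
          as its slices, filed under shape and number.\<close>
        define F where "F = (\<lambda>(l, x, y). if l \<in> I \<and> y < mult_dim l then dec w (enum l y) x else 0)"
        have "(\<lambda>x. F (l, (x, y))) \<in> S l" if "l \<in> I" for l y
        proof (cases "y < mult_dim l")
          case True
          have "(\<lambda>x. F (l, (x, y))) = dec w (enum l y)" using that True by (simp add: F_def)
          then show ?thesis using dec(1)[OF w enum_in(1)[OF True]] enum_in(2)[OF True] by simp
        next
          case False
          then have "(\<lambda>x. F (l, (x, y))) = 0" by (simp add: F_def fun_eq_iff)
          then show ?thesis using cfun.span_zero by simp
        qed
        then have "F \<in> bspace ?N" unfolding summands_space by (auto simp: F_def)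
        moreover have "assemble F = w"
        proof -
          have "slice F p = dec w p" if "p \<in> P" for p
            using slot[OF that] that I by (auto simp: F_def)
          then have "assemble F = (\<Sum>p\<in>P. \<phi> p (dec w p))" unfolding assemble_def by (intro sum.cong) auto
          then show ?thesis using dec(2)[OF w] by simp
        qed
        ultimately show "w \<in> assemble ` bspace ?N" by blast
      qed
    qed
  qed
  have lslice: "(\<lambda>x. lact ?N a F (l, (x, y))) = perm_action m (tabloids m l) tact a (\<lambda>x. F (l, (x, y)))" if "l \<in> I" for a F l y
    using that by (simp add: summands_lact)
  have lact0: "perm_action m (tabloids m l) tact a (\<lambda>x. 0) = 0" for a l
  proof -
    have "perm_action m (tabloids m l) tact a 0 = 0"
      by (simp add: tab.perm_action_eq push_zero)
    then show ?thesis by (simp only: zero_fun_def)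
  qed
  show "lact ?N a F \<in> bspace ?N" if F: "F \<in> bspace ?N" for a F
    unfolding summands_space mem_Collect_eq
  proof (intro conjI ballI allI impI)
    show "(\<lambda>x. lact ?N a F (l, (x, y))) \<in> S l" if "l \<in> I" for l y
      unfolding lslice[OF that] by (rule perm_action_in) (use F that in \<open>simp add: summands_space\<close>)
    show "lact ?N a F (l, (x, y)) = 0" if "l \<notin> I \<or> mult_dim l \<le> y" for l x y
    proof (cases "l \<in> I")
      case True
      then have "(\<lambda>x. F (l, (x, y))) = (\<lambda>x. 0)" using F that by (auto simp: summands_space)
      then show ?thesis using lact0 by (simp add: summands_lact)
    qed (simp add: summands_lact)
  qed
  show "assemble (lact ?N a F) = lact ?M a (assemble F)" if F: "F \<in> bspace ?N" for a F
  proof -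
    have "assemble (lact ?N a F) = (\<Sum>p\<in>P. \<phi> p (perm_action m (tabloids m (sh p)) tact a (slice F p)))"
      unfolding assemble_def by (rule sum.cong) (use lslice I in auto)
    also have "\<dots> = (\<Sum>p\<in>P. perm_action m W act a (\<phi> p (slice F p)))"
    proof (rule sum.cong[OF refl])
      fix p assume p: "p \<in> P"
      show "\<phi> p (perm_action m (tabloids m (sh p)) tact a (slice F p)) = perm_action m W act a (\<phi> p (slice F p))"
        by (rule equivariant_perm_action[OF phi_equivariant[OF p] cfun.subspace_span rep_specht_space slice_in[OF F p] tab.perm_rep_axioms self])
    qed
    also have "\<dots> = perm_action m W act a (assemble F)"
      unfolding assemble_def perm_action_eq
      by (simp add: push_sum cfun.scale_sum_right sum.swap[of _ _ "carrier (sym_group m)"])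
    finally show ?thesis by simp
  qed
  have rslice: "slice (ract ?N b F) p = (\<Sum>p'\<in>Psh (sh p). fscale (coef b p' p) (slice F p'))" if p: "p \<in> P" for b F p
  proof
    fix x
    have "slice (ract ?N b F) p x = (\<Sum>y'<mult_dim (sh p). F (sh p, (x, y')) * coef b (enum (sh p) y') p)"
      using p slot[OF p] I by (simp add: summands_ract)
    also have "\<dots> = (\<Sum>p'\<in>Psh (sh p). F (sh p, (x, slot p')) * coef b p' p)"
      by (rule sum_enum)
    also have "\<dots> = (\<Sum>p'\<in>Psh (sh p). fscale (coef b p' p) (slice F p')) x"
      unfolding sum_fun_apply by (rule sum.cong) (auto simp: mult.commute)
    finally show "slice (ract ?N b F) p x = (\<Sum>p'\<in>Psh (sh p). fscale (coef b p' p) (slice F p')) x" .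
  qed
  show "ract ?N b F \<in> bspace ?N" if F: "F \<in> bspace ?N" for b F
    unfolding summands_space mem_Collect_eq
  proof (intro conjI ballI allI impI)
    show "(\<lambda>x. ract ?N b F (l, (x, y))) \<in> S l" if l: "l \<in> I" for l y
    proof (cases "y < mult_dim l")
      case True
      have "(\<lambda>x. ract ?N b F (l, (x, y))) = (\<Sum>y'<mult_dim l. fscale (coef b (enum l y') (enum l y)) (\<lambda>x. F (l, (x, y'))))"
        using True l by (simp add: fun_eq_iff summands_ract sum_fun_apply mult.commute)
      moreover have "\<dots> \<in> S l"
        by (rule cfun.span_sum, rule cfun.span_scale) (use F l in \<open>simp add: summands_space\<close>)
      ultimately show ?thesis by simp
    next
      case False
      then have "(\<lambda>x. ract ?N b F (l, (x, y))) = 0" by (simp add: summands_ract fun_eq_iff)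
      then show ?thesis using cfun.span_zero by simp
    qed
    show "ract ?N b F (l, (x, y)) = 0" if "l \<notin> I \<or> mult_dim l \<le> y" for l x y
      using that by (auto simp: summands_ract)
  qed
  show "assemble (ract ?N b F) = ract ?M b (assemble F)" if "b \<in> carrier alg_r" and F: "F \<in> bspace ?N" for b F
  proof -
    have b: "b \<in> free_space B" using that carrier_alg_r by simp
    have "assemble (ract ?N b F) = (\<Sum>p\<in>P. \<Sum>p'\<in>Psh (sh p). fscale (coef b p' p) (\<phi> p (slice F p')))"
      unfolding assemble_def
    proof (rule sum.cong[OF refl])
      fix p assume p: "p \<in> P"
      have sl: "slice F p' \<in> S (sh p)" if "p' \<in> Psh (sh p)" for p' using slice_in[OF F, of p'] that by simp
      have "\<phi> p (slice (ract ?N b F) p) = (\<Sum>p'\<in>Psh (sh p). \<phi> p (fscale (coef b p' p) (slice F p')))"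
        unfolding rslice[OF p]
        by (rule linear_on_sum[OF cfun.subspace_span phi_linear[OF p]], rule cfun.span_scale, rule sl)
      also have "\<dots> = (\<Sum>p'\<in>Psh (sh p). fscale (coef b p' p) (\<phi> p (slice F p')))"
        by (rule sum.cong[OF refl], rule linear_on_scale[OF phi_linear[OF p]], rule sl)
      finally show "\<phi> p (slice (ract ?N b F) p) = (\<Sum>p'\<in>Psh (sh p). fscale (coef b p' p) (\<phi> p (slice F p')))" .
    qed
    \<comment> \<open>The sum over pairs of equal shape is regrouped by source instead of target;
      the inner sum is then the right-hand side of \<open>act_r_phi\<close>.\<close>
    also have "\<dots> = (\<Sum>p'\<in>P. \<Sum>p | p \<in> P \<and> sh p' = sh p. fscale (coef b p' p) (\<phi> p (slice F p')))"
      by (rule sum.swap_restrict[OF fin_P fin_P])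
    also have "\<dots> = (\<Sum>p'\<in>P. act_r b (\<phi> p' (slice F p')))"
    proof (rule sum.cong[OF refl])
      fix p' assume p': "p' \<in> P"
      have "{p \<in> P. sh p' = sh p} = Psh (sh p')" by auto
      then show "(\<Sum>p | p \<in> P \<and> sh p' = sh p. fscale (coef b p' p) (\<phi> p (slice F p'))) = act_r b (\<phi> p' (slice F p'))"
        using act_r_phi[OF b p' slice_in[OF F p']] by simp
    qed
    also have "\<dots> = act_r b (assemble F)"
      unfolding assemble_def
      by (rule linear_on_sum[symmetric, OF subspace_free_space right.act_linear[OF b]]) (rule phi_in[OF _ slice_in[OF F]])
    finally show ?thesis by simp
  qed
qed

lemma duality_theorem:
  assumes "I = sh ` P"
  shows "\<exists>A :: nat list \<Rightarrow> ('b \<Rightarrow> complex, nat) amod.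
    (\<forall>l\<in>I. irreducible_right_module alg_r (A l) \<and> module_dim (A l) = card (Psh l)) \<and>
    bimodule_isomorphic (group_algebra (sym_group m)) alg_r
      \<lparr>bspace = free_space W, lact = perm_action m W act, ract = act_r\<rparr>
      (direct_sum I (\<lambda>l. outer_tensor (specht m l) (A l)))"
proof (intro exI conjI ballI)
  show "bimodule_isomorphic (group_algebra (sym_group m)) alg_r
      \<lparr>bspace = free_space W, lact = perm_action m W act, ract = act_r\<rparr>
      (direct_sum I (\<lambda>l. outer_tensor (specht m l) (mult_module l)))"
    using duality[OF assms] by (simp only: summands_def)
  fix l assume "l \<in> I"
  then obtain p where p: "p \<in> P" "sh p = l" using assms by blast
  show "irreducible_right_module alg_r (mult_module l)"
    by (rule mult_module_irreducible) (use p sh_part in auto)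
  show "module_dim (mult_module l) = card (Psh l)" by (rule mult_module_dim)
qed

end

section \<open>Schur-Weyl duality for the partition algebras\<close>

definition diagram_matrix :: "vertex set set \<Rightarrow> nat list \<Rightarrow> nat list \<Rightarrow> complex" where
  "diagram_matrix d u w = (if compatible d u w then 1 else 0)"

text \<open>The matrix product counts the middle words compatible with both diagrams; the free
  labels of the removed components are the source of the power of \<open>n\<close>.\<close>

lemma diagram_matrix_comp:
  assumes d: "d1 \<in> diagrams k" "d2 \<in> diagrams k" and u: "u \<in> words n k" and w: "w \<in> words n k"
  shows "(\<Sum>v\<in>words n k. diagram_matrix d1 u v * diagram_matrix d2 v w)
       = of_nat n ^ removed_components d1 d2 * diagram_matrix (diagram_comp d1 d2) u w"
proof -
  interpret stacked k d1 d2 using d by unfold_locales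
  have "(\<Sum>v\<in>words n k. diagram_matrix d1 u v * diagram_matrix d2 v w)
      = (\<Sum>v\<in>words n k. if compatible d1 u v \<and> compatible d2 v w then 1 else 0)"
    by (rule sum.cong) (auto simp: diagram_matrix_def)
  also have "\<dots> = of_nat (card {v \<in> words n k. compatible d1 u v \<and> compatible d2 v w})"
    by (simp add: sum.inter_filter[symmetric])
  finally show ?thesis by (simp add: count_middle_words[OF u w] diagram_matrix_def)
qed

lemma partition_action_apply:
  "partition_action n k a f w = (\<Sum>d\<in>diagrams k. a d * (\<Sum>u\<in>words n k. f u * (if w \<in> words n k then diagram_matrix d u w else 0)))"
proof -
  have "(\<Sum>v | v \<in> words n k \<and> compatible d u v. basis_vec v) w = (if w \<in> words n k then diagram_matrix d u w else 0)" for d u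
    by (simp add: sum_fun_apply basis_vec_apply diagram_matrix_def)
  then show ?thesis by (simp add: partition_action_def diagram_action_def sum_fun_apply)
qed

lemma words_snoc_n: "n > 0 \<Longrightarrow> w @ [n] \<in> words n (k + 1) \<longleftrightarrow> w \<in> words n k"
  using words_snoc[of w n n k] unfolding Suc_eq_plus1 by auto

lemma sum_tensor_last:
  assumes n: "n > 0"
  shows "(\<Sum>u\<in>words n (k + 1). tensor_last n k f u * g u) = (\<Sum>u\<in>words n k. f u * g (u @ [n]))"
proof -
  have "(\<Sum>u\<in>words n (k + 1). tensor_last n k f u * g u)
      = (\<Sum>u\<in>words n (k + 1). \<Sum>v\<in>words n k. if u = v @ [n] then f v * g u else 0)"
    unfolding tensor_last_def sum_fun_apply sum_distrib_right
    by (intro sum.cong) (auto simp: basis_vec_apply)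
  also have "\<dots> = (\<Sum>v\<in>words n k. \<Sum>u\<in>words n (k + 1). if u = v @ [n] then f v * g u else 0)"
    by (rule sum.swap)
  also have "\<dots> = (\<Sum>v\<in>words n k. f v * g (v @ [n]))"
    by (rule sum.cong) (use words_snoc_n[OF n] in auto)
  finally show ?thesis .
qed

lemma half_action_apply:
  assumes n: "n > 0" and a: "a \<in> free_space (half_diagrams k)"
  shows "half_action n k a f w = (\<Sum>d\<in>half_diagrams k. a d * (\<Sum>u\<in>words n k. f u *
      (if w \<in> words n k then diagram_matrix d (u @ [n]) (w @ [n]) else 0)))"
proof -
  have w: "w @ [n] \<in> words n (k + 1) \<longleftrightarrow> w \<in> words n k" by (rule words_snoc_n[OF n])
  have "half_action n k a f w = (\<Sum>d\<in>diagrams (k + 1). a d * (\<Sum>u\<in>words n k. f u *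
      (if w \<in> words n k then diagram_matrix d (u @ [n]) (w @ [n]) else 0)))"
    unfolding half_action_def partition_action_apply sum_tensor_last[OF n] w ..
  also have "\<dots> = (\<Sum>d\<in>half_diagrams k. a d * (\<Sum>u\<in>words n k. f u *
      (if w \<in> words n k then diagram_matrix d (u @ [n]) (w @ [n]) else 0)))"
    by (rule sum.mono_neutral_right) (use a in \<open>auto simp: half_diagrams_def free_space_def\<close>)
  finally show ?thesis .
qed

text \<open>The block containing both vertices \<open>k + 1\<close> copies the last letter
  \<open>n\<close> from top to bottom.\<close>

lemma half_compatible_last:
  assumes d: "d \<in> half_diagrams k" and u: "u \<in> words n k" and v: "v \<in> words n (k + 1)"
    and c: "compatible d (u @ [n]) v"
  obtains v' where "v' \<in> words n k" "v = v' @ [n]"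
proof -
  obtain v' i where v': "v = v' @ [i]" "v' \<in> words n k" using v words_Suc_cases[of v n k] unfolding Suc_eq_plus1 by blast
  obtain b where b: "b \<in> d" "Top (k + 1) \<in> b" "Bot (k + 1) \<in> b" using d by (auto simp: half_diagrams_def)
  have "vertex_label (u @ [n]) v (Top (k + 1)) = vertex_label (u @ [n]) v (Bot (k + 1))"
    using c b unfolding compatible_def by blast
  then have "i = n" using v' u by (simp add: words_def nth_append)
  then show ?thesis using that v' by blast
qed

lemma half_diagrams_subset: "half_diagrams k \<subseteq> diagrams (k + 1)"
  by (auto simp: half_diagrams_def)

text \<open>The sum over the middle words ending in \<open>n\<close> equals the sum over all middle
  words of length \<open>k + 1\<close>, since \<open>d1\<close> forces the last letter to be
  \<open>n\<close>; so the product formula for integer level applies.\<close>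

lemma half_diagram_matrix_comp:
  assumes n: "n > 0" and d: "d1 \<in> half_diagrams k" "d2 \<in> half_diagrams k"
    and u: "u \<in> words n k" and w: "w \<in> words n k"
  shows "(\<Sum>v\<in>words n k. diagram_matrix d1 (u @ [n]) (v @ [n]) * diagram_matrix d2 (v @ [n]) (w @ [n]))
       = of_nat n ^ removed_components d1 d2 * diagram_matrix (diagram_comp d1 d2) (u @ [n]) (w @ [n])"
proof -
  let ?g = "\<lambda>v. diagram_matrix d1 (u @ [n]) v * diagram_matrix d2 v (w @ [n])"
  have snoc: "v @ [n] \<in> words n (k + 1)" if "v \<in> words n k" for v using words_snoc_n[OF n] that by blast
  have "(\<Sum>v\<in>words n k. ?g (v @ [n])) = (\<Sum>v\<in>(\<lambda>v. v @ [n]) ` words n k. ?g v)"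
    by (subst sum.reindex) (auto simp: inj_on_def)
  also have "\<dots> = (\<Sum>v\<in>words n (k + 1). ?g v)"
  proof (rule sum.mono_neutral_left)
    show "(\<lambda>v. v @ [n]) ` words n k \<subseteq> words n (k + 1)" using snoc by blast
    show "\<forall>v\<in>words n (k + 1) - (\<lambda>v. v @ [n]) ` words n k. ?g v = 0"
    proof
      fix v assume v: "v \<in> words n (k + 1) - (\<lambda>v. v @ [n]) ` words n k"
      have "\<not> compatible d1 (u @ [n]) v"
      proof
        assume "compatible d1 (u @ [n]) v"
        then obtain v' where "v' \<in> words n k" "v = v' @ [n]"
          using half_compatible_last[OF d(1) u] v by blast
        then show False using v by blast
      qed
      then show "?g v = 0" by (simp add: diagram_matrix_def)
    qed
  qed simp
  also have "\<dots> = of_nat n ^ removed_components d1 d2 * diagram_matrix (diagram_comp d1 d2) (u @ [n]) (w @ [n])"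
    by (rule diagram_matrix_comp) (use d half_diagrams_subset snoc u w in blast)+
  finally show ?thesis .
qed

text \<open>Pairs of words with the same kernel lie in one orbit, so an invariant matrix is a
  function of the kernel.\<close>

lemma invariant_matrix_expansion:
  assumes inv: "\<And>\<sigma> u w. \<sigma> permutes {1..n} \<Longrightarrow> u \<in> words n k \<Longrightarrow> w \<in> words n k \<Longrightarrow> t (map \<sigma> u) (map \<sigma> w) = t u w"
  shows "\<exists>a\<in>free_space (diagrams k). \<forall>u\<in>words n k. \<forall>w\<in>words n k. t u w = (\<Sum>d\<in>diagrams k. a d * diagram_matrix d u w)"
proof -
  have "\<exists>a\<in>free_space (diagrams k). \<forall>(u, w)\<in>words n k \<times> words n k. t u w = (\<Sum>d\<in>diagrams k. if compatible d u w then a d else 0)"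
  proof (rule kernel_expansion)
    fix u w u' w'
    assume "(u, w) \<in> words n k \<times> words n k" "(u', w') \<in> words n k \<times> words n k"
      and "kernel_partition k u w = kernel_partition k u' w'"
    then obtain \<sigma> where "\<sigma> permutes {1..n}" "map \<sigma> u = u'" "map \<sigma> w = w'" "u \<in> words n k" "w \<in> words n k"
      using kernel_partition_orbit[of u n k w u' w'] by auto
    then show "t u w = t u' w'" using inv by metis
  qed (auto simp: kernel_partition_in)
  then obtain a where "a \<in> free_space (diagrams k)"
      "\<And>u w. u \<in> words n k \<Longrightarrow> w \<in> words n k \<Longrightarrow> t u w = (\<Sum>d\<in>diagrams k. if compatible d u w then a d else 0)"
    by blast
  then show ?thesis
    by (intro bexI[of _ a] ballI) (auto simp: diagram_matrix_def if_distrib cong: if_cong)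
qed

text \<open>The integer case for the pairs \<open>(u @ [n], w @ [n])\<close>: the kernel of such a
  pair joins the two vertices \<open>k + 1\<close>, so it is a half diagram, and a permutation
  carrying one such pair to another fixes \<open>n\<close>.\<close>

lemma half_invariant_matrix_expansion:
  assumes n: "n > 0"
    and inv: "\<And>\<sigma> u w. \<sigma> permutes {1..n - 1} \<Longrightarrow> u \<in> words n k \<Longrightarrow> w \<in> words n k \<Longrightarrow> t (map \<sigma> u) (map \<sigma> w) = t u w"
  shows "\<exists>a\<in>free_space (half_diagrams k). \<forall>u\<in>words n k. \<forall>w\<in>words n k.
      t u w = (\<Sum>d\<in>half_diagrams k. a d * diagram_matrix d (u @ [n]) (w @ [n]))"
proof -
  define Z where "Z = (\<lambda>(u, w). (u @ [n], w @ [n])) ` (words n k \<times> words n k)"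
  have snoc: "v @ [n] \<in> words n (k + 1)" if "v \<in> words n k" for v using words_snoc_n[OF n] that by blast
  have "\<exists>a\<in>free_space (half_diagrams k). \<forall>(x, y)\<in>Z. t (butlast x) (butlast y) = (\<Sum>d\<in>half_diagrams k. if compatible d x y then a d else 0)"
  proof (rule kernel_expansion[where k = "k + 1"])
    show "half_diagrams k \<subseteq> diagrams (k + 1)" by (rule half_diagrams_subset)
    fix x y assume "(x, y) \<in> Z"
    then obtain u w where xy: "x = u @ [n]" "y = w @ [n]" "u \<in> words n k" "w \<in> words n k" by (auto simp: Z_def)
    have lab: "vertex_label x y (Top (k + 1)) = n" "vertex_label x y (Bot (k + 1)) = n"
      using xy by (simp_all add: words_def nth_append)
    let ?b = "{z \<in> two_rows (k + 1). vertex_label x y z = vertex_label x y (Top (k + 1))}"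
    have "?b \<in> kernel_partition (k + 1) x y" unfolding kernel_partition_def by (rule imageI) auto
    moreover have "Top (k + 1) \<in> ?b" "Bot (k + 1) \<in> ?b" using lab by auto
    ultimately have "\<exists>b\<in>kernel_partition (k + 1) x y. Top (k + 1) \<in> b \<and> Bot (k + 1) \<in> b"
      by (intro bexI conjI)
    then show "kernel_partition (k + 1) x y \<in> half_diagrams k"
      unfolding half_diagrams_def mem_Collect_eq by (rule conjI[OF kernel_partition_in])
    fix x' y' assume "(x', y') \<in> Z" and ke: "kernel_partition (k + 1) x y = kernel_partition (k + 1) x' y'"
    then obtain u' w' where xy': "x' = u' @ [n]" "y' = w' @ [n]" "u' \<in> words n k" "w' \<in> words n k" by (auto simp: Z_def)
    obtain \<sigma> where s: "\<sigma> permutes {1..n}" "map \<sigma> x = x'" "map \<sigma> y = y'"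
      using kernel_partition_orbit[OF _ _ _ _ ke, of n] snoc xy xy' by blast
    then have e: "\<sigma> n = n" "map \<sigma> u = u'" "map \<sigma> w = w'" using xy xy' by simp_all
    have "\<sigma> permutes {1..n - 1}" by (rule permutes_fixes_pred[OF s(1) e(1)])
    then show "t (butlast x) (butlast y) = t (butlast x') (butlast y')"
      using inv[of \<sigma> u w] e xy xy' by simp
  qed
  then obtain a where a: "a \<in> free_space (half_diagrams k)"
      "\<And>x y. (x, y) \<in> Z \<Longrightarrow> t (butlast x) (butlast y) = (\<Sum>d\<in>half_diagrams k. if compatible d x y then a d else 0)"
    by blast
  have "t u w = (\<Sum>d\<in>half_diagrams k. a d * diagram_matrix d (u @ [n]) (w @ [n]))"
    if uw: "u \<in> words n k" "w \<in> words n k" for u w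
  proof -
    have "(u @ [n], w @ [n]) \<in> Z" using uw by (auto simp: Z_def)
    from a(2)[OF this] show ?thesis by (simp add: diagram_matrix_def if_distrib cong: if_cong)
  qed
  then show ?thesis using a(1) by blast
qed

lemma graph_level_eq_image: "n > 0 \<Longrightarrow> graph_level n s = last ` path_set n s"
proof
  assume n: "n > 0"
  show "graph_level n s \<subseteq> last ` path_set n s"
    using paths_nonempty[OF n, of s] by (fastforce simp: paths_eq)
qed (auto simp: path_set_last)

lemma partition_algebra_duality:
  assumes n: "n > 0"
  shows "\<exists>A :: nat list \<Rightarrow> (vertex set set \<Rightarrow> complex, nat) amod.
        (\<forall>l\<in>hat_A n k.
           irreducible_right_module (partition_algebra k n) (A l) \<and>
           module_dim (A l) = card (paths n (2 * k) l)) \<and>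
        bimodule_isomorphic (group_algebra (sym_group n)) (partition_algebra k n)
          (tensor_bimodule n k)
          (direct_sum (hat_A n k) (\<lambda>l. outer_tensor (specht n l) (A l)))"
proof -
  obtain \<phi> where fam: "tensor_family n (2 * k) \<phi>" using tensor_family_exists[OF n] by blast
  have lev: "level_size n (2 * k) = n" by (simp add: level_size_def)
  have half: "2 * k div 2 = k" by simp
  note F = fam[unfolded tensor_family_def lev half]
  interpret matrix_duality n "words n k" map "diagrams k" diagram_comp "\<lambda>d1 d2. of_nat n ^ removed_components d1 d2"
      "identity_diagram k" diagram_matrix "partition_action n k" "path_set n (2 * k)" last \<phi>
  proof
    show "diagram_comp a b \<in> diagrams k" if "a \<in> diagrams k" "b \<in> diagrams k" for a b
      using stacked.diagram_comp_in[of k a b] that by (simp add: stacked_def)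
    show "diagram_matrix (identity_diagram k) u w = (if u = w then 1 else 0)" if "u \<in> words n k" "w \<in> words n k" for u w
      using compatible_identity[OF that] by (simp add: diagram_matrix_def)
    show "diagram_matrix b (map \<sigma> u) (map \<sigma> w) = diagram_matrix b u w"
      if "b \<in> diagrams k" "\<sigma> permutes {1..n}" "u \<in> words n k" "w \<in> words n k" for b \<sigma> u w
      using compatible_map[OF that(2,1)] that(3,4) by (simp add: diagram_matrix_def words_def)
    show "\<exists>a\<in>free_space (diagrams k). \<forall>u\<in>words n k. \<forall>w\<in>words n k. t u w = (\<Sum>b\<in>diagrams k. a b * diagram_matrix b u w)"
      if "\<And>\<sigma> u w. \<sigma> permutes {1..n} \<Longrightarrow> u \<in> words n k \<Longrightarrow> w \<in> words n k \<Longrightarrow> t (map \<sigma> u) (map \<sigma> w) = t u w" for t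
      using invariant_matrix_expansion[of n k t] that by blast
    show "last p \<in> partitions n" if "p \<in> path_set n (2 * k)" for p
      using path_set_last_partitions[OF that] lev by simp
    show "\<phi> p v \<in> free_space (words n k)" if "p \<in> path_set n (2 * k)" "v \<in> specht_space n (last p)" for p v
      using F that by blast
    show "\<exists>x. (\<forall>p\<in>path_set n (2 * k). x p \<in> specht_space n (last p)) \<and> (\<Sum>p\<in>path_set n (2 * k). \<phi> p (x p)) = w"
      if "w \<in> free_space (words n k)" for w
      using tensor_family_surj[OF n fam, of w] that lev by simp
  qed (use F n in \<open>auto simp: identity_diagram_in diagram_matrix_comp partition_action_apply\<close>)
  have "hat_A n k = last ` path_set n (2 * k)"
    using graph_level_eq_image[OF n, of "2 * k"] by (simp add: graph_level_def)
  from duality_theorem[OF this] show ?thesis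
    by (simp only: paths_eq partition_algebra_def tensor_bimodule_def)
qed

lemma half_partition_algebra_duality:
  assumes n: "n > 0"
  shows "\<exists>A :: nat list \<Rightarrow> (vertex set set \<Rightarrow> complex, nat) amod.
        (\<forall>m\<in>hat_A_half n k.
           irreducible_right_module (half_partition_algebra k n) (A m) \<and>
           module_dim (A m) = card (paths n (2 * k + 1) m)) \<and>
        bimodule_isomorphic (group_algebra (sym_group (n - 1))) (half_partition_algebra k n)
          (half_tensor_bimodule n k)
          (direct_sum (hat_A_half n k) (\<lambda>m. outer_tensor (specht (n - 1) m) (A m)))"
proof -
  let ?s = "2 * k + 1"
  obtain \<phi> where fam: "tensor_family n ?s \<phi>" using tensor_family_exists[OF n] by blast
  have lev: "level_size n ?s = n - 1" by (simp add: level_size_def)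
  have half: "?s div 2 = k" by simp
  note F = fam[unfolded tensor_family_def lev half]
  \<comment> \<open>The letters still range up to \<open>n\<close>; only the acting group is
    smaller.\<close>
  interpret words: perm_rep "n - 1" "words n k" map by (rule perm_rep_words) simp
  interpret matrix_duality "n - 1" "words n k" map "half_diagrams k" diagram_comp "\<lambda>d1 d2. of_nat n ^ removed_components d1 d2"
      "identity_diagram (k + 1)" "\<lambda>d u w. diagram_matrix d (u @ [n]) (w @ [n])" "half_action n k" "path_set n ?s" last \<phi>
  proof
    show "finite (half_diagrams k)" by (rule finite_subset[OF half_diagrams_subset finite_diagrams])
    show "diagram_matrix (identity_diagram (k + 1)) (u @ [n]) (w @ [n]) = (if u = w then 1 else 0)"
      if "u \<in> words n k" "w \<in> words n k" for u w
      using compatible_identity[of "u @ [n]" n "k + 1" "w @ [n]"] that words_snoc_n[OF n]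
      by (simp add: diagram_matrix_def)
    show "diagram_matrix b (map \<sigma> u @ [n]) (map \<sigma> w @ [n]) = diagram_matrix b (u @ [n]) (w @ [n])"
      if "b \<in> half_diagrams k" "\<sigma> permutes {1..n - 1}" "u \<in> words n k" "w \<in> words n k" for b \<sigma> u w
    proof -
      have "map \<sigma> u @ [n] = map \<sigma> (u @ [n])" "map \<sigma> w @ [n] = map \<sigma> (w @ [n])"
        using permutes_pred_fixes[OF that(2) n] by simp_all
      moreover have "b \<in> diagrams (k + 1)" using that(1) half_diagrams_subset by blast
      ultimately show ?thesis
        using compatible_map[OF permutes_pred[OF that(2)], of b "k + 1" "u @ [n]" "w @ [n]"] that(3,4)
        unfolding diagram_matrix_def by (simp only: words_def mem_Collect_eq length_append_singleton Suc_eq_plus1)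
    qed
    show "\<exists>a\<in>free_space (half_diagrams k). \<forall>u\<in>words n k. \<forall>w\<in>words n k.
        t u w = (\<Sum>b\<in>half_diagrams k. a b * diagram_matrix b (u @ [n]) (w @ [n]))"
      if "\<And>\<sigma> u w. \<sigma> permutes {1..n - 1} \<Longrightarrow> u \<in> words n k \<Longrightarrow> w \<in> words n k \<Longrightarrow> t (map \<sigma> u) (map \<sigma> w) = t u w" for t
      using half_invariant_matrix_expansion[OF n, of k t] that by blast
    show "last p \<in> partitions (n - 1)" if "p \<in> path_set n ?s" for p
      using path_set_last_partitions[OF that] lev by simp
    show "\<phi> p v \<in> free_space (words n k)" if "p \<in> path_set n ?s" "v \<in> specht_space (n - 1) (last p)" for p v
      using F that by blast
    show "\<exists>x. (\<forall>p\<in>path_set n ?s. x p \<in> specht_space (n - 1) (last p)) \<and> (\<Sum>p\<in>path_set n ?s. \<phi> p (x p)) = w"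
      if "w \<in> free_space (words n k)" for w
      using tensor_family_surj[OF n fam, of w] that lev by simp
    show "identity_diagram (k + 1) \<in> half_diagrams k" by (rule identity_half_diagram_in)
  qed (use F n in \<open>auto simp: half_diagram_comp_in half_diagram_matrix_comp half_action_apply simp del: One_nat_def\<close>)
  have "hat_A_half n k = last ` path_set n ?s"
    using graph_level_eq_image[OF n, of ?s] by (simp add: graph_level_def)
  from duality_theorem[OF this] show ?thesis
    by (simp only: paths_eq half_partition_algebra_def half_tensor_bimodule_def)
qed

theorem theorem3p22:
  fixes n k :: nat
  assumes "n > 0"
  shows
    "(\<exists>A :: nat list \<Rightarrow> (vertex set set \<Rightarrow> complex, nat) amod.
        (\<forall>l\<in>hat_A n k.
           irreducible_right_module (partition_algebra k n) (A l) \<and>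
           module_dim (A l) = card (paths n (2 * k) l)) \<and>
        bimodule_isomorphic (group_algebra (sym_group n)) (partition_algebra k n)
          (tensor_bimodule n k)
          (direct_sum (hat_A n k) (\<lambda>l. outer_tensor (specht n l) (A l)))) \<and>
     (\<exists>A :: nat list \<Rightarrow> (vertex set set \<Rightarrow> complex, nat) amod.
        (\<forall>m\<in>hat_A_half n k.
           irreducible_right_module (half_partition_algebra k n) (A m) \<and>
           module_dim (A m) = card (paths n (2 * k + 1) m)) \<and>
        bimodule_isomorphic (group_algebra (sym_group (n - 1))) (half_partition_algebra k n)
          (half_tensor_bimodule n k)
          (direct_sum (hat_A_half n k) (\<lambda>m. outer_tensor (specht (n - 1) m) (A m))))"
  using partition_algebra_duality[OF assms] half_partition_algebra_duality[OF assms] by blast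

end
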